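(* Let $\mathbb{X}$ be a rank one Riemannian symmetric space of compact type, and let $\psi_1,\psi_2:[0,\infty)\to\mathbb{R}$ be continuous. If the dispersive equations $i\frac{\partial u}{\partial t}-\psi_j\left(\sqrt{-\Delta}\right)u=0$ ($j=1,2$) on $\mathbb{X}\times[0,2\pi)$ are of comparable oscillation, i.e. there exist $R>0$ and $C>0$ such that $$|\psi_1(r)-\psi_2(r)|\le C\quad\text{for all } r>R,$$ then they are transferrable, i.e. they are both $(\psi_1,\psi_2)$-transferrable and $(\psi_2,\psi_1)$-transferrable.
   Context: The rank one Riemannian symmetric spaces of compact type $\mathbb{X}=U/K$ are, with $d$ the real dimension: $\mathbb{S}^d$ ($d\ge1$), $P^d(\mathbb{R})$ ($d\ge2$), $P^d(\mathbb{C})$ ($d=4,6,8,\dots$), $P^d(\mathbb{H})$ ($d=8,12,16,\dots$), $P^{16}(Cay)$. The metric is normalized so that the diameter is $\pi$, and the Riemannian measure so that $\mathbb{X}$ has total measure $1$. $\Delta$ is the Laplace-Beltrami operator. Fix an origin $o\in\mathbb{X}$; $K$ is the stabilizer of $o$. $K$-biinvariant functions on $U$ are identified with functions on $\mathbb{X}$ that are radial around $o$, i.e. depend only on $\theta=d(o,x)\in[0,\pi]$. The eigenvalues of $-\Delta$ are $\lambda_n^2=n(n+\sigma+\tau+1)$, $n=0,1,2,\dots$ ($\lambda_n\ge0$), where $\sigma=\frac{d-2}{2}$ and $\tau=\frac{d-2}{2},-\frac12,0,1,3$ for $\mathbb{S}^d,P^d(\mathbb{R}),P^d(\mathbb{C}),P^d(\mathbb{H}),P^{16}(Cay)$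 respectively. The radial functions in the $n$-th eigenspace form a line spanned by $\tilde Z_n$, the $L^2(\mathbb{X})$-normalized positive multiple of $x\mapsto P_n^{(\sigma,\tau)}(\cos d(o,x))$, with $P_n^{(\sigma,\tau)}$ the Jacobi polynomial. A $K$-biinvariant $f\in C^\infty(\mathbb{X})$ has the absolutely and uniformly convergent expansion $f=\sum_{n\ge0}a_n\tilde Z_n$, with $\|f\|_{H^\alpha(\mathbb{X})}=\big(\sum_{n\ge0}(1+\lambda_n^2)^\alpha|a_n|^2\big)^{1/2}$ for $\alpha\ge 0$, and $e^{-it\psi(\sqrt{-\Delta})}f=\sum_n e^{-it\psi(\lambda_n)}a_n\tilde Z_n$. Definition. The equations for $\psi_1,\psi_2$ are called $(\psi_1,\psi_2)$-transferrable if the following implication holds: whenever, for some $\alpha_0>0$ and some $p\in[1,\infty]$, for every $\alpha>\alpha_0$ there is $C(\alpha)>0$ with $$\Big\|\sup_{0\le t<2\pi}\big|e^{-it\psi_1(\sqrt{-\Delta})}f\big|\Big\|_{L^p(\mathbb{X})}\le C(\alpha)\|f\|_{H^\alpha(\mathbb{X})}\quad\text{for all }K\text{-biinvariant }f\in C^\infty(\mathbb{X}),$$ it follows (with the same $\alpha_0$ and $p$) that for every $\alpha>\alpha_0$ there is $C'(\alpha)>0$ with $$\Big\|\sup_{0\le t<2\pi}\big|e^{-it\psi_2(\sqrt{-\Delta})}f\big|\Big\|_{L^p(\mathbb{X})}\le C'(\alpha)\|f\|_{H^\alpha(\mathbb{X})}\quad\text{for all }K\text{-biinvariant }f\in C^\infty(\mathbb{X}).$$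 $(\psi_2,\psi_1)$-transferrable is defined with the roles exchanged. *)

theory Defs
  imports "HOL-Probability.Probability"
begin

text \<open>
  The rank one symmetric spaces of compact type are realised by their standard isometric (up to
  a constant factor) embeddings: \<open>S\<^sup>d\<close> as a unit sphere, and the projective spaces over
  \<open>F = R, C, H, O\<close> as the Hermitian idempotent matrices of trace 1 with entries in \<open>F\<close>
  (\<open>3 \<times> 3\<close> matrices for the Cayley plane). For \<open>F = R, C, H\<close> a line is identified with the
  orthogonal projection onto it.

  \<open>geo_dist\<close> is the geodesic distance, normalised to diameter \<open>\<pi>\<close>; \<open>rdim\<close> is the real dimension;
  \<open>rtau\<close> is the second Jacobi parameter of the space.
\<close>

record 'e symspace =
  points :: "'e set"
  geo_dist :: "'e \<Rightarrow> 'e \<Rightarrow> real"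
  rdim :: nat
  rtau :: real

definition rsigma :: "'e symspace \<Rightarrow> real" where
  "rsigma X = (real (rdim X) - 2) / 2"


section \<open>The spaces\<close>

definition sphere_space :: "(real ^ 'n) symspace" where
  "sphere_space = (let d = CARD('n) - 1 in
     \<lparr> points = {x. norm x = 1},
       geo_dist = (\<lambda>x y. arccos (x \<bullet> y)),
       rdim = d,
       rtau = (real d - 2) / 2 \<rparr>)"

text \<open>Cayley--Dickson doubling: quaternions from the complex numbers, octonions from quaternions.\<close>

type_synonym quat = "complex \<times> complex"
type_synonym oct = "quat \<times> quat"

definition cd_mult :: "('f \<Rightarrow> 'f \<Rightarrow> 'f::ab_group_add) \<Rightarrow> ('f \<Rightarrow> 'f) \<Rightarrow> 'f \<times> 'f \<Rightarrow> 'f \<times> 'f \<Rightarrow> 'f \<times> 'f" where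
  "cd_mult m c x y =
     (m (fst x) (fst y) - m (c (snd y)) (snd x), m (snd y) (fst x) + m (snd x) (c (fst y)))"

definition cd_cnj :: "('f::ab_group_add \<Rightarrow> 'f) \<Rightarrow> 'f \<times> 'f \<Rightarrow> 'f \<times> 'f" where
  "cd_cnj c x = (c (fst x), - snd x)"

definition quat_mult :: "quat \<Rightarrow> quat \<Rightarrow> quat" where
  "quat_mult = cd_mult (*) cnj"

definition quat_cnj :: "quat \<Rightarrow> quat" where
  "quat_cnj = cd_cnj cnj"

definition oct_mult :: "oct \<Rightarrow> oct \<Rightarrow> oct" where
  "oct_mult = cd_mult quat_mult quat_cnj"

definition oct_cnj :: "oct \<Rightarrow> oct" where
  "oct_cnj = cd_cnj quat_cnj"

definition rank_one_projections ::
    "('f \<Rightarrow> 'f \<Rightarrow> 'f) \<Rightarrow> ('f \<Rightarrow> 'f) \<Rightarrow> 'f \<Rightarrow> ('f::euclidean_space ^ 'n ^ 'n) set" where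
  "rank_one_projections m c e =
     {p. (\<forall>i j. p $ j $ i = c (p $ i $ j)) \<and>
         (\<forall>i j. (\<Sum>k\<in>UNIV. m (p $ i $ k) (p $ k $ j)) = p $ i $ j) \<and>
         (\<Sum>i\<in>UNIV. p $ i $ i) = e}"

text \<open>
  On Hermitian matrices \<open>p \<bullet> q\<close> is the real part of the trace of \<open>p q\<close>. For the projections onto the
  lines spanned by unit vectors \<open>x\<close>, \<open>y\<close> it equals \<open>|\<langle>x,y\<rangle>|\<^sup>2\<close>, so the distance below is
  \<open>2 arccos |\<langle>x,y\<rangle>|\<close>, the Fubini--Study distance scaled to diameter \<open>\<pi>\<close>. The parameter \<open>e\<close> is the
  unit of the coefficient algebra.
\<close>

definition projective_space ::
    "('f \<Rightarrow> 'f \<Rightarrow> 'f) \<Rightarrow> ('f \<Rightarrow> 'f) \<Rightarrow> 'f \<Rightarrow> real \<Rightarrow> ('f::euclidean_space ^ 'n ^ 'n) symspace" where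
  "projective_space m c e t =
     \<lparr> points = rank_one_projections m c e,
       geo_dist = (\<lambda>p q. arccos (2 * (p \<bullet> q) - 1)),
       rdim = DIM('f) * (CARD('n) - 1),
       rtau = t \<rparr>"

definition real_projective :: "(real ^ 'n ^ 'n) symspace" where
  "real_projective = projective_space (*) (\<lambda>x. x) 1 (- 1 / 2)"

definition complex_projective :: "(complex ^ 'n ^ 'n) symspace" where
  "complex_projective = projective_space (*) cnj 1 0"

definition quat_projective :: "(quat ^ 'n ^ 'n) symspace" where
  "quat_projective = projective_space quat_mult quat_cnj (1, 0) 1"

definition cayley_plane :: "(oct ^ 3 ^ 3) symspace" where
  "cayley_plane = projective_space oct_mult oct_cnj ((1, 0), 0) 3"


section \<open>Riemannian measure\<close>

text \<open>
  The Riemannian measure of an embedded \<open>d\<close>-dimensional submanifold is its \<open>d\<close>-dimensional Hausdorff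
  measure. The usual dimensional constant in the latter, and the scaling between the Euclidean
  metric and \<open>geo_dist\<close>, disappear when the total mass is normalised to 1.
\<close>

definition hausdorff_measure :: "nat \<Rightarrow> 'e::metric_space set \<Rightarrow> ennreal" where
  "hausdorff_measure d A =
     (SUP \<delta>\<in>{0::real<..}. INF U\<in>{U :: nat \<Rightarrow> 'e set.
          A \<subseteq> (\<Union>i. U i) \<and> (\<forall>i. bounded (U i) \<and> diameter (U i) \<le> \<delta>)}.
        (\<Sum>i. ennreal (diameter (U i) ^ d)))"

definition riem_measure :: "'e::euclidean_space symspace \<Rightarrow> 'e measure" where
  "riem_measure X = measure_of (points X) (sets (restrict_space borel (points X)))
     (\<lambda>A. hausdorff_measure (rdim X) A / hausdorff_measure (rdim X) (points X))"


section \<open>Function spaces\<close>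

primrec C_k :: "nat \<Rightarrow> ('e::euclidean_space \<Rightarrow> complex) \<Rightarrow> bool" where
  "C_k 0 f \<longleftrightarrow> continuous_on UNIV f"
| "C_k (Suc k) f \<longleftrightarrow>
     (\<forall>x. f differentiable (at x)) \<and> (\<forall>v. C_k k (\<lambda>x. frechet_derivative f (at x) v))"

text \<open>
  Only the values on \<open>points X\<close> of the functions below are meaningful. Since \<open>points X\<close> is a compact
  submanifold, a function on it is smooth iff it extends to a smooth function on the ambient space.
\<close>

definition smooth_fun :: "'e::euclidean_space symspace \<Rightarrow> ('e \<Rightarrow> complex) \<Rightarrow> bool" where
  "smooth_fun X f \<longleftrightarrow> (\<exists>g. (\<forall>k. C_k k g) \<and> (\<forall>x\<in>points X. f x = g x))"

definition radial :: "'e symspace \<Rightarrow> 'e \<Rightarrow> ('e \<Rightarrow> complex) \<Rightarrow> bool" where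
  "radial X b f \<longleftrightarrow> (\<exists>F. \<forall>x\<in>points X. f x = F (geo_dist X b x))"

definition ennreal_powr :: "ennreal \<Rightarrow> real \<Rightarrow> ennreal" where
  "ennreal_powr x r = (if x = \<top> then \<top> else ennreal (enn2real x powr r))"

definition Lp_norm :: "'a measure \<Rightarrow> ennreal \<Rightarrow> ('a \<Rightarrow> ennreal) \<Rightarrow> ennreal" where
  "Lp_norm M p g =
     (if p = \<top> then esssup M g
      else ennreal_powr (\<integral>\<^sup>+ x. ennreal_powr (g x) (enn2real p) \<partial>M) (1 / enn2real p))"


section \<open>Radial harmonic analysis\<close>

definition jacobi_poly :: "real \<Rightarrow> real \<Rightarrow> nat \<Rightarrow> real \<Rightarrow> real" where
  "jacobi_poly \<alpha> \<beta> n x =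
     (\<Sum>s\<le>n. ((real n + \<alpha>) gchoose (n - s)) * ((real n + \<beta>) gchoose s) *
        ((x - 1) / 2) ^ s * ((x + 1) / 2) ^ (n - s))"

definition eig :: "'e symspace \<Rightarrow> nat \<Rightarrow> real" where
  "eig X n = sqrt (real n * (real n + rsigma X + rtau X + 1))"

definition zonal0 :: "'e symspace \<Rightarrow> 'e \<Rightarrow> nat \<Rightarrow> 'e \<Rightarrow> real" where
  "zonal0 X b n x = jacobi_poly (rsigma X) (rtau X) n (cos (geo_dist X b x))"

definition zonal :: "'e::euclidean_space symspace \<Rightarrow> 'e \<Rightarrow> nat \<Rightarrow> 'e \<Rightarrow> real" where
  "zonal X b n x = zonal0 X b n x / sqrt (\<integral>y. (zonal0 X b n y)\<^sup>2 \<partial>riem_measure X)"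

definition zcoeff :: "'e::euclidean_space symspace \<Rightarrow> 'e \<Rightarrow> ('e \<Rightarrow> complex) \<Rightarrow> nat \<Rightarrow> complex" where
  "zcoeff X b f n = (\<integral>x. f x * complex_of_real (zonal X b n x) \<partial>riem_measure X)"

definition sobolev_norm :: "'e::euclidean_space symspace \<Rightarrow> 'e \<Rightarrow> real \<Rightarrow> ('e \<Rightarrow> complex) \<Rightarrow> ennreal" where
  "sobolev_norm X b \<alpha> f =
     ennreal_powr (\<Sum>n. ennreal ((1 + (eig X n)\<^sup>2) powr \<alpha> * (cmod (zcoeff X b f n))\<^sup>2)) (1 / 2)"

text \<open>\<open>propagator X b \<psi> t f\<close> is \<open>exp (- i t \<psi> (sqrt (- \<Delta>))) f\<close>.\<close>

definition propagator ::
    "'e::euclidean_space symspace \<Rightarrow> 'e \<Rightarrow> (real \<Rightarrow> real) \<Rightarrow> real \<Rightarrow> ('e \<Rightarrow> complex) \<Rightarrow> 'e \<Rightarrow> complex" where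
  "propagator X b \<psi> t f x =
     (\<Sum>n. exp (- \<i> * complex_of_real (t * \<psi> (eig X n))) * zcoeff X b f n *
        complex_of_real (zonal X b n x))"

definition maximal_fun ::
    "'e::euclidean_space symspace \<Rightarrow> 'e \<Rightarrow> (real \<Rightarrow> real) \<Rightarrow> ('e \<Rightarrow> complex) \<Rightarrow> 'e \<Rightarrow> ennreal" where
  "maximal_fun X b \<psi> f x = (SUP t\<in>{0..<2 * pi}. ennreal (cmod (propagator X b \<psi> t f x)))"


section \<open>Transference\<close>

definition maximal_estimates ::
    "'e::euclidean_space symspace \<Rightarrow> 'e \<Rightarrow> (real \<Rightarrow> real) \<Rightarrow> real \<Rightarrow> ennreal \<Rightarrow> bool" where
  "maximal_estimates X b \<psi> \<alpha>0 p \<longleftrightarrow>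
     (\<forall>\<alpha>>\<alpha>0. \<exists>C>0. \<forall>f. smooth_fun X f \<and> radial X b f \<longrightarrow>
        Lp_norm (riem_measure X) p (maximal_fun X b \<psi> f) \<le> ennreal C * sobolev_norm X b \<alpha> f)"

definition transferrable ::
    "'e::euclidean_space symspace \<Rightarrow> 'e \<Rightarrow> (real \<Rightarrow> real) \<Rightarrow> (real \<Rightarrow> real) \<Rightarrow> bool" where
  "transferrable X b \<psi>1 \<psi>2 \<longleftrightarrow>
     (\<forall>\<alpha>0>0. \<forall>p\<ge>1. maximal_estimates X b \<psi>1 \<alpha>0 p \<longrightarrow> maximal_estimates X b \<psi>2 \<alpha>0 p)"

definition mutually_transferrable ::
    "'e::euclidean_space symspace \<Rightarrow> (real \<Rightarrow> real) \<Rightarrow> (real \<Rightarrow> real) \<Rightarrow> bool" where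
  "mutually_transferrable X \<psi>1 \<psi>2 \<longleftrightarrow>
     (\<forall>b\<in>points X. transferrable X b \<psi>1 \<psi>2 \<and> transferrable X b \<psi>2 \<psi>1)"

definition comparable_oscillation :: "(real \<Rightarrow> real) \<Rightarrow> (real \<Rightarrow> real) \<Rightarrow> bool" where
  "comparable_oscillation \<psi>1 \<psi>2 \<longleftrightarrow>
     (\<exists>R>0. \<exists>C>0. \<forall>r>R. \<bar>\<psi>1 r - \<psi>2 r\<bar> \<le> C)"

end

theory Submission
  imports Defs
begin

text \<open>
  Since \<open>\<bar>\<psi>1 - \<psi>2\<bar> \<le> D\<close> on the spectrum, expanding \<open>exp (- i t (\<psi>2 - \<psi>1))\<close> into its
  exponential series bounds the maximal function for \<open>\<psi>2\<close> by the sum over \<open>k\<close> of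
  \<open>(2 \<pi> D) ^ k / k!\<close> times the maximal function for \<open>\<psi>1\<close> of \<open>((\<psi>2 - \<psi>1) / D) ^ k f\<close>, whose
  Sobolev norms do not exceed that of \<open>f\<close>. This is applied to the partial sums of the zonal
  expansion of \<open>f\<close>, which are trivially smooth; Jensen's and Fatou's inequalities do the rest.

  The harmonic analysis (orthogonality of the zonal functions, decay of the coefficients) is
  obtained without computing the Riemannian measure, from its invariance under isometries alone:
  the integral of a derivative along a one-parameter family of isometries vanishes, and
  finitely many such derivatives \<open>V\<^sub>j\<close> satisfy \<open>\<Sum> V\<^sub>j V\<^sub>j = \<kappa> \<Delta>\<close> on radial functions.
\<close>

section \<open>Smooth functions on the ambient space\<close>

text \<open>The construction \<open>measure_of\<close> collapses to the zero measure unless its set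
  function is a measure, so each statement on \<open>riem_measure\<close> is arranged to hold for
  the normalised Hausdorff measure and for the zero measure alike. Integration by parts yields only
  mean values of the zonal functions. But the supremum over t can be reduced to a countable one,
  hence be measurable, only where the propagator is continuous in t, and this calls for absolute
  convergence at individual points. The gap is closed by Sonin's function \<open>phi\<close>: its
  mean is explicit, and its values at two interior points are comparable uniformly in n, so
  convergence at one interior point spreads to all of them. The boundedness of the time interval
  makes the exponential series summable uniformly in t; its total weight exp (2 pi D) is the loss in
  the constant. On the projective spaces the cosine of the distance is affine in the matrix, which
  makes zonal functions restrictions of polynomials. Real rotation matrices act there even without
  associativity; the twists supply the remaining directions.\<close>

definition C_inf :: "('e::euclidean_space \<Rightarrow> complex) \<Rightarrow> bool" where
  "C_inf f \<longleftrightarrow> (\<forall>k. C_k k f)"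

definition lie_deriv :: "('e::euclidean_space \<Rightarrow> 'e) \<Rightarrow> ('e \<Rightarrow> complex) \<Rightarrow> 'e \<Rightarrow> complex" where
  "lie_deriv A f x = frechet_derivative f (at x) (A x)"

lemma C_k_SucD: "C_k (Suc k) f \<Longrightarrow> C_k k f"
proof (induction k arbitrary: f)
  case 0
  then show ?case
    by (auto simp: continuous_on_eq_continuous_at differentiable_imp_continuous_within)
next
  case (Suc k)
  then show ?case by simp
qed

lemma C_k_const: "C_k k (\<lambda>x. c)"
  by (induction k arbitrary: c) auto

lemma C_k_SucI:
  assumes "\<And>x. (f has_derivative f' x) (at x)" and "\<And>v. C_k k (\<lambda>x. f' x v)"
  shows "C_k (Suc k) f"
proof -
  have "frechet_derivative f (at x) = f' x" for x
    using frechet_derivative_at[OF assms(1)] by metis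
  then show ?thesis using assms by (auto simp: differentiable_def)
qed

lemma C_k_Suc_has_derivative:
  "C_k (Suc k) f \<Longrightarrow> (f has_derivative frechet_derivative f (at x)) (at x)"
  by (simp add: frechet_derivative_works)

lemma C_k_add: "C_k k f \<Longrightarrow> C_k k g \<Longrightarrow> C_k k (\<lambda>x. f x + g x)"
proof (induction k arbitrary: f g)
  case 0
  then show ?case by (auto intro: continuous_intros)
next
  case (Suc k)
  show ?case
    by (rule C_k_SucI[OF has_derivative_add[OF C_k_Suc_has_derivative[OF Suc.prems(1)]
          C_k_Suc_has_derivative[OF Suc.prems(2)]]])
      (use Suc in auto)
qed

lemma C_k_mult: "C_k k f \<Longrightarrow> C_k k g \<Longrightarrow> C_k k (\<lambda>x. f x * g x)"
proof (induction k arbitrary: f g)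
  case 0
  then show ?case by (auto intro: continuous_intros)
next
  case (Suc k)
  show ?case
    by (rule C_k_SucI[OF has_derivative_mult[OF C_k_Suc_has_derivative[OF Suc.prems(1)]
          C_k_Suc_has_derivative[OF Suc.prems(2)]]])
      (intro C_k_add Suc.IH C_k_SucD[OF Suc.prems(1)] C_k_SucD[OF Suc.prems(2)]
        Suc.prems(1)[unfolded C_k.simps, THEN conjunct2, THEN spec]
        Suc.prems(2)[unfolded C_k.simps, THEN conjunct2, THEN spec])
qed

lemma C_k_linear:
  assumes "bounded_linear l"
  shows "C_k k (\<lambda>x. complex_of_real (l x))"
proof (cases k)
  case 0
  then show ?thesis
    by (simp add: assms continuous_on_of_real linear_continuous_on)
next
  case (Suc m)
  have "C_k (Suc m) (\<lambda>x. complex_of_real (l x))"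
    by (rule C_k_SucI[OF has_derivative_of_real[OF bounded_linear_imp_has_derivative[OF assms]]])
      (rule C_k_const)
  then show ?thesis using Suc by simp
qed

lemma C_inf_const: "C_inf (\<lambda>x. c)"
  and C_inf_add: "C_inf f \<Longrightarrow> C_inf g \<Longrightarrow> C_inf (\<lambda>x. f x + g x)"
  and C_inf_mult: "C_inf f \<Longrightarrow> C_inf g \<Longrightarrow> C_inf (\<lambda>x. f x * g x)"
  and C_inf_linear: "bounded_linear l \<Longrightarrow> C_inf (\<lambda>x. complex_of_real (l x))"
  unfolding C_inf_def by (blast intro: C_k_const C_k_add C_k_mult C_k_linear)+

lemma C_inf_sum:
  assumes "\<And>i. i \<in> I \<Longrightarrow> C_inf (f i)"
  shows "C_inf (\<lambda>x. \<Sum>i\<in>I. f i x)"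
  using assms
proof (induction I rule: infinite_finite_induct)
  case (insert i I)
  then have "C_inf (\<lambda>x. f i x + (\<Sum>i\<in>I. f i x))"
    by (intro C_inf_add) auto
  then show ?case using insert by simp
qed (simp_all add: C_inf_const)

lemma C_inf_poly:
  assumes "C_inf (\<lambda>x. complex_of_real (l x))"
  shows "C_inf (\<lambda>x. complex_of_real (poly p (l x)))"
proof (induction p)
  case 0
  show ?case by (simp add: C_inf_const)
next
  case (pCons a p)
  show ?case
    using C_inf_add[OF C_inf_const C_inf_mult[OF assms pCons.IH]] by simp
qed

lemma C_inf_has_derivative:
  "C_inf f \<Longrightarrow> (f has_derivative frechet_derivative f (at x)) (at x)"
  unfolding C_inf_def by (blast intro: C_k_Suc_has_derivative)

lemma C_inf_continuous: "C_inf f \<Longrightarrow> continuous_on S f"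
  by (metis C_inf_def C_k.simps(1) continuous_on_subset subset_UNIV)

lemma C_inf_frechet: "C_inf f \<Longrightarrow> C_inf (\<lambda>x. frechet_derivative f (at x) v)"
  unfolding C_inf_def by (metis C_k.simps(2))

lemma lie_deriv_eq:
  assumes "(f has_derivative f') (at x)"
  shows "lie_deriv A f x = f' (A x)"
  using frechet_derivative_at[OF assms] by (simp add: lie_deriv_def)

text \<open>\<open>C_inf_frechet\<close> treats a fixed direction only. Expanding the moving
  direction A x in \<open>Basis\<close> reduces to it, with linear functions as
  coefficients.\<close>

lemma C_inf_lie_deriv:
  fixes f :: "'e::euclidean_space \<Rightarrow> complex"
  assumes "C_inf f" and "linear A"
  shows "C_inf (lie_deriv A f)"
proof -
  have "lie_deriv A f = (\<lambda>x. \<Sum>i\<in>Basis. complex_of_real (A x \<bullet> i) * frechet_derivative f (at x) i)"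
  proof
    fix x
    have lin: "linear (frechet_derivative f (at x))"
      using C_inf_has_derivative[OF assms(1)] has_derivative_linear by blast
    have "lie_deriv A f x = frechet_derivative f (at x) (\<Sum>i\<in>Basis. (A x \<bullet> i) *\<^sub>R i)"
      by (simp add: lie_deriv_def euclidean_representation)
    also have "\<dots> = (\<Sum>i\<in>Basis. (A x \<bullet> i) *\<^sub>R frechet_derivative f (at x) i)"
      using lin by (simp add: linear_sum linear_scale)
    finally show "lie_deriv A f x = (\<Sum>i\<in>Basis. complex_of_real (A x \<bullet> i) * frechet_derivative f (at x) i)"
      by (simp add: scaleR_conv_of_real)
  qed
  moreover have "bounded_linear (\<lambda>x. A x \<bullet> i)" for i
    using assms(2) by (simp add: linear_conv_bounded_linear bounded_linear_inner_left_comp)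
  ultimately show ?thesis
    using assms(1) by (simp only:) (intro C_inf_sum C_inf_mult C_inf_linear C_inf_frechet)
qed

lemma lie_deriv_mult:
  assumes "C_inf f" "C_inf g"
  shows "lie_deriv A (\<lambda>x. f x * g x) x = f x * lie_deriv A g x + lie_deriv A f x * g x"
  using lie_deriv_eq[OF has_derivative_mult[OF C_inf_has_derivative[OF assms(1)]
        C_inf_has_derivative[OF assms(2)]]]
  by (simp add: lie_deriv_def)

lemma lie_deriv_linear:
  assumes "bounded_linear l"
  shows "lie_deriv A (\<lambda>x. complex_of_real (l x)) x = complex_of_real (l (A x))"
  by (rule lie_deriv_eq[OF has_derivative_of_real[OF bounded_linear_imp_has_derivative[OF assms]]])

lemma lie_deriv_poly:
  assumes "(l has_derivative l') (at x)"
  shows "lie_deriv A (\<lambda>x. complex_of_real (poly p (l x))) x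
    = complex_of_real (poly (pderiv p) (l x) * l' (A x))"
proof -
  have "((\<lambda>x. poly p (l x)) has_derivative (\<lambda>v. l' v * poly (pderiv p) (l x))) (at x)"
    using has_derivative_compose[OF assms, of "poly p" "\<lambda>h. h * poly (pderiv p) (l x)"]
      poly_DERIV[of p "l x"]
    by (simp add: has_field_derivative_def mult.commute[of _ "poly (pderiv p) (l x)"])
  from lie_deriv_eq[OF has_derivative_of_real[OF this]] show ?thesis
    by (simp add: mult.commute)
qed

section \<open>Isometries and the Riemannian measure\<close>

text \<open>The isometries are restrictions of linear isometries of the ambient space, which keeps
  composition with them smooth. The inverse is carried as an argument, so that invariance of S under
  both maps gives a bijection of S.\<close>

definition points_isometry :: "'e::euclidean_space set \<Rightarrow> ('e \<Rightarrow> 'e) \<Rightarrow> ('e \<Rightarrow> 'e) \<Rightarrow> bool" where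
  "points_isometry S g g' \<longleftrightarrow> linear g \<and> linear g' \<and> g ` S \<subseteq> S \<and> g' ` S \<subseteq> S \<and>
     (\<forall>x. g' (g x) = x) \<and> (\<forall>x. g (g' x) = x) \<and> (\<forall>x. norm (g x) = norm x)"

lemma points_isometry_sym: "points_isometry S g g' \<Longrightarrow> points_isometry S g' g"
  by (simp add: points_isometry_def) metis

lemma points_isometry_comp:
  "points_isometry S g g' \<Longrightarrow> points_isometry S h h' \<Longrightarrow> points_isometry S (g \<circ> h) (h' \<circ> g')"
  by (auto simp: points_isometry_def linear_compose image_subset_iff)

lemma points_isometry_id: "points_isometry S id id"
  by (simp add: points_isometry_def linear_id)

lemma points_isometry_inner:
  assumes "points_isometry S g g'"
  shows "g x \<bullet> g y = x \<bullet> y"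
proof -
  have "orthogonal_transformation g"
    using assms by (simp add: points_isometry_def orthogonal_transformation)
  then show ?thesis by (simp add: orthogonal_transformation_def)
qed

text \<open>A cover of A is pushed forward to a cover of the image by sets of no larger diameter, so
  the same mesh \<open>\<delta>\<close> serves on both sides.\<close>

lemma hausdorff_measure_image_le:
  fixes g :: "'e::metric_space \<Rightarrow> 'e"
  assumes "\<And>x y. dist (g x) (g y) \<le> dist x y"
  shows "hausdorff_measure d (g ` A) \<le> hausdorff_measure d A"
  unfolding hausdorff_measure_def
proof (rule SUP_mono)
  fix \<delta> :: real
  assume \<delta>: "\<delta> \<in> {0<..}"
  let ?cov = "\<lambda>A. {U :: nat \<Rightarrow> 'e set. A \<subseteq> (\<Union>i. U i) \<and> (\<forall>i. bounded (U i) \<and> diameter (U i) \<le> \<delta>)}"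
  have bd: "bounded (g ` V)" and dm: "diameter (g ` V) \<le> diameter V" if V: "bounded V" for V
  proof -
    obtain x e where "\<forall>y\<in>V. dist x y \<le> e" using V by (auto simp: bounded_def)
    then have "\<forall>y\<in>g ` V. dist (g x) y \<le> e" using assms by (auto intro: order_trans)
    then show "bounded (g ` V)" by (auto simp: bounded_def)
    show "diameter (g ` V) \<le> diameter V"
    proof (cases "V = {}")
      case False
      have "dist a b \<le> diameter V" if "a \<in> g ` V" "b \<in> g ` V" for a b
        using that order_trans[OF assms diameter_bounded_bound[OF V]] by blast
      then show ?thesis using False
        by (auto simp: diameter_def intro!: cSUP_least)
    qed simp
  qed
  have "(INF U\<in>?cov (g ` A). \<Sum>i. ennreal (diameter (U i) ^ d))
      \<le> (INF U\<in>?cov A. \<Sum>i. ennreal (diameter (U i) ^ d))"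
  proof (rule INF_mono)
    fix U assume U: "U \<in> ?cov A"
    show "\<exists>W\<in>?cov (g ` A). (\<Sum>i. ennreal (diameter (W i) ^ d)) \<le> (\<Sum>i. ennreal (diameter (U i) ^ d))"
    proof (intro bexI suminf_le)
      show "(\<lambda>i. g ` U i) \<in> ?cov (g ` A)"
      proof (intro CollectI conjI allI)
        show "g ` A \<subseteq> (\<Union>i. g ` U i)" using U by blast
        show "bounded (g ` U i)" for i using U by (intro bd) simp
        show "diameter (g ` U i) \<le> \<delta>" for i
          using U by (intro order_trans[OF dm]) auto
      qed
      show "ennreal (diameter (g ` U i) ^ d) \<le> ennreal (diameter (U i) ^ d)" for i
        using U bd dm by (auto intro!: ennreal_leI power_mono diameter_ge_0)
    qed auto
  qed
  with \<delta> show "\<exists>\<delta>'\<in>{0<..}. (INF U\<in>?cov (g ` A). \<Sum>i. ennreal (diameter (U i) ^ d))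
      \<le> (INF U\<in>{U :: nat \<Rightarrow> 'e set. A \<subseteq> (\<Union>i. U i) \<and> (\<forall>i. bounded (U i) \<and> diameter (U i) \<le> \<delta>')}.
          \<Sum>i. ennreal (diameter (U i) ^ d))" by blast
qed

lemma points_isometry_dist: "points_isometry S g g' \<Longrightarrow> dist (g x) (g y) = dist x y"
  by (metis dist_norm linear_diff points_isometry_def)

lemma hausdorff_measure_isometry:
  assumes "points_isometry S g g'"
  shows "hausdorff_measure d (g ` A) = hausdorff_measure d A"
proof (rule antisym)
  show "hausdorff_measure d (g ` A) \<le> hausdorff_measure d A"
    by (rule hausdorff_measure_image_le) (simp add: points_isometry_dist[OF assms])
  have "hausdorff_measure d (g' ` g ` A) \<le> hausdorff_measure d (g ` A)"
    by (rule hausdorff_measure_image_le)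
      (simp add: points_isometry_dist[OF points_isometry_sym[OF assms]])
  moreover have "g' ` g ` A = A"
    using assms by (simp add: points_isometry_def image_image)
  ultimately show "hausdorff_measure d A \<le> hausdorff_measure d (g ` A)" by simp
qed

lemma space_riem_measure [simp]: "space (riem_measure X) = points X"
  unfolding riem_measure_def by (subst space_measure_of) (auto simp: sets_restrict_space)

lemma sets_riem_measure: "sets (riem_measure X) = sets (restrict_space borel (points X))"
  unfolding riem_measure_def
  using sets.sigma_sets_eq[of "restrict_space borel (points X)"]
  by (subst sets_measure_of) (auto simp: sets_restrict_space space_restrict_space)

lemma sigma_sets_restrict_borel:
  "sigma_sets S (sets (restrict_space borel S)) = sets (restrict_space (borel :: 'e::topological_space measure) S)"
  using sets.sigma_sets_eq[of "restrict_space (borel :: 'e measure) S"] by (simp add: space_restrict_space)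

text \<open>The dichotomy behind \<open>measure_of\<close>: the quotient of Hausdorff measures if
  this is a measure, and zero otherwise. Both alternatives are invariant under isometries and have
  finite mass.\<close>

lemma emeasure_riem_measure_cases:
  obtains "\<And>A. emeasure (riem_measure X) A = 0"
  | "\<And>A. A \<in> sets (riem_measure X) \<Longrightarrow>
      emeasure (riem_measure X) A = hausdorff_measure (rdim X) A / hausdorff_measure (rdim X) (points X)"
proof -
  let ?\<mu> = "\<lambda>A. hausdorff_measure (rdim X) A / hausdorff_measure (rdim X) (points X)"
  have eq: "emeasure (riem_measure X) = (\<lambda>B. if B \<in> sets (riem_measure X) \<and>
      measure_space (points X) (sets (riem_measure X)) ?\<mu> then ?\<mu> B else 0)"
    unfolding sets_riem_measure unfolding riem_measure_def
    by (subst emeasure_measure_of_conv) (simp add: sigma_sets_restrict_borel)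
  show ?thesis
    using that unfolding eq by (cases "measure_space (points X) (sets (riem_measure X)) ?\<mu>") auto
qed

lemma finite_measure_riem_measure: "finite_measure (riem_measure X)"
proof
  have "points X \<in> sets (riem_measure X)"
    using sets.top[of "riem_measure X"] by simp
  then have "emeasure (riem_measure X) (points X) \<le> 1"
  proof (cases rule: emeasure_riem_measure_cases[of X])
    case 2
    let ?h = "hausdorff_measure (rdim X) (points X)"
    \<comment> \<open>In \<open>ennreal\<close> both 0 / 0 and \<top> / \<top> are 0; in every other
      case the quotient is 1.\<close>
    have "?h / ?h \<le> 1"
      by (cases "?h = 0 \<or> ?h = \<top>") (auto simp: ennreal_divide_self less_top)
    with 2 \<open>points X \<in> sets (riem_measure X)\<close> show ?thesis by simp
  qed simp
  then show "emeasure (riem_measure X) (space (riem_measure X)) \<noteq> \<infinity>"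
    by (auto simp: top_unique)
qed

lemma borel_measurable_riem:
  "continuous_on (points X) f \<Longrightarrow> f \<in> borel_measurable (riem_measure X)"
  using borel_measurable_continuous_on_restrict[of "points X" f]
  by (simp add: measurable_def sets_riem_measure space_restrict_space)

lemma measurable_riem_isometry:
  assumes "points_isometry (points X) g g'"
  shows "g \<in> measurable (riem_measure X) (riem_measure X)"
proof -
  have "linear g" using assms by (simp add: points_isometry_def)
  then have "g \<in> borel_measurable (riem_measure X)"
    by (intro borel_measurable_riem linear_continuous_on) (simp add: linear_conv_bounded_linear)
  then have "g \<in> measurable (riem_measure X) (restrict_space borel (points X))"
    using assms by (intro measurable_restrict_space2) (auto simp: points_isometry_def)
  then show ?thesis
    by (simp add: measurable_def sets_riem_measure space_restrict_space)
qed

text \<open>The preimage under g is the image under g', whose mass is unchanged in either case for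
  \<open>riem_measure\<close>.\<close>

lemma distr_riem_isometry:
  assumes g: "points_isometry (points X) g g'"
  shows "distr (riem_measure X) (riem_measure X) g = riem_measure X"
proof (rule measure_eqI)
  fix A assume "A \<in> sets (distr (riem_measure X) (riem_measure X) g)"
  then have A: "A \<in> sets (riem_measure X)" by simp
  note meas = measurable_riem_isometry[OF g]
  have eq: "g -` A \<inter> points X = g' ` A"
  proof -
    have "A \<subseteq> points X" using sets.sets_into_space[OF A] by simp
    show ?thesis
    proof (intro set_eqI iffI)
      fix x assume "x \<in> g -` A \<inter> points X"
      moreover have "x = g' (g x)" using g by (simp add: points_isometry_def)
      ultimately show "x \<in> g' ` A" by blast
    next
      fix x assume "x \<in> g' ` A"
      then obtain y where y: "y \<in> A" "x = g' y" by blast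
      then have "g x = y" using g by (simp add: points_isometry_def)
      moreover have "x \<in> points X"
        using g y \<open>A \<subseteq> points X\<close> unfolding points_isometry_def by blast
      ultimately show "x \<in> g -` A \<inter> points X" using y by simp
    qed
  qed
  have pre: "g' ` A \<in> sets (riem_measure X)"
    using measurable_sets[OF meas A] by (simp add: eq)
  have "emeasure (riem_measure X) (g' ` A) = emeasure (riem_measure X) A"
    by (cases rule: emeasure_riem_measure_cases[of X])
      (simp_all add: A pre hausdorff_measure_isometry[OF points_isometry_sym[OF g]])
  then show "emeasure (distr (riem_measure X) (riem_measure X) g) A = emeasure (riem_measure X) A"
    by (simp add: emeasure_distr[OF meas A] eq)
qed simp

lemma integral_riem_isometry:
  fixes h :: "'e::euclidean_space \<Rightarrow> complex"
  assumes "points_isometry (points X) g g'" and "h \<in> borel_measurable (riem_measure X)"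
  shows "(\<integral>x. h (g x) \<partial>riem_measure X) = (\<integral>x. h x \<partial>riem_measure X)"
  using integral_distr[OF measurable_riem_isometry[OF assms(1)] assms(2)]
  by (simp add: distr_riem_isometry[OF assms(1)])

section \<open>The Jacobi equation\<close>

definition jacobi_coeff :: "real \<Rightarrow> real \<Rightarrow> nat \<Rightarrow> nat \<Rightarrow> real" where
  "jacobi_coeff \<alpha> \<beta> n s = ((real n + \<alpha>) gchoose (n - s)) * ((real n + \<beta>) gchoose s)"

text \<open>A formal polynomial, so that \<open>pderiv\<close> is available; the two linear factors
  are (x - 1) / 2 and (x + 1) / 2.\<close>

definition jacobi_pol :: "real \<Rightarrow> real \<Rightarrow> nat \<Rightarrow> real poly" where
  "jacobi_pol \<alpha> \<beta> n =
     (\<Sum>s\<le>n. smult (jacobi_coeff \<alpha> \<beta> n s) ([:-1/2, 1/2:] ^ s * [:1/2, 1/2:] ^ (n - s)))"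

lemma poly_jacobi_pol: "poly (jacobi_pol \<alpha> \<beta> n) x = jacobi_poly \<alpha> \<beta> n x"
proof -
  have "[:-1/2, 1/2:] = [:-(1/2), 1/2::real:]" by simp
  have u: "poly [:-1/2, 1/2:] x = (x - 1) / 2" and v: "poly [:1/2, 1/2:] x = (x + 1) / 2"
    by (simp_all add: field_simps)
  show ?thesis
    unfolding jacobi_pol_def jacobi_poly_def jacobi_coeff_def poly_sum poly_smult poly_mult poly_power u v
    by (simp add: mult.assoc)
qed

lemma gchoose_Suc_mult:
  fixes a :: "'a::field_char_0"
  shows "of_nat (Suc k) * (a gchoose Suc k) = (a gchoose k) * (a - of_nat k)"
  using gbinomial_absorb_comp[of a k] gbinomial_mult_1[of a k] by (simp add: algebra_simps)

text \<open>Matches the two remainders of \<open>jacobi_term_ode\<close> for neighbouring s, which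
  makes the sum over s telescope.\<close>

lemma jacobi_coeff_rec:
  assumes "s < n"
  shows "jacobi_coeff \<alpha> \<beta> n (Suc s) * (real (Suc s) * (real (Suc s) + \<alpha>))
    = jacobi_coeff \<alpha> \<beta> n s * (real (n - s) * (real (n - s) + \<beta>))"
proof -
  obtain k where k: "n - s = Suc k" using assms by (metis Suc_diff_Suc)
  then have n: "real n = real s + real k + 1" and k': "n - Suc s = k" using assms by linarith+
  have 1: "real (Suc k) * ((real n + \<alpha>) gchoose Suc k) = ((real n + \<alpha>) gchoose k) * (real n + \<alpha> - real k)"
    by (rule gchoose_Suc_mult)
  have 2: "real (Suc s) * ((real n + \<beta>) gchoose Suc s) = ((real n + \<beta>) gchoose s) * (real n + \<beta> - real s)"
    by (rule gchoose_Suc_mult)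
  have "jacobi_coeff \<alpha> \<beta> n (Suc s) * (real (Suc s) * (real (Suc s) + \<alpha>))
    = ((real n + \<alpha>) gchoose k) * (real (Suc s) * ((real n + \<beta>) gchoose Suc s)) * (real (Suc s) + \<alpha>)"
    by (simp only: jacobi_coeff_def k' mult.assoc mult.left_commute)
  also have "\<dots> = ((real n + \<alpha>) gchoose k) * (real n + \<alpha> - real k) * ((real n + \<beta>) gchoose s) * (real n + \<beta> - real s)"
    unfolding 2 by (simp add: n algebra_simps)
  also have "\<dots> = (real (Suc k) * ((real n + \<alpha>) gchoose Suc k)) * ((real n + \<beta>) gchoose s) * (real n + \<beta> - real s)"
    unfolding 1 by simp
  also have "\<dots> = jacobi_coeff \<alpha> \<beta> n s * (real (n - s) * (real (n - s) + \<beta>))"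
    unfolding jacobi_coeff_def k using n by (simp add: algebra_simps)
  finally show ?thesis .
qed

lemma pderiv_two_powers:
  fixes s k :: nat
  defines "q \<equiv> \<lambda>s k. [:-1/2, 1/2::real:] ^ s * [:1/2, 1/2:] ^ k"
  shows "pderiv (q s k) = smult (real s / 2) (q (s - 1) k) + smult (real k / 2) (q s (k - 1))"
proof -
  define P Q :: "real poly" where "P = [:-1/2, 1/2:]" and "Q = [:1/2, 1/2:]"
  have P: "pderiv P = [:1/2:]" and Q: "pderiv Q = [:1/2:]"
    by (simp_all add: P_def Q_def pderiv_pCons)
  have "pderiv (P ^ s * Q ^ k) = smult (real s / 2) (P ^ (s - 1) * Q ^ k) + smult (real k / 2) (P ^ s * Q ^ (k - 1))"
    unfolding pderiv_mult pderiv_power P Q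
    by (simp add: mult_smult_left mult_smult_right mult.commute[of "Q ^ k"] add.commute)
  then show ?thesis by (simp only: q_def P_def Q_def)
qed

text \<open>Here 1 - x^2 = - 4 u v. The relation v = u + 1 rewrites the terms of degree s + k + 1 as
  multiples of u^s v^k, cancelled by the eigenvalue term, plus two remainders of degree s + k -
  1.\<close>

lemma jacobi_term_ode:
  fixes \<alpha> \<beta> x :: real and s k :: nat
  defines "u \<equiv> (x - 1) / 2" and "v \<equiv> (x + 1) / 2" and "n \<equiv> real s + real k"
    and "q \<equiv> [:-1/2, 1/2:] ^ s * [:1/2, 1/2:] ^ k"
  shows "(1 - x\<^sup>2) * poly (pderiv (pderiv q)) x + (\<beta> - \<alpha> - (\<alpha> + \<beta> + 2) * x) * poly (pderiv q) x
      + n * (n + \<alpha> + \<beta> + 1) * poly q x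
    = k * (k + \<beta>) * u ^ s * v ^ (k - 1) - s * (s + \<alpha>) * u ^ (s - 1) * v ^ k"
proof -
  have P: "poly [:-1/2, 1/2:] x = u" "poly [:1/2, 1/2:] x = v"
    by (simp_all add: u_def v_def field_simps)
  have x: "x = u + v" and vu: "v = u + 1" by (simp_all add: u_def v_def field_simps)
  have d0: "poly q x = u ^ s * v ^ k" by (simp only: q_def poly_mult poly_power P)
  have d1: "poly (pderiv q) x = real s / 2 * (u ^ (s - 1) * v ^ k) + real k / 2 * (u ^ s * v ^ (k - 1))"
    by (simp only: q_def pderiv_two_powers poly_mult poly_power poly_add poly_smult P)
  have d2: "poly (pderiv (pderiv q)) x =
      real s / 2 * (real (s - 1) / 2 * (u ^ (s - 1 - 1) * v ^ k) + real k / 2 * (u ^ (s - 1) * v ^ (k - 1)))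
    + real k / 2 * (real s / 2 * (u ^ (s - 1) * v ^ (k - 1)) + real (k - 1) / 2 * (u ^ s * v ^ (k - 1 - 1)))"
    by (simp only: q_def pderiv_two_powers pderiv_add pderiv_smult poly_mult poly_power poly_add poly_smult P)
  \<comment> \<open>The truncated subtraction is harmless: wherever s - 1 or s - 1 - 1 is cut off,
    one of the factors \<open>real s\<close>, \<open>real (s - 1)\<close> vanishes.\<close>
  have A: "real s * (real (s - 1) * u ^ (s - 1 - 1)) * u = real s * (real s - 1) * u ^ (s - 1)"
    "real s * u ^ (s - 1) * u = real s * u ^ s"
    by (cases s; cases "s - 1"; simp)+
  have B: "real k * (real (k - 1) * v ^ (k - 1 - 1)) * v = real k * (real k - 1) * v ^ (k - 1)"
    "real k * v ^ (k - 1) * v = real k * v ^ k"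
    by (cases k; cases "k - 1"; simp)+
  have *: "1 - x\<^sup>2 = - 4 * u * v" by (simp add: u_def v_def field_simps power2_eq_square)
  have 2: "(1 - x\<^sup>2) * poly (pderiv (pderiv q)) x
    = - (real s * (real s - 1) * u ^ (s - 1)) * v ^ k * v - 2 * (real s * u ^ s) * (real k * v ^ k)
      - (real k * (real k - 1) * v ^ (k - 1)) * u ^ s * u"
    unfolding * d2 A[symmetric] B[symmetric] by (simp add: algebra_simps)
  have **: "(\<beta> - \<alpha> - (\<alpha> + \<beta> + 2) * x) = - 2 * (\<alpha> + 1) * v - 2 * (\<beta> + 1) * u"
    by (simp add: u_def v_def field_simps)
  have 1: "(\<beta> - \<alpha> - (\<alpha> + \<beta> + 2) * x) * poly (pderiv q) x
    = - (\<alpha> + 1) * (real s * u ^ (s - 1) * v ^ k * v + real k * v ^ k * u ^ s)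
      - (\<beta> + 1) * (real s * u ^ s * v ^ k + real k * v ^ (k - 1) * u ^ s * u)"
    unfolding ** d1 A(2)[symmetric] B(2)[symmetric] by (simp add: field_simps)
  have Av: "real s * u ^ (s - 1) * v = real s * u ^ s + real s * u ^ (s - 1)"
    using A(2) by (simp add: vu algebra_simps)
  have Bu: "real k * v ^ (k - 1) * u = real k * v ^ k - real k * v ^ (k - 1)"
    using B(2) by (simp add: vu algebra_simps)
  have "(1 - x\<^sup>2) * poly (pderiv (pderiv q)) x + (\<beta> - \<alpha> - (\<alpha> + \<beta> + 2) * x) * poly (pderiv q) x
      = - (s + \<alpha>) * (real s * u ^ (s - 1) * v) * v ^ k
        - (k + \<beta>) * (real k * v ^ (k - 1) * u) * u ^ s
        - (2 * s * k + (\<alpha> + 1) * k + (\<beta> + 1) * s) * (u ^ s * v ^ k)"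
    unfolding 1 2 by (simp add: algebra_simps)
  then show ?thesis
    unfolding Av Bu d0 n_def by (simp add: algebra_simps)
qed

lemma pderiv_sum: "pderiv (\<Sum>i\<in>I. f i) = (\<Sum>i\<in>I. pderiv (f i))"
  by (induction I rule: infinite_finite_induct) (auto simp: pderiv_add)

lemma jacobi_pol_ode:
  "(1 - x\<^sup>2) * poly (pderiv (pderiv (jacobi_pol \<alpha> \<beta> n))) x
    + (\<beta> - \<alpha> - (\<alpha> + \<beta> + 2) * x) * poly (pderiv (jacobi_pol \<alpha> \<beta> n)) x
    + n * (n + \<alpha> + \<beta> + 1) * poly (jacobi_pol \<alpha> \<beta> n) x = 0"
proof -
  define u v where "u = (x - 1) / 2" and "v = (x + 1) / 2"
  let ?c = "jacobi_coeff \<alpha> \<beta> n"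
  let ?q = "\<lambda>s. [:-1/2, 1/2:] ^ s * [:1/2, 1/2::real:] ^ (n - s)"
  \<comment> \<open>The remainder attached to s. At the ends of the telescoping sum it vanishes: at
    s = 0 by the factor \<open>real s\<close>, at s = n + 1 by the cut-off.\<close>
  define E where "E s = (if n < s then 0 else ?c s * (real s * (real s + \<alpha>)) * u ^ (s - 1) * v ^ (n - s))" for s
  have "(1 - x\<^sup>2) * poly (pderiv (pderiv (jacobi_pol \<alpha> \<beta> n))) x
    + (\<beta> - \<alpha> - (\<alpha> + \<beta> + 2) * x) * poly (pderiv (jacobi_pol \<alpha> \<beta> n)) x
    + n * (n + \<alpha> + \<beta> + 1) * poly (jacobi_pol \<alpha> \<beta> n) x
    = (\<Sum>s\<le>n. ?c s * ((1 - x\<^sup>2) * poly (pderiv (pderiv (?q s))) x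
        + (\<beta> - \<alpha> - (\<alpha> + \<beta> + 2) * x) * poly (pderiv (?q s)) x
        + n * (n + \<alpha> + \<beta> + 1) * poly (?q s) x))"
    unfolding jacobi_pol_def pderiv_sum pderiv_smult poly_sum poly_smult
      sum_distrib_left sum.distrib[symmetric]
    by (intro sum.cong refl) (simp only: distrib_left mult.left_commute)
  also have "\<dots> = (\<Sum>s\<le>n. ?c s * (real (n - s) * (real (n - s) + \<beta>) * u ^ s * v ^ (n - s - 1)
      - real s * (real s + \<alpha>) * u ^ (s - 1) * v ^ (n - s)))"
  proof (intro sum.cong refl arg_cong2[where f = "(*)"])
    fix s assume "s \<in> {..n}"
    then have "real s + real (n - s) = real n" by simp
    then show "(1 - x\<^sup>2) * poly (pderiv (pderiv (?q s))) x
        + (\<beta> - \<alpha> - (\<alpha> + \<beta> + 2) * x) * poly (pderiv (?q s)) x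
        + n * (n + \<alpha> + \<beta> + 1) * poly (?q s) x = real (n - s) * (real (n - s) + \<beta>) * u ^ s * v ^ (n - s - 1)
      - real s * (real s + \<alpha>) * u ^ (s - 1) * v ^ (n - s)"
      using jacobi_term_ode[of x s "n - s" \<beta> \<alpha>] unfolding u_def v_def by simp
  qed
  also have "\<dots> = (\<Sum>s\<le>n. E (Suc s) - E s)"
  proof (intro sum.cong refl)
    fix s assume s: "s \<in> {..n}"
    then consider "s < n" | "s = n" by force
    then have "?c s * (real (n - s) * (real (n - s) + \<beta>)) * u ^ s * v ^ (n - s - 1) = E (Suc s)"
    proof cases
      case 1
      show ?thesis using 1 by (simp add: E_def jacobi_coeff_rec[OF 1] del: of_nat_Suc)
    next
      case 2
      then show ?thesis by (simp add: E_def)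
    qed
    then show "?c s * (real (n - s) * (real (n - s) + \<beta>) * u ^ s * v ^ (n - s - 1)
      - real s * (real s + \<alpha>) * u ^ (s - 1) * v ^ (n - s)) = E (Suc s) - E s"
      using s by (simp add: E_def algebra_simps)
  qed
  also have "\<dots> = E (Suc n) - E 0"
    using sum_lessThan_telescope[of E "Suc n"] by (simp only: lessThan_Suc_atMost)
  also have "\<dots> = 0"
  proof -
    have "E 0 = 0" by (simp add: E_def)
    moreover have "E (Suc n) = 0"
      by (simp add: E_def)
    ultimately show ?thesis by simp
  qed
  finally show ?thesis .
qed

section \<open>Radial harmonic analysis by integration along flows\<close>

text \<open>S need not be convex, so the mean value bound is taken on a ball containing it, where
  compactness bounds the partial derivatives.\<close>

lemma C_inf_Lipschitz:
  fixes h :: "'e::euclidean_space \<Rightarrow> complex"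
  assumes "C_inf h" "bounded S"
  obtains L where "L \<ge> 0" "\<And>x y. x \<in> S \<Longrightarrow> y \<in> S \<Longrightarrow> norm (h x - h y) \<le> L * norm (x - y)"
proof -
  obtain R where R: "S \<subseteq> cball 0 R"
    using assms(2) unfolding bounded_iff by (meson mem_cball_0 subsetI)
  let ?D = "\<lambda>x. frechet_derivative h (at x)"
  have "continuous_on (cball 0 R) (\<lambda>x. \<Sum>i\<in>Basis. norm (?D x i))"
    by (intro continuous_intros C_inf_continuous C_inf_frechet assms)
  then have "bounded ((\<lambda>x. \<Sum>i\<in>Basis. norm (?D x i)) ` cball 0 R)"
    by (intro compact_imp_bounded compact_continuous_image) auto
  then obtain L where L0: "L > 0" "\<forall>x\<in>cball 0 R. norm (\<Sum>i\<in>Basis. norm (?D x i)) \<le> L"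
    unfolding bounded_pos ball_simps by blast
  then have L: "L > 0" "\<And>x. x \<in> cball 0 R \<Longrightarrow> (\<Sum>i\<in>Basis. norm (?D x i)) \<le> L"
    by (auto intro: order_trans[OF abs_ge_self])
  have on: "onorm (?D x) \<le> L" if "x \<in> cball 0 R" for x
    using onorm_componentwise[OF has_derivative_bounded_linear[OF C_inf_has_derivative[OF assms(1)]]]
      L(2)[OF that] by (rule order_trans)
  have "norm (h x - h y) \<le> L * norm (x - y)" if "x \<in> S" "y \<in> S" for x y
    by (rule differentiable_bound[OF convex_cball _ on, of 0 R])
      (use that R in \<open>auto intro: has_derivative_at_withinI C_inf_has_derivative assms\<close>)
  then show ?thesis using that[of L] L(1) by simp
qed

lemma tendsto_difference_quotient:
  fixes f :: "real \<Rightarrow> 'a::real_normed_vector"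
  assumes "(f has_vector_derivative d) (at 0)"
  shows "((\<lambda>t. (f t - f 0) /\<^sub>R t) \<longlongrightarrow> d) (at 0)"
proof -
  have "((\<lambda>t. norm (f t - f 0 - t *\<^sub>R d) / norm t) \<longlongrightarrow> 0) (at 0)"
    using assms by (simp add: has_vector_derivative_def has_derivative_at)
  then have "((\<lambda>t. norm ((f t - f 0) /\<^sub>R t - d)) \<longlongrightarrow> 0) (at 0)"
  proof (rule Lim_transform_eventually)
    show "\<forall>\<^sub>F t in at 0. norm (f t - f 0 - t *\<^sub>R d) / norm t = norm ((f t - f 0) /\<^sub>R t - d)"
      unfolding eventually_at_filter
    proof (intro always_eventually allI impI)
      fix t :: real assume "t \<noteq> 0"
      then have eq: "(f t - f 0) /\<^sub>R t - d = (f t - f 0 - t *\<^sub>R d) /\<^sub>R t"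
        by (simp add: scaleR_diff_right)
      show "norm (f t - f 0 - t *\<^sub>R d) / norm t = norm ((f t - f 0) /\<^sub>R t - d)"
        unfolding eq by (simp add: divide_inverse mult.commute)
    qed
  qed
  then show ?thesis
    by (rule LIM_zero_cancel[OF tendsto_norm_zero_cancel])
qed

text \<open>The interface between geometry and analysis. \<open>l\<close> is the cosine of the
  normalised distance to b, affine on the ambient space; \<open>T j\<close> is a family of
  isometries with generator \<open>A j\<close>. \<open>gradient\<close> and \<open>laplacian\<close>
  say that the sum of the squares of the generating fields acts on functions of \<open>l\<close> as
  \<open>\<kappa>\<close> times the Jacobi operator. \<open>T_Lipschitz\<close> dominates difference
  quotients, and \<open>param\<close> makes the eigenvalues strictly increasing.\<close>

locale zonal_flow =
  fixes X :: "'e::euclidean_space symspace" and b :: 'e and J :: "'j set"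
    and T T' :: "'j \<Rightarrow> real \<Rightarrow> 'e \<Rightarrow> 'e" and A :: "'j \<Rightarrow> 'e \<Rightarrow> 'e"
    and l l0 :: "'e \<Rightarrow> real" and c0 \<kappa> B :: real
  assumes compact_points: "compact (points X)"
    and l_eq: "\<And>x. l x = l0 x + c0" and l0: "bounded_linear l0"
    and l_le: "\<And>x. x \<in> points X \<Longrightarrow> \<bar>l x\<bar> \<le> 1"
    and geo_dist_eq: "\<And>x. x \<in> points X \<Longrightarrow> geo_dist X b x = arccos (l x)"
    and finite_J: "finite J" and \<kappa>: "\<kappa> > 0"
    and iso: "\<And>j \<theta>. j \<in> J \<Longrightarrow> points_isometry (points X) (T j \<theta>) (T' j \<theta>)"
    and linear_A: "\<And>j. j \<in> J \<Longrightarrow> linear (A j)"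
    and T_0: "\<And>j x. j \<in> J \<Longrightarrow> T j 0 x = x"
    and T_deriv: "\<And>j x. j \<in> J \<Longrightarrow> x \<in> points X \<Longrightarrow>
      ((\<lambda>\<theta>. T j \<theta> x) has_vector_derivative A j x) (at 0)"
    and T_Lipschitz: "\<And>j x \<theta>. j \<in> J \<Longrightarrow> x \<in> points X \<Longrightarrow> norm (T j \<theta> x - x) \<le> B * \<bar>\<theta>\<bar>"
    and gradient: "\<And>x. x \<in> points X \<Longrightarrow> (\<Sum>j\<in>J. (l0 (A j x))\<^sup>2) = \<kappa> * (1 - (l x)\<^sup>2)"
    and laplacian: "\<And>x. x \<in> points X \<Longrightarrow> (\<Sum>j\<in>J. l0 (A j (A j x)))
      = \<kappa> * (rtau X - rsigma X - (rsigma X + rtau X + 2) * l x)"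
    and param: "rsigma X + rtau X + 1 \<ge> 0"
begin

abbreviation "M \<equiv> riem_measure X"

sublocale finite_measure M
  by (rule finite_measure_riem_measure)

lemma integrable_continuous:
  fixes f :: "'e \<Rightarrow> 'b::{banach, second_countable_topology}"
  assumes "continuous_on (points X) f"
  shows "integrable M f"
proof -
  have "bounded (f ` points X)"
    by (intro compact_imp_bounded compact_continuous_image assms compact_points)
  then obtain C where "\<And>x. x \<in> points X \<Longrightarrow> norm (f x) \<le> C"
    unfolding bounded_iff by blast
  then show ?thesis
    using borel_measurable_riem[OF assms] by (intro integrable_const_bound[where B = C]) auto
qed

lemma integrable_C_inf: "C_inf f \<Longrightarrow> integrable M f"
  by (intro integrable_continuous C_inf_continuous)

text \<open>Each difference quotient of h along \<open>T j\<close> has integral zero by invariance.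
  The bound L * B, uniform in the step and integrable on a finite measure, allows the limit under
  the integral.\<close>

lemma integral_lie_deriv:
  assumes j: "j \<in> J" and h: "C_inf h"
  shows "(\<integral>x. lie_deriv (A j) h x \<partial>M) = 0"
proof -
  obtain L where L: "L \<ge> 0" "\<And>x y. x \<in> points X \<Longrightarrow> y \<in> points X \<Longrightarrow> norm (h x - h y) \<le> L * norm (x - y)"
    by (rule C_inf_Lipschitz[OF h compact_imp_bounded[OF compact_points]]) blast
  define F where "F m x = (h (T j (inverse (real (Suc m))) x) - h x) /\<^sub>R inverse (real (Suc m))" for m x
  have hm: "h \<in> borel_measurable M" by (intro borel_measurable_riem C_inf_continuous h)
  have hT: "integrable M (\<lambda>x. h (T j \<theta> x))" for \<theta>
  proof (intro integrable_continuous continuous_on_compose2[OF C_inf_continuous[OF h]])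
    have "linear (T j \<theta>)" using iso[OF j, of \<theta>] by (simp add: points_isometry_def)
    then show "continuous_on (points X) (T j \<theta>)"
      by (intro linear_continuous_on) (simp add: linear_conv_bounded_linear)
  qed (rule subset_UNIV)
  have int0: "(\<integral>x. F m x \<partial>M) = 0" for m
    unfolding F_def integral_scaleR_right
    by (simp add: Bochner_Integration.integral_diff[OF hT integrable_C_inf[OF h]] integral_riem_isometry[OF iso[OF j] hm])
  have "(\<lambda>m. \<integral>x. F m x \<partial>M) \<longlonglongrightarrow> (\<integral>x. lie_deriv (A j) h x \<partial>M)"
  proof (rule integral_dominated_convergence[where w = "\<lambda>_. L * B"])
    show "lie_deriv (A j) h \<in> borel_measurable M"
      by (intro borel_measurable_riem C_inf_continuous C_inf_lie_deriv h linear_A j)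
    show "F m \<in> borel_measurable M" for m
      unfolding F_def using borel_measurable_integrable[OF hT] hm by simp
    show "AE x in M. (\<lambda>m. F m x) \<longlonglongrightarrow> lie_deriv (A j) h x"
    proof (rule AE_I2)
      fix x assume "x \<in> space M"
      then have x: "x \<in> points X" by simp
      have "((h \<circ> (\<lambda>\<theta>. T j \<theta> x)) has_vector_derivative frechet_derivative h (at x) (A j x)) (at 0)"
        by (rule vector_derivative_diff_chain_within[OF T_deriv[OF j x]])
          (simp add: T_0[OF j] has_derivative_at_withinI C_inf_has_derivative[OF h])
      from tendsto_difference_quotient[OF this]
      have "((\<lambda>t. (h (T j t x) - h x) /\<^sub>R t) \<longlongrightarrow> lie_deriv (A j) h x) (at 0)"
        by (simp add: T_0[OF j] lie_deriv_def)
      moreover have "filterlim (\<lambda>m. inverse (real (Suc m))) (at 0) sequentially"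
        unfolding filterlim_at using LIMSEQ_inverse_real_of_nat by auto
      ultimately show "(\<lambda>m. F m x) \<longlonglongrightarrow> lie_deriv (A j) h x"
        unfolding F_def by (rule filterlim_compose)
    qed
    show "AE x in M. norm (F m x) \<le> L * B" for m
    proof (rule AE_I2)
      fix x assume "x \<in> space M"
      then have x: "x \<in> points X" by simp
      let ?t = "inverse (real (Suc m))"
      have "T j ?t x \<in> points X" using iso[OF j, of ?t] x by (auto simp: points_isometry_def)
      then have "norm (h (T j ?t x) - h x) \<le> L * norm (T j ?t x - x)" using x by (rule L(2))
      also have "\<dots> \<le> L * (B * ?t)"
        using T_Lipschitz[OF j x, of ?t] L(1) by (intro mult_left_mono) auto
      finally have "norm (h (T j ?t x) - h x) \<le> L * B * ?t" by simp
      moreover have "norm (F m x) = norm (h (T j ?t x) - h x) / ?t"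
        unfolding F_def norm_scaleR by (simp add: divide_inverse del: of_nat_Suc)
      ultimately show "norm (F m x) \<le> L * B"
        by (simp add: pos_divide_le_eq del: of_nat_Suc)
    qed
  qed auto
  then show ?thesis by (simp add: int0 LIMSEQ_const_iff)
qed

section \<open>The sum of squares of the flows and its zonal eigenfunctions\<close>

text \<open>Identified with the Jacobi operator on functions of \<open>l\<close>, but symmetric on
  all smooth functions; the latter allows it to be moved onto an arbitrary smooth f.\<close>

definition Lop :: "('e \<Rightarrow> complex) \<Rightarrow> 'e \<Rightarrow> complex" where
  "Lop f x = (\<Sum>j\<in>J. lie_deriv (A j) (lie_deriv (A j) f) x)"

lemma C_inf_Lop: "C_inf f \<Longrightarrow> C_inf (Lop f)"
  unfolding Lop_def[abs_def] by (intro C_inf_sum C_inf_lie_deriv linear_A)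

lemma Green:
  assumes "j \<in> J" "C_inf f" "C_inf g"
  shows "(\<integral>x. f x * lie_deriv (A j) (lie_deriv (A j) g) x \<partial>M)
    = - (\<integral>x. lie_deriv (A j) f x * lie_deriv (A j) g x \<partial>M)"
proof -
  note A = linear_A[OF assms(1)]
  note C = C_inf_lie_deriv[OF assms(2) A] C_inf_lie_deriv[OF assms(3) A]
    C_inf_lie_deriv[OF C_inf_lie_deriv[OF assms(3) A] A]
  have "0 = (\<integral>x. lie_deriv (A j) (\<lambda>x. f x * lie_deriv (A j) g x) x \<partial>M)"
    using integral_lie_deriv[OF assms(1) C_inf_mult[OF assms(2) C(2)]] by simp
  also have "\<dots> = (\<integral>x. f x * lie_deriv (A j) (lie_deriv (A j) g) x \<partial>M)
    + (\<integral>x. lie_deriv (A j) f x * lie_deriv (A j) g x \<partial>M)"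
    unfolding lie_deriv_mult[OF assms(2) C(2)]
    by (intro Bochner_Integration.integral_add integrable_C_inf C_inf_mult assms C)
  finally show ?thesis by (simp add: eq_neg_iff_add_eq_0)
qed

lemma Lop_symmetric:
  assumes "C_inf f" "C_inf g"
  shows "(\<integral>x. f x * Lop g x \<partial>M) = (\<integral>x. Lop f x * g x \<partial>M)"
proof -
  have "(\<integral>x. f x * Lop g x \<partial>M) = (\<Sum>j\<in>J. \<integral>x. f x * lie_deriv (A j) (lie_deriv (A j) g) x \<partial>M)"
    unfolding Lop_def sum_distrib_left
    by (intro Bochner_Integration.integral_sum integrable_C_inf C_inf_mult C_inf_lie_deriv assms linear_A)
  also have "\<dots> = (\<Sum>j\<in>J. \<integral>x. g x * lie_deriv (A j) (lie_deriv (A j) f) x \<partial>M)"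
    by (intro sum.cong refl) (simp add: Green assms mult.commute)
  also have "\<dots> = (\<integral>x. Lop f x * g x \<partial>M)"
    unfolding Lop_def sum_distrib_right mult.commute[of "g _"]
    by (intro Bochner_Integration.integral_sum[symmetric] integrable_C_inf C_inf_mult C_inf_lie_deriv assms linear_A)
  finally show ?thesis .
qed

definition Zf :: "real poly \<Rightarrow> 'e \<Rightarrow> complex" where
  "Zf p x = complex_of_real (poly p (l x))"

lemma C_inf_l: "C_inf (\<lambda>x. complex_of_real (l x))"
  using C_inf_add[OF C_inf_linear[OF l0] C_inf_const[of "complex_of_real c0"]] by (simp add: l_eq)

lemma C_inf_Zf: "C_inf (Zf p)"
  unfolding Zf_def[abs_def] by (rule C_inf_poly[OF C_inf_l])

lemma bounded_linear_l0_A: "j \<in> J \<Longrightarrow> bounded_linear (\<lambda>x. l0 (A j x))"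
  by (rule bounded_linear_compose[OF l0]) (simp add: linear_A flip: linear_conv_bounded_linear)

lemma lie_deriv_Zf:
  "lie_deriv (A j) (Zf p) x = Zf (pderiv p) x * complex_of_real (l0 (A j x))"
proof -
  have "(l has_derivative l0) (at x)"
    unfolding l_eq[abs_def] using has_derivative_add_const[OF bounded_linear_imp_has_derivative[OF l0]] .
  from lie_deriv_poly[OF this] show ?thesis by (simp add: Zf_def[abs_def])
qed

lemma lie_deriv2_Zf:
  assumes j: "j \<in> J"
  shows "lie_deriv (A j) (lie_deriv (A j) (Zf p)) x
    = complex_of_real (poly (pderiv (pderiv p)) (l x) * (l0 (A j x))\<^sup>2 + poly (pderiv p) (l x) * l0 (A j (A j x)))"
proof -
  have "lie_deriv (A j) (Zf p) = (\<lambda>x. Zf (pderiv p) x * complex_of_real (l0 (A j x)))"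
    by (intro ext lie_deriv_Zf)
  then show ?thesis
    using lie_deriv_mult[OF C_inf_Zf[of "pderiv p"] C_inf_linear[OF bounded_linear_l0_A[OF j]], of "A j" x]
    by (simp add: lie_deriv_linear[OF bounded_linear_l0_A[OF j]] lie_deriv_Zf)
      (simp add: Zf_def power2_eq_square)
qed

definition zpol :: "nat \<Rightarrow> real poly" where
  "zpol n = jacobi_pol (rsigma X) (rtau X) n"

definition lam :: "nat \<Rightarrow> real" where
  "lam n = real n * (real n + rsigma X + rtau X + 1)"

text \<open>This quadratic growth turns the bound of \<open>zcoeff_decay\<close> into
  summability.\<close>

lemma lam_ge: "lam n \<ge> (real n)\<^sup>2"
  using param mult_nonneg_nonneg[of "real n" "rsigma X + rtau X + 1"]
  by (simp add: lam_def power2_eq_square algebra_simps)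

lemma lam_nonneg: "lam n \<ge> 0"
  using lam_ge[of n] zero_le_power2[of "real n"] by linarith

lemma lam_pos: "n > 0 \<Longrightarrow> lam n > 0"
  using lam_ge[of n] zero_less_power2[of "real n"] by (metis less_le_trans of_nat_0_eq_iff not_gr_zero)

lemma lam_strict: "m < n \<Longrightarrow> lam m < lam n"
proof -
  assume mn: "m < n"
  have "lam n - lam m = (real n - real m) * (real n + real m + (rsigma X + rtau X + 1))"
    by (simp add: lam_def algebra_simps)
  moreover have "\<dots> > 0" using mn param by (intro mult_pos_pos) auto
  ultimately show ?thesis by simp
qed

text \<open>Inserting \<open>gradient\<close> and \<open>laplacian\<close> into the second-order
  chain rule \<open>lie_deriv2_Zf\<close> leaves \<open>\<kappa>\<close> times the Jacobi equation
  at \<open>l x\<close>.\<close>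

lemma Lop_zpol:
  assumes "x \<in> points X"
  shows "Lop (Zf (zpol n)) x = - complex_of_real (\<kappa> * lam n) * Zf (zpol n) x"
proof -
  let ?p = "zpol n"
  have "Lop (Zf ?p) x = complex_of_real (poly (pderiv (pderiv ?p)) (l x) * (\<Sum>j\<in>J. (l0 (A j x))\<^sup>2)
      + poly (pderiv ?p) (l x) * (\<Sum>j\<in>J. l0 (A j (A j x))))"
    unfolding Lop_def sum_distrib_left sum.distrib[symmetric] of_real_sum
    by (intro sum.cong refl lie_deriv2_Zf)
  also have "\<dots> = complex_of_real (- \<kappa> * lam n * poly ?p (l x))"
    unfolding gradient[OF assms] laplacian[OF assms]
    using jacobi_pol_ode[of "l x" "rsigma X" "rtau X" n]
    unfolding zpol_def lam_def by (intro arg_cong[where f = complex_of_real]) algebra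
  finally show ?thesis by (simp add: Zf_def)
qed

lemma integral_Lop_zpol:
  "(\<integral>x. f x * Lop (Zf (zpol n)) x \<partial>M) = - complex_of_real (\<kappa> * lam n) * (\<integral>x. f x * Zf (zpol n) x \<partial>M)"
proof -
  have "(\<integral>x. f x * Lop (Zf (zpol n)) x \<partial>M) = (\<integral>x. - complex_of_real (\<kappa> * lam n) * (f x * Zf (zpol n) x) \<partial>M)"
    by (intro Bochner_Integration.integral_cong refl) (simp add: Lop_zpol)
  then show ?thesis by simp
qed

text \<open>Eigenfunctions of a symmetric operator for distinct eigenvalues.\<close>

lemma zpol_orthogonal:
  assumes "m \<noteq> n"
  shows "(\<integral>x. Zf (zpol m) x * Zf (zpol n) x \<partial>M) = 0"
proof -
  let ?I = "\<integral>x. Zf (zpol m) x * Zf (zpol n) x \<partial>M"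
  have "- complex_of_real (\<kappa> * lam n) * ?I = (\<integral>x. Lop (Zf (zpol m)) x * Zf (zpol n) x \<partial>M)"
    using Lop_symmetric[OF C_inf_Zf C_inf_Zf, of "zpol m" "zpol n"] by (simp add: integral_Lop_zpol)
  also have "\<dots> = - complex_of_real (\<kappa> * lam m) * ?I"
    using integral_Lop_zpol[of "Zf (zpol n)" m] by (simp add: mult.commute)
  finally have "?I = 0 \<or> \<kappa> * lam n = \<kappa> * lam m" by (auto simp flip: of_real_mult)
  then show ?thesis using lam_strict[of m n] lam_strict[of n m] assms \<kappa> by (auto simp: neq_iff)
qed

text \<open>The squared norm before normalisation. If it is zero, for instance because M is the zero
  measure, then \<open>zeta n\<close> is zero by division by zero.\<close>

definition hn :: "nat \<Rightarrow> real" where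
  "hn n = (\<integral>x. (poly (zpol n) (l x))\<^sup>2 \<partial>M)"

definition zeta :: "nat \<Rightarrow> real \<Rightarrow> real" where
  "zeta n s = poly (zpol n) s / sqrt (hn n)"

lemma zonal0_eq: "x \<in> points X \<Longrightarrow> zonal0 X b n x = poly (zpol n) (l x)"
  using l_le[of x] by (simp add: zonal0_def geo_dist_eq cos_arccos_abs zpol_def poly_jacobi_pol)

lemma zonal_eq: "x \<in> points X \<Longrightarrow> zonal X b n x = zeta n (l x)"
proof -
  have "(\<integral>y. (zonal0 X b n y)\<^sup>2 \<partial>M) = hn n"
    unfolding hn_def by (intro Bochner_Integration.integral_cong refl) (simp add: zonal0_eq)
  then show "x \<in> points X \<Longrightarrow> ?thesis" by (simp add: zonal_def zeta_def zonal0_eq)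
qed

lemma continuous_l: "continuous_on S l"
  unfolding l_eq[abs_def] by (intro continuous_intros linear_continuous_on l0)

lemma hn_nonneg: "hn n \<ge> 0"
  unfolding hn_def by simp

lemma integral_zonal_mult:
  "(\<integral>x. complex_of_real (zonal X b m x) * complex_of_real (zonal X b n x) \<partial>M)
    = (if m = n \<and> hn n \<noteq> 0 then 1 else 0)"
proof -
  have "(\<integral>x. complex_of_real (zonal X b m x) * complex_of_real (zonal X b n x) \<partial>M)
    = (\<integral>x. complex_of_real (inverse (sqrt (hn m) * sqrt (hn n))) * (Zf (zpol m) x * Zf (zpol n) x) \<partial>M)"
    by (intro Bochner_Integration.integral_cong refl) (simp add: zonal_eq zeta_def Zf_def field_simps)
  also have "\<dots> = complex_of_real (inverse (sqrt (hn m) * sqrt (hn n))) * (\<integral>x. Zf (zpol m) x * Zf (zpol n) x \<partial>M)"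
    by simp
  also have "\<dots> = (if m = n \<and> hn n \<noteq> 0 then 1 else 0)"
  proof (cases "m = n")
    case True
    have "(\<integral>x. Zf (zpol n) x * Zf (zpol n) x \<partial>M) = complex_of_real (hn n)"
      unfolding hn_def integral_complex_of_real[symmetric]
      by (simp add: Zf_def power2_eq_square)
    then show ?thesis using True hn_nonneg[of n]
      by (simp flip: of_real_mult)
  qed (simp add: zpol_orthogonal)
  finally show ?thesis .
qed

text \<open>The energy identity: \<open>Green\<close> for the zonal polynomial paired with itself,
  the factor \<open>\<kappa>\<close> cancelling. It gives the mean of the second summand of
  \<open>phi\<close>.\<close>

lemma integral_gradient_zpol:
  "(\<integral>x. (1 - (l x)\<^sup>2) * (poly (pderiv (zpol n)) (l x))\<^sup>2 \<partial>M) = lam n * hn n"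
proof -
  let ?p = "zpol n"
  have "(\<integral>x. Zf ?p x * Lop (Zf ?p) x \<partial>M) = (\<Sum>j\<in>J. \<integral>x. Zf ?p x * lie_deriv (A j) (lie_deriv (A j) (Zf ?p)) x \<partial>M)"
    unfolding Lop_def sum_distrib_left
    by (intro Bochner_Integration.integral_sum integrable_C_inf C_inf_mult C_inf_lie_deriv C_inf_Zf linear_A)
  also have "\<dots> = - (\<Sum>j\<in>J. \<integral>x. lie_deriv (A j) (Zf ?p) x * lie_deriv (A j) (Zf ?p) x \<partial>M)"
    by (simp add: Green C_inf_Zf sum_negf)
  also have "\<dots> = - (\<integral>x. (\<Sum>j\<in>J. lie_deriv (A j) (Zf ?p) x * lie_deriv (A j) (Zf ?p) x) \<partial>M)"
    by (subst Bochner_Integration.integral_sum)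
      (auto intro!: integrable_C_inf C_inf_mult C_inf_lie_deriv C_inf_Zf linear_A)
  also have "\<dots> = - (\<integral>x. complex_of_real (\<kappa> * ((1 - (l x)\<^sup>2) * (poly (pderiv ?p) (l x))\<^sup>2)) \<partial>M)"
  proof (intro arg_cong[where f = uminus] Bochner_Integration.integral_cong refl)
    fix x assume "x \<in> space M"
    then have x: "x \<in> points X" by simp
    have "(\<Sum>j\<in>J. lie_deriv (A j) (Zf ?p) x * lie_deriv (A j) (Zf ?p) x)
      = complex_of_real ((\<Sum>j\<in>J. (l0 (A j x))\<^sup>2) * (poly (pderiv ?p) (l x))\<^sup>2)"
      unfolding lie_deriv_Zf Zf_def sum_distrib_right of_real_sum
      by (intro sum.cong refl) (simp add: power2_eq_square)
    then show "(\<Sum>j\<in>J. lie_deriv (A j) (Zf ?p) x * lie_deriv (A j) (Zf ?p) x)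
      = complex_of_real (\<kappa> * ((1 - (l x)\<^sup>2) * (poly (pderiv ?p) (l x))\<^sup>2))"
      by (simp add: gradient[OF x])
  qed
  also have "\<dots> = - complex_of_real (\<kappa> * (\<integral>x. (1 - (l x)\<^sup>2) * (poly (pderiv ?p) (l x))\<^sup>2 \<partial>M))"
    by (simp only: integral_complex_of_real integral_mult_right_zero)
  finally have 1: "(\<integral>x. Zf ?p x * Lop (Zf ?p) x \<partial>M)
    = - complex_of_real (\<kappa> * (\<integral>x. (1 - (l x)\<^sup>2) * (poly (pderiv ?p) (l x))\<^sup>2 \<partial>M))" .
  have "(\<integral>x. Zf ?p x * Zf ?p x \<partial>M) = complex_of_real (hn n)"
    unfolding hn_def integral_complex_of_real[symmetric] by (simp add: Zf_def power2_eq_square)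
  then have "- complex_of_real (\<kappa> * lam n * hn n)
    = - complex_of_real (\<kappa> * (\<integral>x. (1 - (l x)\<^sup>2) * (poly (pderiv ?p) (l x))\<^sup>2 \<partial>M))"
    using 1 unfolding integral_Lop_zpol by simp
  then have "\<kappa> * lam n * hn n = \<kappa> * (\<integral>x. (1 - (l x)\<^sup>2) * (poly (pderiv ?p) (l x))\<^sup>2 \<partial>M)"
    by (simp only: neg_equal_iff_equal of_real_eq_iff)
  then show ?thesis using \<kappa> by simp
qed

end

context zonal_flow
begin

section \<open>Decay and summability of the zonal coefficients\<close>

lemma zcoeff_eq:
  assumes "\<And>x. x \<in> points X \<Longrightarrow> f x = g x"
  shows "zcoeff X b f n = (\<integral>x. g x * Zf (zpol n) x \<partial>M) / complex_of_real (sqrt (hn n))"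
proof -
  have "zcoeff X b f n = (\<integral>x. g x * Zf (zpol n) x / complex_of_real (sqrt (hn n)) \<partial>M)"
    unfolding zcoeff_def
    by (intro Bochner_Integration.integral_cong refl) (simp add: assms zonal_eq zeta_def Zf_def)
  then show ?thesis by simp
qed

lemma integrable_zeta: "integrable M (\<lambda>x. zeta n (l x))" "integrable M (\<lambda>x. (zeta n (l x))\<^sup>2)"
  unfolding zeta_def[abs_def] divide_inverse
  by (intro integrable_continuous continuous_intros continuous_on_poly continuous_l)+

lemma integral_zeta_square_le: "(\<integral>x. (zeta n (l x))\<^sup>2 \<partial>M) \<le> 1"
proof -
  have "(\<integral>x. (zeta n (l x))\<^sup>2 \<partial>M) = hn n / hn n"
    unfolding zeta_def power_divide using hn_nonneg[of n] by (simp add: hn_def)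
  then show ?thesis by simp
qed

text \<open>An L1 bound uniform in n, from |z| \<le> 1 + z^2 and the finite total mass.\<close>

lemma integral_abs_zeta_le: "(\<integral>x. \<bar>zeta n (l x)\<bar> \<partial>M) \<le> measure M (points X) + 1"
proof -
  have "(\<integral>x. \<bar>zeta n (l x)\<bar> \<partial>M) \<le> (\<integral>x. 1 + (zeta n (l x))\<^sup>2 \<partial>M)"
  proof (intro integral_mono integrable_abs Bochner_Integration.integrable_add integrable_zeta integrable_const)
    show "\<bar>z\<bar> \<le> 1 + z\<^sup>2" for z :: real
      using zero_le_power2[of "\<bar>z\<bar> - 1"] by (simp add: power2_diff)
  qed
  also have "\<dots> = measure M (points X) + (\<integral>x. (zeta n (l x))\<^sup>2 \<partial>M)"
    by (subst Bochner_Integration.integral_add) (auto intro: integrable_zeta)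
  finally show ?thesis using integral_zeta_square_le[of n] by simp
qed

text \<open>By symmetry the operator passes from the zonal function to the smooth extension g of f.
  There its result is bounded by compactness, and the zonal factor costs only its L1 norm.\<close>

lemma zcoeff_decay:
  assumes "smooth_fun X f"
  obtains C where "\<And>n. lam n * cmod (zcoeff X b f n) \<le> C"
proof -
  obtain g where g: "C_inf g" "\<And>x. x \<in> points X \<Longrightarrow> f x = g x"
    using assms by (auto simp: smooth_fun_def C_inf_def)
  obtain K where K: "\<And>x. x \<in> points X \<Longrightarrow> cmod (Lop g x) \<le> K"
    using compact_imp_bounded[OF compact_continuous_image[OF C_inf_continuous[OF C_inf_Lop[OF g(1)]] compact_points]]
    unfolding bounded_iff by blast
  define C where "C = \<bar>K\<bar> * (measure M (points X) + 1) / \<kappa>"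
  have "lam n * cmod (zcoeff X b f n) \<le> C" for n
  proof -
    have zc: "zcoeff X b f n = (\<integral>x. g x * Zf (zpol n) x \<partial>M) / complex_of_real (sqrt (hn n))"
      by (rule zcoeff_eq) (rule g(2))
    have eq: "- complex_of_real (\<kappa> * lam n) * zcoeff X b f n = (\<integral>x. Lop g x * complex_of_real (zeta n (l x)) \<partial>M)"
    proof -
      have "- complex_of_real (\<kappa> * lam n) * zcoeff X b f n
        = (\<integral>x. Lop g x * Zf (zpol n) x \<partial>M) / complex_of_real (sqrt (hn n))"
        unfolding zc Lop_symmetric[OF g(1) C_inf_Zf, symmetric] integral_Lop_zpol by simp
      also have "\<dots> = (\<integral>x. Lop g x * Zf (zpol n) x / complex_of_real (sqrt (hn n)) \<partial>M)" by simp
      finally show ?thesis by (simp add: Zf_def zeta_def)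
    qed
    have cont: "continuous_on (points X) (\<lambda>x. Lop g x * complex_of_real (zeta n (l x)))"
      unfolding zeta_def divide_inverse
      by (intro continuous_intros continuous_on_poly continuous_l C_inf_continuous C_inf_Lop g)
    have "\<kappa> * (lam n * cmod (zcoeff X b f n)) = cmod (- complex_of_real (\<kappa> * lam n) * zcoeff X b f n)"
      using \<kappa> lam_nonneg[of n] by (simp add: norm_mult)
    also have "\<dots> \<le> (\<integral>x. cmod (Lop g x * complex_of_real (zeta n (l x))) \<partial>M)"
      unfolding eq by (rule integral_norm_bound)
    also have "\<dots> \<le> (\<integral>x. \<bar>K\<bar> * \<bar>zeta n (l x)\<bar> \<partial>M)"
      using K by (intro integral_mono integrable_norm integrable_continuous cont integrable_mult_right integrable_abs integrable_zeta)
        (fastforce simp: norm_mult intro!: mult_right_mono)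
    also have "\<dots> \<le> \<bar>K\<bar> * (measure M (points X) + 1)"
      using integral_abs_zeta_le[of n] by (simp add: mult_left_mono)
    finally show ?thesis using \<kappa> by (simp add: C_def field_simps)
  qed
  then show ?thesis by (rule that)
qed

lemma summable_zcoeff:
  assumes "smooth_fun X f"
  shows "summable (\<lambda>n. cmod (zcoeff X b f n))"
proof -
  obtain C where C: "\<And>n. lam n * cmod (zcoeff X b f n) \<le> C" by (rule zcoeff_decay[OF assms]) blast
  show ?thesis
  proof (rule summable_comparison_test_ev)
    show "\<forall>\<^sub>F n in sequentially. norm (cmod (zcoeff X b f n)) \<le> C * inverse ((real n) ^ 2)"
    proof (rule eventually_mono[OF eventually_gt_at_top[of 0]])
      fix n :: nat assume n: "0 < n"
      have "(real n)\<^sup>2 * cmod (zcoeff X b f n) \<le> lam n * cmod (zcoeff X b f n)"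
        by (intro mult_right_mono lam_ge) auto
      then have "(real n)\<^sup>2 * cmod (zcoeff X b f n) \<le> C" using C[of n] by linarith
      then show "norm (cmod (zcoeff X b f n)) \<le> C * inverse ((real n) ^ 2)"
        using n by (simp add: field_simps)
    qed
    show "summable (\<lambda>n. C * inverse ((real n) ^ 2))"
      by (intro summable_mult inverse_power_summable) auto
  qed
qed

section \<open>Pointwise convergence of zonal series\<close>

text \<open>Sonin's function for the Jacobi equation. The weight (1 - s^2) / \<open>lam n\<close> is
  the one for which the products of the polynomial and its derivative cancel when
  \<open>phi n\<close> is differentiated.\<close>

definition phi :: "nat \<Rightarrow> real \<Rightarrow> real" where
  "phi n s = (poly (zpol n) s)\<^sup>2 + (1 - s\<^sup>2) * (poly (pderiv (zpol n)) s)\<^sup>2 / lam n"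

lemma phi_nonneg: "\<bar>s\<bar> \<le> 1 \<Longrightarrow> phi n s \<ge> 0"
  and poly_square_le_phi: "\<bar>s\<bar> \<le> 1 \<Longrightarrow> (poly (zpol n) s)\<^sup>2 \<le> phi n s"
  using lam_nonneg[of n] by (auto simp: phi_def abs_square_le_1 intro!: add_nonneg_nonneg)

text \<open>The Jacobi equation eliminates the second derivative. What survives is the squared first
  derivative over \<open>lam n\<close>, with a coefficient independent of n.\<close>

lemma phi_deriv:
  assumes "n > 0"
  shows "(phi n has_real_derivative
    2 * (rsigma X - rtau X + (rsigma X + rtau X + 1) * s) * (poly (pderiv (zpol n)) s)\<^sup>2 / lam n) (at s)"
proof -
  let ?P = "poly (zpol n) s" and ?D = "poly (pderiv (zpol n)) s"
    and ?E = "poly (pderiv (pderiv (zpol n))) s"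
  have L: "lam n \<noteq> 0" using lam_pos[OF assms] by linarith
  have ode: "(1 - s\<^sup>2) * ?E = - (rtau X - rsigma X - (rsigma X + rtau X + 2) * s) * ?D - lam n * ?P"
    using jacobi_pol_ode[of s "rsigma X" "rtau X" n] unfolding zpol_def lam_def by algebra
  have "(phi n has_real_derivative (2 * ?P * ?D + ((- 2 * s) * ?D\<^sup>2 + (1 - s\<^sup>2) * (2 * ?D * ?E)) / lam n)) (at s)"
    unfolding phi_def[abs_def]
    by (auto intro!: derivative_eq_intros poly_DERIV simp: L field_simps power2_eq_square)
  moreover have "(1 - s\<^sup>2) * (2 * ?D * ?E) = 2 * ?D * (- (rtau X - rsigma X - (rsigma X + rtau X + 2) * s) * ?D - lam n * ?P)"
    unfolding ode[symmetric] by simp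
  then have num: "(- 2 * s) * ?D\<^sup>2 + (1 - s\<^sup>2) * (2 * ?D * ?E)
    = 2 * (rsigma X - rtau X + (rsigma X + rtau X + 1) * s) * ?D\<^sup>2 - lam n * (2 * ?P * ?D)"
    by (simp add: algebra_simps power2_eq_square)
  have "2 * ?P * ?D + ((- 2 * s) * ?D\<^sup>2 + (1 - s\<^sup>2) * (2 * ?D * ?E)) / lam n
    = 2 * (rsigma X - rtau X + (rsigma X + rtau X + 1) * s) * ?D\<^sup>2 / lam n"
    unfolding num diff_divide_distrib nonzero_mult_div_cancel_left[OF L] by simp
  ultimately show ?thesis by simp
qed

text \<open>A Gronwall argument: \<open>\<bar>phi' n\<bar> \<le> K * phi n\<close> on compact subintervals of the open interval,
  with \<open>K\<close> independent of \<open>n\<close>.\<close>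

lemma phi_compare:
  assumes "\<bar>s\<bar> < 1" "\<bar>t\<bar> < 1"
  obtains C where "\<And>n. n > 0 \<Longrightarrow> phi n s \<le> C * phi n t"
proof -
  define r where "r = max \<bar>s\<bar> \<bar>t\<bar>"
  have r: "0 \<le> r" "r < 1" "\<bar>s\<bar> \<le> r" "\<bar>t\<bar> \<le> r" using assms by (auto simp: r_def)
  have r2: "1 - r\<^sup>2 > 0" using r by (simp add: abs_square_less_1)
  define Q where "Q = \<bar>rsigma X - rtau X\<bar> + \<bar>rsigma X + rtau X + 1\<bar>"
  \<comment> \<open>Q bounds the linear coefficient of \<open>phi_deriv\<close> on [-1, 1]. Dividing
    by 1 - r^2, which is at most 1 - x^2 on the interval, allows the second summand of
    \<open>phi\<close> to absorb the derivative.\<close>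
  define K where "K = 2 * Q / (1 - r\<^sup>2)"
  define d where "d n s = 2 * (rsigma X - rtau X + (rsigma X + rtau X + 1) * s) * (poly (pderiv (zpol n)) s)\<^sup>2 / lam n" for n s
  have dphi: "\<bar>d n x\<bar> \<le> K * phi n x" if n: "n > 0" and x: "\<bar>x\<bar> \<le> r" for n x
  proof -
    let ?D = "(poly (pderiv (zpol n)) x)\<^sup>2 / lam n"
    have D: "?D \<ge> 0" using lam_pos[OF n] by simp
    have x2: "x\<^sup>2 \<le> r\<^sup>2" using x r by (metis abs_le_square_iff abs_of_nonneg)
    have "\<bar>rsigma X - rtau X + (rsigma X + rtau X + 1) * x\<bar> \<le> \<bar>rsigma X - rtau X\<bar> + \<bar>rsigma X + rtau X + 1\<bar> * \<bar>x\<bar>"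
      by (metis abs_mult abs_triangle_ineq)
    also have "\<dots> \<le> Q" unfolding Q_def using x r by (intro add_left_mono mult_left_le) auto
    finally have q: "\<bar>rsigma X - rtau X + (rsigma X + rtau X + 1) * x\<bar> \<le> Q" .
    have "d n x = 2 * (rsigma X - rtau X + (rsigma X + rtau X + 1) * x) * ?D" by (simp add: d_def)
    then have "\<bar>d n x\<bar> = 2 * \<bar>rsigma X - rtau X + (rsigma X + rtau X + 1) * x\<bar> * ?D"
      by (simp only: abs_mult abs_of_nonneg[OF D] abs_numeral)
    also have "\<dots> \<le> 2 * Q * ?D" using q D by (intro mult_right_mono) auto
    also have "\<dots> = K * ((1 - r\<^sup>2) * ?D)" using r2 by (simp add: K_def)
    also have "\<dots> \<le> K * ((1 - x\<^sup>2) * ?D)"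
      using D x2 r2 by (intro mult_left_mono mult_right_mono) (auto simp: K_def Q_def)
    also have "\<dots> \<le> K * phi n x"
      using r2 by (intro mult_left_mono) (auto simp: phi_def K_def Q_def)
    finally show ?thesis .
  qed
  have K0: "K \<ge> 0" using r2 by (auto simp: K_def Q_def)
  have up: "phi n x * exp (- K * x) \<ge> phi n y * exp (- K * y)" and
    dn: "phi n x * exp (K * x) \<le> phi n y * exp (K * y)" if n: "n > 0" and xy: "- r \<le> x" "x \<le> y" "y \<le> r" for n x y
  proof -
    show "phi n x * exp (- K * x) \<ge> phi n y * exp (- K * y)"
    proof (rule DERIV_nonpos_imp_nonincreasing[OF xy(2)])
      fix z assume "x \<le> z" "z \<le> y"
      with xy have zr: "\<bar>z\<bar> \<le> r" by (simp add: abs_le_iff)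
      have "((\<lambda>z. phi n z * exp (- K * z)) has_real_derivative (d n z - K * phi n z) * exp (- K * z)) (at z)"
        by (auto intro!: derivative_eq_intros phi_deriv[OF n] simp: d_def algebra_simps)
      moreover have "(d n z - K * phi n z) * exp (- K * z) \<le> 0"
        using abs_le_D1[OF dphi[OF n zr]] by (intro mult_nonpos_nonneg) auto
      ultimately show "\<exists>w. ((\<lambda>z. phi n z * exp (- K * z)) has_real_derivative w) (at z) \<and> w \<le> 0" by blast
    qed
    show "phi n x * exp (K * x) \<le> phi n y * exp (K * y)"
    proof (rule DERIV_nonneg_imp_nondecreasing[OF xy(2)])
      fix z assume "x \<le> z" "z \<le> y"
      with xy have zr: "\<bar>z\<bar> \<le> r" by (simp add: abs_le_iff)
      have "((\<lambda>z. phi n z * exp (K * z)) has_real_derivative (d n z + K * phi n z) * exp (K * z)) (at z)"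
        by (auto intro!: derivative_eq_intros phi_deriv[OF n] simp: d_def algebra_simps)
      moreover have "(d n z + K * phi n z) * exp (K * z) \<ge> 0"
        using abs_le_D2[OF dphi[OF n zr]] by (intro mult_nonneg_nonneg) auto
      ultimately show "\<exists>w. ((\<lambda>z. phi n z * exp (K * z)) has_real_derivative w) (at z) \<and> 0 \<le> w" by blast
    qed
  qed
  have "phi n s \<le> exp (K * \<bar>s - t\<bar>) * phi n t" if n: "n > 0" for n
  proof (cases "s \<le> t")
    case True
    have "phi n s * exp (K * s) \<le> phi n t * exp (K * t)" using r True by (intro dn n) auto
    then have "phi n s \<le> phi n t * (exp (K * t) / exp (K * s))"
      by (simp add: pos_le_divide_eq)
    then show ?thesis using True by (simp add: exp_diff[symmetric] algebra_simps)
  next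
    case False
    have "phi n s * exp (- K * s) \<le> phi n t * exp (- K * t)" using r False by (intro up n) auto
    then have "phi n s \<le> phi n t * (exp (- K * t) / exp (- K * s))"
      by (simp add: pos_le_divide_eq)
    then show ?thesis using False by (simp add: exp_diff[symmetric] algebra_simps)
  qed
  then show ?thesis by (rule that)
qed

text \<open>A majorant of \<open>zeta n\<close> that inherits the comparison of values from
  \<open>phi\<close>. The function \<open>zeta n\<close> itself may vanish at single points, so
  smallness at one point says nothing about another.\<close>

definition env :: "nat \<Rightarrow> real \<Rightarrow> real" where
  "env n s = sqrt (phi n s / hn n)"

lemma abs_zeta_le_env: "\<bar>s\<bar> \<le> 1 \<Longrightarrow> \<bar>zeta n s\<bar> \<le> env n s"
  unfolding zeta_def env_def real_sqrt_divide abs_divide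
  using real_sqrt_le_mono[OF poly_square_le_phi[of s n]] hn_nonneg[of n]
  by (auto intro: divide_right_mono)

lemma env_nonneg: "\<bar>s\<bar> \<le> 1 \<Longrightarrow> env n s \<ge> 0"
  using abs_zeta_le_env[of s n] by linarith

lemma continuous_phi: "continuous_on (points X) (\<lambda>x. phi n (l x))"
  unfolding phi_def divide_inverse
  by (intro continuous_intros continuous_on_poly continuous_l)

lemma continuous_env: "continuous_on (points X) (\<lambda>x. env n (l x))"
  unfolding env_def divide_inverse by (intro continuous_intros continuous_phi)

text \<open>Both summands have mean \<open>hn n\<close>: the first by definition, the second by the
  energy identity.\<close>

lemma integral_phi: "n > 0 \<Longrightarrow> (\<integral>x. phi n (l x) \<partial>M) = 2 * hn n"
proof -
  assume n: "n > 0"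
  have "(\<integral>x. phi n (l x) \<partial>M) = (\<integral>x. (poly (zpol n) (l x))\<^sup>2 \<partial>M)
      + (\<integral>x. (1 - (l x)\<^sup>2) * (poly (pderiv (zpol n)) (l x))\<^sup>2 / lam n \<partial>M)"
    unfolding phi_def divide_inverse
    by (rule Bochner_Integration.integral_add)
      (intro integrable_continuous continuous_intros continuous_on_poly continuous_l)+
  also have "\<dots> = 2 * hn n"
    using lam_pos[OF n] by (simp add: integral_gradient_zpol flip: hn_def)
  finally show ?thesis .
qed

lemma integral_env_le: "n > 0 \<Longrightarrow> (\<integral>x. env n (l x) \<partial>M) \<le> measure M (points X) + 2"
proof -
  assume n: "n > 0"
  have "(\<integral>x. env n (l x) \<partial>M) \<le> (\<integral>x. 1 + phi n (l x) / hn n \<partial>M)"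
  proof (intro integral_mono integrable_continuous continuous_env)
    show "continuous_on (points X) (\<lambda>x. 1 + phi n (l x) / hn n)"
      unfolding divide_inverse by (intro continuous_intros continuous_phi)
    fix x assume "x \<in> space M"
    then have "phi n (l x) / hn n \<ge> 0" using phi_nonneg[OF l_le] hn_nonneg by simp
    then have "sqrt (phi n (l x) / hn n) \<le> 1 + (sqrt (phi n (l x) / hn n))\<^sup>2"
      using zero_le_power2[of "sqrt (phi n (l x) / hn n) - 1"]
      by (simp add: power2_diff)
    with \<open>phi n (l x) / hn n \<ge> 0\<close> show "env n (l x) \<le> 1 + phi n (l x) / hn n"
      by (simp add: env_def)
  qed
  also have "\<dots> = measure M (points X) + 2 * hn n / hn n"
    using integrable_continuous[OF continuous_phi, of n]
    by (subst Bochner_Integration.integral_add) (auto simp: integral_phi[OF n])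
  also have "\<dots> \<le> measure M (points X) + 2" by simp
  finally show ?thesis .
qed

text \<open>Tonelli: the integrals of the terms are summable by \<open>integral_env_le\<close>. The
  index is shifted because \<open>lam 0 = 0\<close>, and the bound on the mean of
  \<open>env n\<close> holds for n > 0.\<close>

lemma AE_summable_env:
  assumes "summable (\<lambda>n. \<bar>a n :: real\<bar>)"
  shows "AE x in M. summable (\<lambda>n. \<bar>a (Suc n)\<bar> * env (Suc n) (l x))"
proof -
  have env0: "env n (l x) \<ge> 0" if "x \<in> space M" for n x
    using that env_nonneg[OF l_le] by simp
  have meas: "(\<lambda>x. env n (l x)) \<in> borel_measurable M" for n
    by (intro borel_measurable_riem continuous_env)
  have sum: "summable (\<lambda>n. \<bar>a (Suc n)\<bar> * (measure M (points X) + 2))"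
    using assms summable_Suc_iff[of "\<lambda>n. \<bar>a n\<bar>"] by (intro summable_mult2) simp
  have "(\<integral>\<^sup>+x. (\<Sum>n. ennreal (\<bar>a (Suc n)\<bar> * env (Suc n) (l x))) \<partial>M)
    = (\<Sum>n. \<integral>\<^sup>+x. ennreal (\<bar>a (Suc n)\<bar> * env (Suc n) (l x)) \<partial>M)"
    using meas by (intro nn_integral_suminf) simp
  also have "\<dots> \<le> (\<Sum>n. ennreal (\<bar>a (Suc n)\<bar> * (measure M (points X) + 2)))"
  proof (intro suminf_le)
    fix n
    have "(\<integral>\<^sup>+x. ennreal (\<bar>a (Suc n)\<bar> * env (Suc n) (l x)) \<partial>M)
      = ennreal (\<integral>x. \<bar>a (Suc n)\<bar> * env (Suc n) (l x) \<partial>M)"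
      using env0 by (intro nn_integral_eq_integral integrable_mult_right integrable_continuous continuous_env AE_I2) auto
    also have "\<dots> \<le> ennreal (\<bar>a (Suc n)\<bar> * (measure M (points X) + 2))"
      using integral_env_le[of "Suc n"] by (intro ennreal_leI) (simp add: mult_left_mono)
    finally show "(\<integral>\<^sup>+x. ennreal (\<bar>a (Suc n)\<bar> * env (Suc n) (l x)) \<partial>M)
      \<le> ennreal (\<bar>a (Suc n)\<bar> * (measure M (points X) + 2))" .
  qed auto
  also have "\<dots> < \<infinity>"
    by (subst suminf_ennreal2[OF _ sum]) auto
  finally have "AE x in M. (\<Sum>n. ennreal (\<bar>a (Suc n)\<bar> * env (Suc n) (l x))) \<noteq> \<infinity>"
    using meas by (intro nn_integral_PInf_AE) auto
  then show ?thesis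
  proof (rule AE_mp, intro AE_I2 impI)
    fix x assume "x \<in> space M" "(\<Sum>n. ennreal (\<bar>a (Suc n)\<bar> * env (Suc n) (l x))) \<noteq> \<infinity>"
    then show "summable (\<lambda>n. \<bar>a (Suc n)\<bar> * env (Suc n) (l x))"
      using env0 by (intro summable_suminf_not_top) auto
  qed
qed

lemma summable_zeta_if_env:
  assumes "summable (\<lambda>n. \<bar>a (Suc n)\<bar> * env (Suc n) s)" "\<bar>s\<bar> \<le> 1"
  shows "summable (\<lambda>n. \<bar>a n :: real\<bar> * \<bar>zeta n s\<bar>)"
proof -
  have "summable (\<lambda>n. \<bar>a (Suc n)\<bar> * \<bar>zeta (Suc n) s\<bar>)"
    by (rule summable_comparison_test'[OF assms(1)])
      (auto simp: abs_mult intro!: mult_left_mono abs_zeta_le_env assms(2))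
  then show ?thesis using summable_Suc_iff[of "\<lambda>n. \<bar>a n\<bar> * \<bar>zeta n s\<bar>"] by simp
qed

lemma AE_summable_zeta:
  assumes "summable (\<lambda>n. \<bar>a n :: real\<bar>)"
  shows "AE x in M. summable (\<lambda>n. \<bar>a n\<bar> * \<bar>zeta n (l x)\<bar>)"
  using AE_summable_env[OF assms]
  by (rule AE_mp) (auto intro!: AE_I2 summable_zeta_if_env l_le)

text \<open>Almost everywhere convergence of the majorants supplies one good interior point, unless
  M is carried by the set |l| = 1; \<open>phi_compare\<close> spreads the convergence from this
  point to s.\<close>

lemma interior_summable_zeta:
  assumes a: "summable (\<lambda>n. \<bar>a n :: real\<bar>)" and s: "\<bar>s\<bar> < 1"
  shows "summable (\<lambda>n. \<bar>a n\<bar> * \<bar>zeta n s\<bar>)"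
proof (cases "\<exists>y\<in>points X. \<bar>l y\<bar> < 1 \<and> summable (\<lambda>n. \<bar>a (Suc n)\<bar> * env (Suc n) (l y))")
  case True
  then obtain y where y: "y \<in> points X" "\<bar>l y\<bar> < 1" "summable (\<lambda>n. \<bar>a (Suc n)\<bar> * env (Suc n) (l y))"
    by blast
  obtain C where C: "\<And>n. n > 0 \<Longrightarrow> phi n s \<le> C * phi n (l y)" by (rule phi_compare[OF s y(2)]) blast
  \<comment> \<open>\<open>phi_compare\<close> does not fix the sign of C, so its absolute value
    goes under the root.\<close>
  have env: "env (Suc n) s \<le> sqrt \<bar>C\<bar> * env (Suc n) (l y)" for n
  proof -
    have "phi (Suc n) s / hn (Suc n) \<le> C * phi (Suc n) (l y) / hn (Suc n)"
      using C[of "Suc n"] hn_nonneg by (intro divide_right_mono) auto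
    also have "\<dots> \<le> \<bar>C\<bar> * (phi (Suc n) (l y) / hn (Suc n))"
      using phi_nonneg[of "l y" "Suc n"] y(2) hn_nonneg[of "Suc n"]
      by (auto intro!: divide_right_mono mult_right_mono)
    finally show ?thesis unfolding env_def real_sqrt_mult[symmetric] by (rule real_sqrt_le_mono)
  qed
  have "summable (\<lambda>n. \<bar>a (Suc n)\<bar> * env (Suc n) s)"
  proof (rule summable_comparison_test')
    show "summable (\<lambda>n. sqrt \<bar>C\<bar> * (\<bar>a (Suc n)\<bar> * env (Suc n) (l y)))" by (intro summable_mult y)
    show "norm (\<bar>a (Suc n)\<bar> * env (Suc n) s) \<le> sqrt \<bar>C\<bar> * (\<bar>a (Suc n)\<bar> * env (Suc n) (l y))" for n
      using mult_left_mono[OF env[of n], of "\<bar>a (Suc n)\<bar>"] env_nonneg[of s "Suc n"] s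
      by (simp add: mult_ac)
  qed
  then show ?thesis using s by (intro summable_zeta_if_env) auto
next
  case False
  \<comment> \<open>Now M is carried by |l| = 1, where 1 - l^2 vanishes. The energy identity then
    forces \<open>hn (Suc n) = 0\<close>, so all terms but the first are zero.\<close>
  have AE: "AE x in M. \<bar>l x\<bar> = 1"
    using AE_summable_env[OF a]
  proof (rule AE_mp, intro AE_I2 impI)
    fix x assume "x \<in> space M" "summable (\<lambda>n. \<bar>a (Suc n)\<bar> * env (Suc n) (l x))"
    then show "\<bar>l x\<bar> = 1" using False l_le[of x] by force
  qed
  have "zeta (Suc n) s = 0" for n
  proof -
    have "lam (Suc n) * hn (Suc n) = (\<integral>x. (0::real) \<partial>M)"
      unfolding integral_gradient_zpol[symmetric]
    proof (rule integral_cong_AE)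
      show "AE x in M. (1 - (l x)\<^sup>2) * (poly (pderiv (zpol (Suc n))) (l x))\<^sup>2 = 0"
        using AE by (rule AE_mp) (auto simp: abs_square_eq_1)
    qed (auto intro!: borel_measurable_riem continuous_intros continuous_on_poly continuous_l)
    then have "hn (Suc n) = 0" using lam_pos[of "Suc n"] by simp
    then show ?thesis by (simp add: zeta_def)
  qed
  then have "summable (\<lambda>n. \<bar>a (Suc n)\<bar> * \<bar>zeta (Suc n) s\<bar>)" by simp
  then show ?thesis using summable_Suc_iff[of "\<lambda>n. \<bar>a n\<bar> * \<bar>zeta n s\<bar>"] by simp
qed

end

section \<open>Transference\<close>

lemma ennreal_powr_mono: "x \<le> y \<Longrightarrow> r \<ge> 0 \<Longrightarrow> ennreal_powr x r \<le> ennreal_powr y r"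
  by (auto simp: ennreal_powr_def top_unique less_top intro!: ennreal_leI powr_mono2 enn2real_mono)

lemma ennreal_powr_powr_inverse: "r > 0 \<Longrightarrow> ennreal_powr (ennreal_powr x r) (1 / r) = x"
  by (auto simp: ennreal_powr_def powr_powr less_top)

lemma ennreal_powr_le_iff:
  assumes "r > 0"
  shows "ennreal_powr x (1 / r) \<le> y \<longleftrightarrow> x \<le> ennreal_powr y r"
proof
  assume "ennreal_powr x (1 / r) \<le> y"
  then have "ennreal_powr (ennreal_powr x (1 / r)) r \<le> ennreal_powr y r"
    using assms by (intro ennreal_powr_mono) auto
  then show "x \<le> ennreal_powr y r"
    using ennreal_powr_powr_inverse[of "1 / r" x] assms by simp
next
  assume "x \<le> ennreal_powr y r"
  then have "ennreal_powr x (1 / r) \<le> ennreal_powr (ennreal_powr y r) (1 / r)"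
    using assms by (intro ennreal_powr_mono) auto
  then show "ennreal_powr x (1 / r) \<le> y"
    using ennreal_powr_powr_inverse[of r y] assms by simp
qed

text \<open>A monotone map with open range is continuous for the order topology; here the range is
  everything, by the inverse power.\<close>

lemma continuous_ennreal_powr:
  assumes "r > 0"
  shows "continuous_on UNIV (\<lambda>x. ennreal_powr x r)"
proof (rule continuous_onI_mono)
  have "surj (\<lambda>x. ennreal_powr x r)"
    using ennreal_powr_powr_inverse[of "1 / r"] assms by (intro surjI[of _ "\<lambda>x. ennreal_powr x (1 / r)"]) auto
  then show "open (range (\<lambda>x. ennreal_powr x r))" by simp
qed (use assms in \<open>auto intro: ennreal_powr_mono\<close>)

lemma borel_measurable_ennreal_powr:
  "r > 0 \<Longrightarrow> f \<in> borel_measurable M \<Longrightarrow> (\<lambda>x. ennreal_powr (f x) r) \<in> borel_measurable M"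
  using measurable_compose[OF _ borel_measurable_continuous_onI[OF continuous_ennreal_powr]] .

lemma ennreal_powr_ennreal: "y \<ge> 0 \<Longrightarrow> ennreal_powr (ennreal y) r = ennreal (y powr r)"
  by (simp add: ennreal_powr_def)

lemma ennreal_powr_mult:
  assumes "r > 0"
  shows "ennreal_powr (x * y) r = ennreal_powr x r * ennreal_powr y r"
proof (cases "x = \<top> \<or> y = \<top>")
  case True
  then show ?thesis using assms
    by (auto simp: ennreal_powr_def ennreal_top_mult ennreal_mult_top enn2real_eq_0_iff)
next
  case False
  then show ?thesis
    by (simp add: ennreal_powr_def ennreal_mult_eq_top_iff enn2real_mult powr_mult ennreal_mult)
qed

text \<open>The graph of y^r lies above its tangent at z. This is weighted AM-GM with weights 1 / r
  and 1 - 1 / r, which includes r = 1.\<close>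

lemma ennreal_powr_tangent:
  assumes r: "r \<ge> 1" and z: "z > 0"
  shows "ennreal (r * z powr (r - 1)) * F \<le> ennreal_powr F r + ennreal ((r - 1) * z powr r)"
proof (cases F)
  case (real y)
  have "y * z powr (r - 1) \<le> y powr r / r + (1 - 1 / r) * z powr r"
  proof (cases "y = 0")
    case False
    then have y: "y > 0" using real by simp
    have "(y powr r) powr (1 / r) * (z powr r) powr (1 - 1 / r) \<le> 1 / r * y powr r + (1 - 1 / r) * z powr r"
      using y z r by (intro Youngs_inequality_0) auto
    moreover have "(y powr r) powr (1 / r) = y" using r y by (simp add: powr_powr)
    moreover have "(z powr r) powr (1 - 1 / r) = z powr (r - 1)"
      using r by (simp add: powr_powr right_diff_distrib)
    ultimately show ?thesis by simp
  qed (use r in simp)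
  then have "r * (y * z powr (r - 1)) \<le> r * (y powr r / r + (1 - 1 / r) * z powr r)"
    using r by (intro mult_left_mono) auto
  also have "\<dots> = y powr r + (r - 1) * z powr r" using r by (simp add: field_simps)
  finally have "ennreal (r * z powr (r - 1) * y) \<le> ennreal (y powr r + (r - 1) * z powr r)"
    by (intro ennreal_leI) (simp add: mult_ac)
  then show ?thesis using real r
    by (simp add: ennreal_mult ennreal_plus ennreal_powr_ennreal)
qed (simp add: ennreal_powr_def)

lemma suminf_ennreal_sums:
  assumes "\<And>k. v k \<ge> 0" "v sums s"
  shows "(\<Sum>k. ennreal (v k)) = ennreal s"
  unfolding suminf_ennreal2[OF assms(1) sums_summable[OF assms(2)]] sums_unique[OF assms(2), symmetric] ..

text \<open>The tangent inequality at the mean of the F k, averaged against the weights. If the mean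
  is infinite, the tangent at z = 1 already makes the right-hand side infinite.\<close>

lemma ennreal_powr_Jensen:
  fixes F :: "nat \<Rightarrow> ennreal" and v :: "nat \<Rightarrow> real"
  assumes r: "r \<ge> 1" and v: "\<And>k. v k \<ge> 0" "v sums 1"
  shows "ennreal_powr (\<Sum>k. ennreal (v k) * F k) r \<le> (\<Sum>k. ennreal (v k) * ennreal_powr (F k) r)"
proof -
  let ?S = "\<Sum>k. ennreal (v k) * F k" and ?Q = "\<Sum>k. ennreal (v k) * ennreal_powr (F k) r"
  have v1: "(\<Sum>k. ennreal (v k)) = 1"
    using suminf_ennreal_sums[of v, OF v] by simp
  have tang: "ennreal (r * z powr (r - 1)) * ?S \<le> ?Q + ennreal ((r - 1) * z powr r)" if z: "z > 0" for z
  proof -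
    have "ennreal (r * z powr (r - 1)) * ?S = (\<Sum>k. ennreal (v k) * (ennreal (r * z powr (r - 1)) * F k))"
      by (simp add: mult.left_commute flip: ennreal_suminf_cmult)
    also have "\<dots> \<le> (\<Sum>k. ennreal (v k) * (ennreal_powr (F k) r + ennreal ((r - 1) * z powr r)))"
      by (intro suminf_le mult_left_mono ennreal_powr_tangent r z) auto
    also have "\<dots> = ?Q + (\<Sum>k. ennreal (v k)) * ennreal ((r - 1) * z powr r)"
      by (simp add: distrib_left suminf_add[symmetric])
    finally show ?thesis by (simp add: v1)
  qed
  show ?thesis
  proof (cases ?S)
    case (real z)
    show ?thesis
    proof (cases "z = 0")
      case True
      then show ?thesis using real r by (simp add: ennreal_powr_def)
    next
      case False
      with real have z: "z > 0" by simp
      have "r * z powr (r - 1) * z = z powr r + (r - 1) * z powr r"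
        using z by (simp add: powr_diff algebra_simps)
      then have "ennreal (z powr r) + ennreal ((r - 1) * z powr r) = ennreal (r * z powr (r - 1) * z)"
        using r by (subst ennreal_plus[symmetric]) auto
      also have "\<dots> = ennreal (r * z powr (r - 1)) * ennreal z"
        using z r by (intro ennreal_mult) auto
      also have "\<dots> \<le> ?Q + ennreal ((r - 1) * z powr r)"
        using tang[OF z] real(2) by simp
      finally have "ennreal (z powr r) + ennreal ((r - 1) * z powr r) \<le> ?Q + ennreal ((r - 1) * z powr r)" .
      then have "ennreal (z powr r) \<le> ?Q"
        using ennreal_add_left_cancel_le[of "ennreal ((r - 1) * z powr r)" "ennreal (z powr r)" ?Q]
        by (simp add: add.commute)
      then show ?thesis using real z by (simp add: ennreal_powr_ennreal)
    qed
  next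
    case top
    have "ennreal r * \<top> \<le> ?Q + ennreal (r - 1)" using tang[of 1] top by simp
    moreover have "ennreal r * \<top> = \<top>" using r by (simp add: ennreal_mult_top)
    ultimately have "?Q = \<top>"
      by (metis add_right_mono ennreal_add_eq_top ennreal_neq_top top_unique)
    then show ?thesis by simp
  qed
qed

text \<open>In the role of Minkowski's inequality for a countable sum: the weights are scaled to
  total mass 1, so that Jensen's inequality applies and the integral can be taken term by
  term.\<close>

lemma nn_integral_powr_suminf_le:
  fixes F :: "nat \<Rightarrow> 'a \<Rightarrow> ennreal" and w :: "nat \<Rightarrow> real"
  assumes F: "\<And>k. F k \<in> borel_measurable M" and r: "r \<ge> 1"
    and w: "\<And>k. w k \<ge> 0" "w sums W" "W > 0"
    and Y: "\<And>k. (\<integral>\<^sup>+x. ennreal_powr (F k x) r \<partial>M) \<le> Y"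
  shows "(\<integral>\<^sup>+x. ennreal_powr (\<Sum>k. ennreal (w k) * F k x) r \<partial>M) \<le> ennreal_powr (ennreal W) r * Y"
proof -
  define v where "v k = w k / W" for k
  have v: "v k \<ge> 0" "v sums 1" for k
    using w sums_divide[OF w(2), of W] by (auto simp: v_def[abs_def])
  have wv: "ennreal (w k) = ennreal W * ennreal (v k)" for k
    using w by (simp add: v_def flip: ennreal_mult)
  have v1: "(\<Sum>k. ennreal (v k)) = 1"
    using suminf_ennreal_sums[of v, OF v] by simp
  have "(\<integral>\<^sup>+x. ennreal_powr (\<Sum>k. ennreal (w k) * F k x) r \<partial>M)
    = (\<integral>\<^sup>+x. ennreal_powr (ennreal W) r * ennreal_powr (\<Sum>k. ennreal (v k) * F k x) r \<partial>M)"
    using r by (simp add: wv mult.assoc ennreal_powr_mult[symmetric] ennreal_suminf_cmult)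
  also have "\<dots> \<le> (\<integral>\<^sup>+x. ennreal_powr (ennreal W) r * (\<Sum>k. ennreal (v k) * ennreal_powr (F k x) r) \<partial>M)"
    by (intro nn_integral_mono mult_left_mono ennreal_powr_Jensen r v) simp
  also have "\<dots> = ennreal_powr (ennreal W) r * (\<Sum>k. ennreal (v k) * (\<integral>\<^sup>+x. ennreal_powr (F k x) r \<partial>M))"
  proof -
    have [measurable]: "(\<lambda>x. ennreal_powr (F k x) r) \<in> borel_measurable M" for k
      using F r by (intro borel_measurable_ennreal_powr) auto
    show ?thesis by (simp add: nn_integral_cmult nn_integral_suminf)
  qed
  also have "\<dots> \<le> ennreal_powr (ennreal W) r * (\<Sum>k. ennreal (v k) * Y)"
    by (intro mult_left_mono suminf_le Y) auto
  finally show ?thesis by (simp add: v1)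
qed

lemma SUP_rationals:
  fixes g :: "real \<Rightarrow> real"
  assumes "continuous_on UNIV g" "\<And>t. g t \<ge> 0"
  shows "(SUP t\<in>{0..<2 * pi}. ennreal (g t)) = (SUP t\<in>{0..<2 * pi} \<inter> \<rat>. ennreal (g t))"
proof (rule antisym)
  show "(SUP t\<in>{0..<2 * pi}. ennreal (g t)) \<le> (SUP t\<in>{0..<2 * pi} \<inter> \<rat>. ennreal (g t))"
  proof (rule SUP_least, rule ccontr)
    fix t assume t: "t \<in> {0..<2 * pi}"
    assume "\<not> ennreal (g t) \<le> (SUP t\<in>{0..<2 * pi} \<inter> \<rat>. ennreal (g t))"
    then have less: "(SUP t\<in>{0..<2 * pi} \<inter> \<rat>. ennreal (g t)) < ennreal (g t)" by simp
    then obtain s where s: "s \<ge> 0" "(SUP t\<in>{0..<2 * pi} \<inter> \<rat>. ennreal (g t)) = ennreal s"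
      by (cases "SUP t\<in>{0..<2 * pi} \<inter> \<rat>. ennreal (g t)") auto
    then have st: "s < g t" using less by (simp add: ennreal_less_iff)
    have "isCont g t" using assms(1) by (simp add: continuous_on_eq_continuous_at)
    then have "\<forall>\<^sub>F q in at t. s < g q"
      using st by (simp add: isCont_def order_tendsto_iff)
    then obtain d where d: "d > 0" "\<And>q. q \<noteq> t \<Longrightarrow> dist q t < d \<Longrightarrow> s < g q"
      unfolding eventually_at by blast
    \<comment> \<open>Taken to the right of t, q stays in the half-open interval even for t =
      0.\<close>
    obtain q where q: "q \<in> \<rat>" "t < q" "q < min (2 * pi) (t + d)"
      using Rats_dense_in_real[of t "min (2 * pi) (t + d)"] t d(1) by auto
    then have "s < g q" by (intro d(2)) (auto simp: dist_real_def)
    moreover have "ennreal (g q) \<le> ennreal s"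
      unfolding s(2)[symmetric] using q t by (intro SUP_upper) auto
    ultimately show False using s(1) assms(2)[of q] by (simp add: ennreal_le_iff)
  qed
qed (auto intro!: SUP_subset_mono)

section \<open>Finite zonal sums and measurability of the maximal functions\<close>

context zonal_flow
begin

definition comb :: "nat \<Rightarrow> (nat \<Rightarrow> complex) \<Rightarrow> 'e \<Rightarrow> complex" where
  "comb N c x = (\<Sum>n<N. c n * complex_of_real (zonal X b n x))"

lemma continuous_zonal: "continuous_on (points X) (zonal X b n)"
  by (subst continuous_on_cong[OF refl zonal_eq])
    (auto simp: zeta_def divide_inverse intro!: continuous_intros continuous_on_poly continuous_l)

lemma measurable_zonal [measurable]: "zonal X b n \<in> borel_measurable M"
  by (intro borel_measurable_riem continuous_zonal)

lemma smooth_comb: "smooth_fun X (comb N c)"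
proof -
  define g where "g x = (\<Sum>n<N. c n / complex_of_real (sqrt (hn n)) * Zf (zpol n) x)" for x
  have "C_inf g" unfolding g_def[abs_def] by (intro C_inf_sum C_inf_mult C_inf_const C_inf_Zf)
  moreover have "comb N c x = g x" if "x \<in> points X" for x
    using that by (simp add: comb_def g_def zonal_eq zeta_def Zf_def)
  ultimately show ?thesis unfolding smooth_fun_def C_inf_def by blast
qed

lemma radial_comb: "radial X b (comb N c)"
  unfolding radial_def comb_def zonal_def zonal0_def
  by (intro exI[of _ "\<lambda>\<theta>. \<Sum>n<N. c n * complex_of_real (jacobi_poly (rsigma X) (rtau X) n (cos \<theta>) /
    sqrt (\<integral>y. (jacobi_poly (rsigma X) (rtau X) n (cos (geo_dist X b y)))\<^sup>2 \<partial>M))"]) simp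

lemma zcoeff_comb: "zcoeff X b (comb N c) n = (if n < N \<and> hn n \<noteq> 0 then c n else 0)"
proof -
  let ?z = "\<lambda>n x. complex_of_real (zonal X b n x)"
  have "zcoeff X b (comb N c) n = (\<integral>x. (\<Sum>m<N. c m * (?z m x * ?z n x)) \<partial>M)"
    unfolding zcoeff_def comb_def sum_distrib_right
    by (intro Bochner_Integration.integral_cong refl sum.cong) (simp add: mult.assoc)
  also have "\<dots> = (\<Sum>m<N. c m * (\<integral>x. ?z m x * ?z n x \<partial>M))"
    by (subst Bochner_Integration.integral_sum)
      (auto intro!: integrable_continuous continuous_intros continuous_zonal)
  also have "\<dots> = (\<Sum>m<N. if m = n then (if hn n \<noteq> 0 then c n else 0) else 0)"
    by (intro sum.cong refl) (simp add: integral_zonal_mult)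
  also have "\<dots> = (if n < N \<and> hn n \<noteq> 0 then c n else 0)"
    by (simp add: sum.delta)
  finally show ?thesis .
qed

text \<open>The proviso \<open>hn n \<noteq> 0\<close> of \<open>zcoeff_comb\<close> disappears for
  coefficients that come from a function: if \<open>hn n = 0\<close>, they vanish.\<close>

lemma zcoeff_comb_zcoeff:
  "zcoeff X b (comb N (\<lambda>n. w n * zcoeff X b f n)) n = (if n < N then w n * zcoeff X b f n else 0)"
proof -
  have "zcoeff X b f n = 0" if "hn n = 0"
  proof -
    have "zcoeff X b f n = (\<integral>x. 0 \<partial>M)"
      unfolding zcoeff_def
      by (intro Bochner_Integration.integral_cong refl) (simp add: zonal_eq zeta_def that)
    then show ?thesis by simp
  qed
  then show ?thesis by (auto simp: zcoeff_comb)
qed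

lemma sobolev_comb_le:
  assumes "\<And>n. cmod (w n) \<le> 1"
  shows "sobolev_norm X b \<alpha> (comb N (\<lambda>n. w n * zcoeff X b f n)) \<le> sobolev_norm X b \<alpha> f"
  unfolding sobolev_norm_def
proof (intro ennreal_powr_mono suminf_le ennreal_leI mult_left_mono)
  show "(cmod (zcoeff X b (comb N (\<lambda>n. w n * zcoeff X b f n)) n))\<^sup>2 \<le> (cmod (zcoeff X b f n))\<^sup>2" for n
    using mult_right_mono[OF assms, of "cmod (zcoeff X b f n)" n]
    by (auto simp: zcoeff_comb_zcoeff norm_mult intro!: power_mono)
qed auto

lemma propagator_comb:
  "propagator X b \<psi> t (comb N (\<lambda>n. w n * zcoeff X b f n)) x
    = (\<Sum>n<N. exp (- \<i> * complex_of_real (t * \<psi> (eig X n))) * (w n * zcoeff X b f n) * complex_of_real (zonal X b n x))"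
  unfolding propagator_def
  by (subst suminf_finite[of "{..<N}"]) (auto simp: zcoeff_comb_zcoeff)

lemma measurable_SUP_continuous:
  fixes u :: "real \<Rightarrow> 'e \<Rightarrow> complex"
  assumes "\<And>t. u t \<in> borel_measurable M" "\<And>x. x \<in> points X \<Longrightarrow> continuous_on UNIV (\<lambda>t. u t x)"
  shows "(\<lambda>x. SUP t\<in>{0..<2 * pi}. ennreal (cmod (u t x))) \<in> borel_measurable M"
proof -
  have "(\<lambda>x. SUP t\<in>{0..<2 * pi} \<inter> \<rat>. ennreal (cmod (u t x))) \<in> borel_measurable M"
  proof (rule borel_measurable_SUP)
    show "countable ({0..<2 * pi} \<inter> \<rat>)" using countable_rat by (rule countable_subset[rotated]) auto
  qed (use assms(1) in measurable)
  moreover have "(SUP t\<in>{0..<2 * pi}. ennreal (cmod (u t x))) = (SUP t\<in>{0..<2 * pi} \<inter> \<rat>. ennreal (cmod (u t x)))"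
    if "x \<in> points X" for x
    by (intro SUP_rationals continuous_intros assms that) auto
  ultimately show ?thesis by (subst measurable_cong) auto
qed

lemma measurable_maximal_comb:
  "maximal_fun X b \<psi> (comb N (\<lambda>n. w n * zcoeff X b f n)) \<in> borel_measurable M"
  unfolding maximal_fun_def[abs_def]
  by (rule measurable_SUP_continuous) (auto simp: propagator_comb intro!: continuous_intros)

lemma measurable_propagator: "propagator X b \<psi> t f \<in> borel_measurable M"
  unfolding propagator_def[abs_def] by (intro borel_measurable_suminf) measurable

lemma continuous_propagator:
  assumes "summable (\<lambda>n. cmod (zcoeff X b f n) * \<bar>zonal X b n x\<bar>)"
  shows "continuous_on UNIV (\<lambda>t. propagator X b \<psi> t f x)"
proof -
  have "uniform_limit UNIV
    (\<lambda>N t. \<Sum>n<N. exp (- \<i> * complex_of_real (t * \<psi> (eig X n))) * zcoeff X b f n * complex_of_real (zonal X b n x))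
    (\<lambda>t. propagator X b \<psi> t f x) sequentially"
    unfolding propagator_def
    by (rule Weierstrass_m_test[OF _ assms]) (simp add: norm_mult)
  then show ?thesis
    by (rule uniform_limit_theorem[rotated]) (auto intro!: always_eventually continuous_intros)
qed

text \<open>Measurability matters because \<open>esssup\<close> is \<open>\<top>\<close> on non-measurable functions. At the endpoints
  \<open>l x = \<plusminus>1\<close> the series might diverge, but there the maximal function is constant.\<close>

lemma measurable_maximal:
  assumes f: "smooth_fun X f"
  shows "maximal_fun X b \<psi> f \<in> borel_measurable M"
proof -
  define m where "m s = (SUP t\<in>{0..<2 * pi}. ennreal (cmod (\<Sum>n. exp (- \<i> * complex_of_real (t * \<psi> (eig X n)))
    * zcoeff X b f n * complex_of_real (zeta n s))))" for s
  have m: "maximal_fun X b \<psi> f x = m (l x)" if "x \<in> points X" for x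
    using that by (simp add: maximal_fun_def propagator_def m_def zonal_eq)
  let ?R = "\<lambda>x. SUP t\<in>{0..<2 * pi} \<inter> \<rat>. ennreal (cmod (propagator X b \<psi> t f x))"
  have [measurable]: "?R \<in> borel_measurable M"
  proof (rule borel_measurable_SUP)
    show "countable ({0..<2 * pi} \<inter> \<rat>)" using countable_rat by (rule countable_subset[rotated]) auto
    show "(\<lambda>x. ennreal (cmod (propagator X b \<psi> t f x))) \<in> borel_measurable M" for t
      using measurable_propagator[of \<psi> t f] by measurable
  qed
  have [measurable]: "l \<in> borel_measurable M" by (intro borel_measurable_riem continuous_l)
  have "(\<lambda>x. if l x = 1 then m 1 else if l x = -1 then m (-1) else ?R x) \<in> borel_measurable M"
    by measurable
  moreover have "maximal_fun X b \<psi> f x = (if l x = 1 then m 1 else if l x = -1 then m (-1) else ?R x)"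
    if x: "x \<in> space M" for x
  proof (cases "\<bar>l x\<bar> = 1")
    case True
    then show ?thesis using x m by (auto simp: abs_if split: if_splits)
  next
    case False
    then have "\<bar>l x\<bar> < 1" using l_le[of x] x by auto
    then have "summable (\<lambda>n. \<bar>cmod (zcoeff X b f n)\<bar> * \<bar>zeta n (l x)\<bar>)"
      by (intro interior_summable_zeta) (simp add: summable_zcoeff[OF f])
    then have "summable (\<lambda>n. cmod (zcoeff X b f n) * \<bar>zonal X b n x\<bar>)"
      using x by (simp add: zonal_eq)
    then have "maximal_fun X b \<psi> f x = ?R x"
      unfolding maximal_fun_def by (intro SUP_rationals continuous_intros continuous_propagator) auto
    then show ?thesis using False by auto
  qed
  ultimately show ?thesis by (subst measurable_cong) auto
qed

section \<open>Comparison of the two maximal functions\<close>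

text \<open>Since N is finite, the sum over n and the exponential series over k can be interchanged.
  Each k then contributes a propagator for \<open>\<psi>1\<close>, at the same t and x, of a finite
  zonal sum, with a factor at most (2 pi D)^k / k! since t < 2 pi.\<close>

lemma truncated_maximal_le:
  fixes D :: real
  assumes D: "D > 0" "\<And>n. \<bar>\<psi>1 (eig X n) - \<psi>2 (eig X n)\<bar> \<le> D" and t: "t \<in> {0..<2 * pi}"
  defines "\<rho> \<equiv> \<lambda>n. complex_of_real ((\<psi>2 (eig X n) - \<psi>1 (eig X n)) / D)"
  shows "ennreal (cmod (\<Sum>n<N. exp (- \<i> * complex_of_real (t * \<psi>2 (eig X n))) * zcoeff X b f n * complex_of_real (zonal X b n x)))
    \<le> (\<Sum>k. ennreal ((2 * pi * D) ^ k / fact k) * maximal_fun X b \<psi>1 (comb N (\<lambda>n. \<rho> n ^ k * zcoeff X b f n)) x)"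
proof -
  define y where "y n = exp (- \<i> * complex_of_real (t * \<psi>1 (eig X n))) * zcoeff X b f n * complex_of_real (zonal X b n x)" for n
  \<comment> \<open>The product c * \<open>\<rho>\<close> n is the phase difference - i t
    (\<open>\<psi>2\<close> - \<open>\<psi>1\<close>) at the n-th eigenvalue. D is shifted into c so
    that |\<open>\<rho>\<close> n| \<le> 1.\<close>
  define c where "c = - \<i> * complex_of_real (t * D)"
  define g where "g k = c ^ k /\<^sub>R fact k * propagator X b \<psi>1 t (comb N (\<lambda>n. \<rho> n ^ k * zcoeff X b f n)) x" for k
  have expand: "(\<lambda>k. (c * \<rho> n) ^ k /\<^sub>R fact k * y n) sums
      (exp (- \<i> * complex_of_real (t * \<psi>2 (eig X n))) * zcoeff X b f n * complex_of_real (zonal X b n x))" for n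
  proof -
    have "- \<i> * complex_of_real (t * \<psi>2 (eig X n)) = c * \<rho> n + - \<i> * complex_of_real (t * \<psi>1 (eig X n))"
      using D(1) by (simp add: c_def \<rho>_def field_simps)
    then have "exp (c * \<rho> n) * y n = exp (- \<i> * complex_of_real (t * \<psi>2 (eig X n))) * zcoeff X b f n * complex_of_real (zonal X b n x)"
      by (simp only: y_def exp_add mult.assoc)
    then show ?thesis using sums_mult2[OF exp_converges[of "c * \<rho> n"], of "y n"] by simp
  qed
  have g_eq: "g k = (\<Sum>n<N. (c * \<rho> n) ^ k /\<^sub>R fact k * y n)" for k
    unfolding g_def propagator_comb sum_distrib_left y_def
    by (intro sum.cong refl) (simp add: power_mult_distrib mult_ac)
  have g_sums: "g sums (\<Sum>n<N. exp (- \<i> * complex_of_real (t * \<psi>2 (eig X n))) * zcoeff X b f n * complex_of_real (zonal X b n x))"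
    unfolding g_eq[abs_def] by (intro sums_sum expand)
  have "cmod (c * \<rho> n) \<le> 2 * pi * D" for n
  proof -
    have "cmod (\<rho> n) \<le> 1"
      using D(2)[of n] D(1) by (simp add: \<rho>_def norm_divide abs_minus_commute flip: of_real_diff)
    moreover have "cmod c \<le> 2 * pi * D" using t D(1) by (simp add: c_def norm_mult abs_mult)
    ultimately have "cmod c * cmod (\<rho> n) \<le> 2 * pi * D * 1" using D(1) by (intro mult_mono) auto
    then show ?thesis by (simp add: norm_mult)
  qed
  have g_bound: "cmod (g k) \<le> (2 * pi * D) ^ k / fact k * cmod (propagator X b \<psi>1 t (comb N (\<lambda>n. \<rho> n ^ k * zcoeff X b f n)) x)" for k
  proof -
    have "cmod c ^ k \<le> (2 * pi * D) ^ k"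
      using t D(1) by (intro power_mono) (auto simp: c_def norm_mult abs_mult)
    then show ?thesis
      unfolding g_def norm_mult norm_scaleR norm_power
      by (intro mult_right_mono) (auto simp: divide_inverse mult.commute intro!: mult_left_mono)
  qed
  have summ: "summable (\<lambda>k. cmod (g k))"
  proof (rule summable_comparison_test')
    show "summable (\<lambda>k. \<Sum>n<N. cmod ((c * \<rho> n) ^ k /\<^sub>R fact k) * cmod (y n))"
      by (intro summable_sum summable_mult2 summable_norm_exp)
    show "norm (cmod (g k)) \<le> (\<Sum>n<N. cmod ((c * \<rho> n) ^ k /\<^sub>R fact k) * cmod (y n))" for k
      unfolding g_eq norm_mult[symmetric] real_norm_def abs_norm_cancel by (rule norm_sum)
  qed
  have "ennreal (cmod (\<Sum>n<N. exp (- \<i> * complex_of_real (t * \<psi>2 (eig X n))) * zcoeff X b f n * complex_of_real (zonal X b n x)))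
    \<le> ennreal (\<Sum>k. cmod (g k))"
    unfolding sums_unique[OF g_sums] by (intro ennreal_leI summable_norm summ)
  also have "\<dots> = (\<Sum>k. ennreal (cmod (g k)))"
    by (rule suminf_ennreal2[symmetric, OF _ summ]) simp
  also have "\<dots> \<le> (\<Sum>k. ennreal ((2 * pi * D) ^ k / fact k) * maximal_fun X b \<psi>1 (comb N (\<lambda>n. \<rho> n ^ k * zcoeff X b f n)) x)"
  proof (intro suminf_le)
    fix k
    have "ennreal (cmod (g k)) \<le> ennreal ((2 * pi * D) ^ k / fact k)
        * ennreal (cmod (propagator X b \<psi>1 t (comb N (\<lambda>n. \<rho> n ^ k * zcoeff X b f n)) x))"
      using ennreal_leI[OF g_bound[of k]] D(1) by (subst ennreal_mult[symmetric]) auto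
    also have "\<dots> \<le> ennreal ((2 * pi * D) ^ k / fact k) * maximal_fun X b \<psi>1 (comb N (\<lambda>n. \<rho> n ^ k * zcoeff X b f n)) x"
      unfolding maximal_fun_def using t by (intro mult_left_mono SUP_upper) auto
    finally show "ennreal (cmod (g k)) \<le> ennreal ((2 * pi * D) ^ k / fact k) * maximal_fun X b \<psi>1 (comb N (\<lambda>n. \<rho> n ^ k * zcoeff X b f n)) x" .
  qed auto
  finally show ?thesis .
qed

theorem maximal_estimates_transfer:
  assumes D: "D > 0" "\<And>n. \<bar>\<psi>1 (eig X n) - \<psi>2 (eig X n)\<bar> \<le> D" and p: "p \<ge> 1"
    and est: "maximal_estimates X b \<psi>1 \<alpha>0 p"
  shows "maximal_estimates X b \<psi>2 \<alpha>0 p"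
  unfolding maximal_estimates_def
proof (intro allI impI)
  fix \<alpha> assume "\<alpha> > \<alpha>0"
  then obtain C where C: "C > 0" "\<And>f. smooth_fun X f \<Longrightarrow> radial X b f \<Longrightarrow>
      Lp_norm M p (maximal_fun X b \<psi>1 f) \<le> ennreal C * sobolev_norm X b \<alpha> f"
    using est unfolding maximal_estimates_def by blast
  define \<rho> where "\<rho> = (\<lambda>n. complex_of_real ((\<psi>2 (eig X n) - \<psi>1 (eig X n)) / D))"
  have \<rho>: "cmod (\<rho> n ^ k) \<le> 1" for n k
    using D(2)[of n] D(1) unfolding norm_power
    by (intro power_le_one) (auto simp: \<rho>_def norm_divide abs_minus_commute simp flip: of_real_diff)
  define w where "w k = (2 * pi * D) ^ k / fact k" for k :: nat
  define W where "W = exp (2 * pi * D)"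
  have w: "w k \<ge> 0" "w sums W" "W > 0" for k
    using D(1) exp_converges[of "2 * pi * D"] by (auto simp: w_def[abs_def] W_def divide_inverse mult.commute)
  have wsum: "(\<Sum>k. ennreal (w k)) = ennreal W"
    by (rule suminf_ennreal_sums[OF w(1,2)])
  show "\<exists>C'>0. \<forall>f. smooth_fun X f \<and> radial X b f \<longrightarrow>
      Lp_norm M p (maximal_fun X b \<psi>2 f) \<le> ennreal C' * sobolev_norm X b \<alpha> f"
  \<comment> \<open>W = exp (2 pi D) is the total weight of the exponential series; C is the
    constant for \<open>\<psi>1\<close> at the same \<open>\<alpha>\<close>.\<close>
  proof (intro exI[of _ "W * C"] conjI allI impI)
    show "W * C > 0" using w C by simp
    fix f assume "smooth_fun X f \<and> radial X b f"
    then have f: "smooth_fun X f" by simp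
    define Bd where "Bd = ennreal C * sobolev_norm X b \<alpha> f"
    define F where "F N k = maximal_fun X b \<psi>1 (comb N (\<lambda>n. \<rho> n ^ k * zcoeff X b f n))" for N k
    define Q where "Q N x = (\<Sum>k. ennreal (w k) * F N k x)" for N x
    have F_meas [measurable]: "F N k \<in> borel_measurable M" for N k
      unfolding F_def by (rule measurable_maximal_comb)
    have Q_meas: "Q N \<in> borel_measurable M" for N
      unfolding Q_def[abs_def] by measurable
    have F_le: "Lp_norm M p (F N k) \<le> Bd" for N k
    proof -
      have "Lp_norm M p (F N k) \<le> ennreal C * sobolev_norm X b \<alpha> (comb N (\<lambda>n. \<rho> n ^ k * zcoeff X b f n))"
        unfolding F_def by (intro C smooth_comb radial_comb)
      also have "\<dots> \<le> Bd"
        unfolding Bd_def by (intro mult_left_mono sobolev_comb_le \<rho>) auto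
      finally show ?thesis .
    qed
    \<comment> \<open>The phases have modulus 1, so absolute convergence at x serves all t at once:
      the exceptional null set is independent of t, and the supremum over t can be taken after the
      limit in N.\<close>
    have liminf: "AE x in M. maximal_fun X b \<psi>2 f x \<le> liminf (\<lambda>N. Q N x)"
    proof -
      have "AE x in M. summable (\<lambda>n. \<bar>cmod (zcoeff X b f n)\<bar> * \<bar>zeta n (l x)\<bar>)"
        by (rule AE_summable_zeta) (simp add: summable_zcoeff[OF f])
      then show ?thesis
      proof (rule AE_mp, intro AE_I2 impI)
        fix x assume x: "x \<in> space M" and s: "summable (\<lambda>n. \<bar>cmod (zcoeff X b f n)\<bar> * \<bar>zeta n (l x)\<bar>)"
        show "maximal_fun X b \<psi>2 f x \<le> liminf (\<lambda>N. Q N x)"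
          unfolding maximal_fun_def
        proof (rule SUP_least)
          fix t assume t: "t \<in> {0..<2 * pi}"
          define y where "y n = exp (- \<i> * complex_of_real (t * \<psi>2 (eig X n))) * zcoeff X b f n * complex_of_real (zonal X b n x)" for n
          have "summable (\<lambda>n. norm (y n))"
            using s x by (simp add: y_def norm_mult zonal_eq)
          then have "summable y" by (rule summable_norm_cancel)
          then have "(\<lambda>N. \<Sum>n<N. y n) \<longlonglongrightarrow> propagator X b \<psi>2 t f x"
            unfolding propagator_def y_def[symmetric] by (rule summable_LIMSEQ)
          then have "(\<lambda>N. ennreal (cmod (\<Sum>n<N. y n))) \<longlonglongrightarrow> ennreal (cmod (propagator X b \<psi>2 t f x))"
            by (intro tendsto_ennrealI tendsto_norm)
          then have "ennreal (cmod (propagator X b \<psi>2 t f x)) = liminf (\<lambda>N. ennreal (cmod (\<Sum>n<N. y n)))"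
            by (intro lim_imp_Liminf[symmetric]) auto
          also have "\<dots> \<le> liminf (\<lambda>N. Q N x)"
            unfolding Q_def F_def w_def y_def \<rho>_def
            by (intro Liminf_mono always_eventually allI truncated_maximal_le D t)
          finally show "ennreal (cmod (propagator X b \<psi>2 t f x)) \<le> liminf (\<lambda>N. Q N x)" .
        qed
      qed
    qed
    have goal: "Lp_norm M p (maximal_fun X b \<psi>2 f) \<le> ennreal W * Bd"
    proof (cases "p = \<top>")
      case True
      have "AE x in M. F N k x \<le> Bd" for N k
        using esssup_AE[where M = M and f = "F N k"] F_le[of N k] True
        by (auto simp: Lp_norm_def elim!: eventually_mono)
      \<comment> \<open>There are only countably many pairs N, k, hence one common null set.\<close>
      then have "AE x in M. \<forall>N k. F N k x \<le> Bd" by (simp add: AE_all_countable)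
      with liminf have "AE x in M. maximal_fun X b \<psi>2 f x \<le> ennreal W * Bd"
      proof eventually_elim
        case (elim x)
        have "Q N x \<le> ennreal W * Bd" for N
        proof -
          have "Q N x \<le> (\<Sum>k. ennreal (w k) * Bd)"
            unfolding Q_def using elim by (intro suminf_le mult_left_mono) auto
          then show ?thesis by (simp add: wsum)
        qed
        then have "liminf (\<lambda>N. Q N x) \<le> liminf (\<lambda>N::nat. ennreal W * Bd)"
          by (intro Liminf_mono always_eventually allI)
        with elim show ?case by (simp add: Liminf_const)
      qed
      then show ?thesis
        using True measurable_maximal[OF f] by (simp add: Lp_norm_def esssup_I)
    next
      case False
      define r where "r = enn2real p"
      have r: "r \<ge> 1"
        using p False unfolding r_def by (cases p) auto
      have F_int: "(\<integral>\<^sup>+x. ennreal_powr (F N k x) r \<partial>M) \<le> ennreal_powr Bd r" for N k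
        using F_le[of N k] False r by (simp add: Lp_norm_def r_def[symmetric] ennreal_powr_le_iff)
      have "(\<integral>\<^sup>+x. ennreal_powr (maximal_fun X b \<psi>2 f x) r \<partial>M)
          \<le> (\<integral>\<^sup>+x. ennreal_powr (liminf (\<lambda>N. Q N x)) r \<partial>M)"
        using r by (intro nn_integral_mono_AE eventually_mono[OF liminf] ennreal_powr_mono) auto
      also have "\<dots> = (\<integral>\<^sup>+x. liminf (\<lambda>N. ennreal_powr (Q N x) r) \<partial>M)"
        using r by (intro nn_integral_cong Liminf_compose_continuous_mono[symmetric] continuous_ennreal_powr)
          (auto intro!: monoI ennreal_powr_mono)
      also have "\<dots> \<le> liminf (\<lambda>N. \<integral>\<^sup>+x. ennreal_powr (Q N x) r \<partial>M)"
        using r by (intro nn_integral_liminf borel_measurable_ennreal_powr Q_meas) auto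
      also have "\<dots> \<le> liminf (\<lambda>N::nat. ennreal_powr (ennreal W) r * ennreal_powr Bd r)"
        unfolding Q_def
        by (intro Liminf_mono always_eventually allI nn_integral_powr_suminf_le F_meas r w F_int)
      also have "\<dots> = ennreal_powr (ennreal W * Bd) r"
        using r by (simp add: Liminf_const ennreal_powr_mult)
      finally show ?thesis
        using False r by (simp add: Lp_norm_def r_def[symmetric] ennreal_powr_le_iff)
    qed
    then show "Lp_norm M p (maximal_fun X b \<psi>2 f) \<le> ennreal (W * C) * sobolev_norm X b \<alpha> f"
      using w C by (simp add: Bd_def ennreal_mult mult.assoc)
  qed
qed

end

text \<open>Conjugating all flows by an isometry g moves the base point, so flows have to be
  constructed only at model points.\<close>

lemma (in zonal_flow) zonal_flow_conj:
  assumes g: "points_isometry (points X) g g'"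
    and geo: "\<And>x. x \<in> points X \<Longrightarrow> geo_dist X b' x = arccos (l (g' x))"
  shows "zonal_flow X b' J (\<lambda>j \<theta>. g \<circ> T j \<theta> \<circ> g') (\<lambda>j \<theta>. g \<circ> T' j \<theta> \<circ> g') (\<lambda>j. g \<circ> A j \<circ> g')
    (\<lambda>x. l (g' x)) (\<lambda>x. l0 (g' x)) c0 \<kappa> B"
proof -
  have g': "g' x \<in> points X" if "x \<in> points X" for x
    using g that by (auto simp: points_isometry_def)
  have lin: "linear g" "linear g'" and inv: "g' (g x) = x" "g (g' x) = x" and nrm: "norm (g x) = norm x" for x
    using g by (auto simp: points_isometry_def)
  have bl: "bounded_linear g" "bounded_linear g'"
    using lin by (simp_all add: linear_conv_bounded_linear)
  show ?thesis
  proof (rule zonal_flow.intro)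
    show "bounded_linear (\<lambda>x. l0 (g' x))" by (rule bounded_linear_compose[OF l0 bl(2)])
    show "points_isometry (points X) (g \<circ> T j \<theta> \<circ> g') (g \<circ> T' j \<theta> \<circ> g')" if "j \<in> J" for j \<theta>
      using points_isometry_comp[OF points_isometry_comp[OF g iso[OF that]] points_isometry_sym[OF g]]
      by (simp add: comp_assoc)
    show "linear (g \<circ> A j \<circ> g')" if "j \<in> J" for j
      by (intro linear_compose lin linear_A that)
    show "((\<lambda>\<theta>. (g \<circ> T j \<theta> \<circ> g') x) has_vector_derivative (g \<circ> A j \<circ> g') x) (at 0)"
      if "j \<in> J" "x \<in> points X" for j x
      using bounded_linear.has_vector_derivative[OF bl(1) T_deriv[OF that(1) g'[OF that(2)]]] by simp
    show "norm ((g \<circ> T j \<theta> \<circ> g') x - x) \<le> B * \<bar>\<theta>\<bar>" if "j \<in> J" "x \<in> points X" for j x \<theta>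
    proof -
      have "(g \<circ> T j \<theta> \<circ> g') x - x = g (T j \<theta> (g' x) - g' x)"
        using lin by (simp add: linear_diff inv)
      then show ?thesis using T_Lipschitz[OF that(1) g'[OF that(2)], of \<theta>] by (simp add: nrm)
    qed
  qed (use compact_points l_eq l_le geo finite_J \<kappa> T_0 gradient laplacian param g' inv in auto)
qed

section \<open>Rotations\<close>

text \<open>Rodrigues' formula for exp (\<open>\<theta>\<close> G), valid for generators with G^3 =
  - G.\<close>

definition rot :: "('v \<Rightarrow> 'v) \<Rightarrow> real \<Rightarrow> 'v \<Rightarrow> 'v::real_inner" where
  "rot G \<theta> x = x + (1 - cos \<theta>) *\<^sub>R G (G x) + sin \<theta> *\<^sub>R G x"

definition rot_generator :: "('v::real_inner \<Rightarrow> 'v) \<Rightarrow> bool" where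
  "rot_generator G \<longleftrightarrow> bounded_linear G \<and> (\<forall>x y. G x \<bullet> y = - (x \<bullet> G y)) \<and> (\<forall>x. G (G (G x)) = - G x)"

lemma rot_0 [simp]: "rot G 0 x = x"
  by (simp add: rot_def)

lemma rot_generatorD:
  assumes "rot_generator G"
  shows "bounded_linear G" "linear G" "G x \<bullet> y = - (x \<bullet> G y)" "G (G (G x)) = - G x"
  using assms bounded_linear.linear by (auto simp: rot_generator_def)

lemma linear_rot: "rot_generator G \<Longrightarrow> linear (rot G \<theta>)"
  using rot_generatorD(2)[of G]
  by (intro linearI) (simp_all add: rot_def linear_add linear_scale algebra_simps)

lemma rot_inverse:
  assumes G: "rot_generator G"
  shows "rot G (- \<theta>) (rot G \<theta> x) = x"
proof -
  note lin = rot_generatorD(2)[OF G] and G3 = rot_generatorD(4)[OF G]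
  have cs: "(cos \<theta> * cos \<theta>) *\<^sub>R v + (sin \<theta> * sin \<theta>) *\<^sub>R v = v" for v :: 'a
    by (simp add: power2_eq_square[symmetric] flip: scaleR_add_left)
  have "rot G (- \<theta>) (rot G \<theta> x) = x
      + ((1 - cos \<theta>) + (1 - cos \<theta>) - (1 - cos \<theta>) * (1 - cos \<theta>) - sin \<theta> * sin \<theta>) *\<^sub>R G (G x)"
    unfolding rot_def by (simp add: linear_add[OF lin] linear_diff[OF lin] linear_scale[OF lin] G3 algebra_simps linear_neg[OF lin] cs)
  also have "(1 - cos \<theta>) + (1 - cos \<theta>) - (1 - cos \<theta>) * (1 - cos \<theta>) - sin \<theta> * sin \<theta> = 0"
    using sin_cos_squared_add[of \<theta>] by (simp add: algebra_simps power2_eq_square)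
  finally show ?thesis by simp
qed

lemma norm_rot:
  assumes G: "rot_generator G"
  shows "norm (rot G \<theta> x) = norm x"
proof -
  note lin = rot_generatorD(2)[OF G] and G3 = rot_generatorD(4)[OF G] and sk = rot_generatorD(3)[OF G]
  have adj: "rot G \<theta> u \<bullet> v = u \<bullet> rot G (- \<theta>) v" for u v
    by (simp add: rot_def inner_add_left inner_add_right inner_diff_right sk)
  have "rot G \<theta> x \<bullet> rot G \<theta> x = x \<bullet> x"
    unfolding adj rot_inverse[OF G] ..
  then show ?thesis by (simp add: norm_eq_sqrt_inner)
qed

text \<open>Skewness and G^3 = - G give |x + G (G x)|^2 = |x|^2 - |G x|^2.\<close>

lemma norm_generator_le:
  assumes G: "rot_generator G"
  shows "norm (G x) \<le> norm x"
proof -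
  note sk = rot_generatorD(3)[OF G] and G3 = rot_generatorD(4)[OF G]
  have "0 \<le> (x + G (G x)) \<bullet> (x + G (G x))" by simp
  also have "\<dots> = x \<bullet> x - G x \<bullet> G x"
    using sk[of "G x" x] sk[of x "G x"] sk[of "G x" "G (G x)"]
    by (simp add: inner_add_left inner_add_right G3 sk inner_commute)
  finally show ?thesis by (simp add: norm_le)
qed

lemma abs_one_minus_cos_le: "\<bar>1 - cos \<theta>\<bar> \<le> \<bar>\<theta> :: real\<bar>"
proof -
  have "1 - cos \<theta> = 2 * (sin (\<theta> / 2))\<^sup>2" using cos_double_sin[of "\<theta> / 2"] by simp
  then have "\<bar>1 - cos \<theta>\<bar> = 2 * (\<bar>sin (\<theta> / 2)\<bar> * \<bar>sin (\<theta> / 2)\<bar>)"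
    by (simp add: power2_eq_square abs_mult)
  also have "\<dots> \<le> 2 * (1 * \<bar>\<theta> / 2\<bar>)"
    by (intro mult_left_mono mult_mono abs_sin_le_one abs_sin_x_le_abs_x) auto
  finally show ?thesis by simp
qed

lemma norm_rot_diff_le:
  assumes G: "rot_generator G"
  shows "norm (rot G \<theta> x - x) \<le> 2 * \<bar>\<theta>\<bar> * norm x"
proof -
  have "norm (rot G \<theta> x - x) \<le> \<bar>1 - cos \<theta>\<bar> * norm (G (G x)) + \<bar>sin \<theta>\<bar> * norm (G x)"
    unfolding rot_def using norm_triangle_ineq[of "(1 - cos \<theta>) *\<^sub>R G (G x)" "sin \<theta> *\<^sub>R G x"] by simp
  also have "\<dots> \<le> \<bar>\<theta>\<bar> * norm x + \<bar>\<theta>\<bar> * norm x"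
    by (intro add_mono mult_mono abs_one_minus_cos_le abs_sin_x_le_abs_x norm_generator_le[OF G]
        order_trans[OF norm_generator_le[OF G] norm_generator_le[OF G]]) auto
  finally show ?thesis by simp
qed

text \<open>The argument is allowed to move with \<open>\<theta>\<close> in order to differentiate a
  rotation of the rows composed with one of the columns.\<close>

lemma rot_has_vector_derivative:
  assumes G: "rot_generator G" and y: "(y has_vector_derivative y') (at 0)"
  shows "((\<lambda>\<theta>. rot G \<theta> (y \<theta>)) has_vector_derivative y' + G (y 0)) (at 0)"
proof -
  note bl = rot_generatorD(1)[OF G]
  have 1: "((\<lambda>\<theta>. G (y \<theta>)) has_vector_derivative G y') (at 0)"
    by (rule bounded_linear.has_vector_derivative[OF bl y])
  have 2: "((\<lambda>\<theta>. G (G (y \<theta>))) has_vector_derivative G (G y')) (at 0)"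
    by (rule bounded_linear.has_vector_derivative[OF bl 1])
  have c: "((\<lambda>\<theta>. 1 - cos \<theta>) has_real_derivative 0) (at 0)"
    by (auto intro!: derivative_eq_intros)
  have s: "(sin has_real_derivative 1) (at (0::real))"
    by (auto intro!: derivative_eq_intros)
  show ?thesis
    unfolding rot_def
    using has_vector_derivative_add[OF has_vector_derivative_add[OF y
          has_vector_derivative_scaleR[OF c 2]] has_vector_derivative_scaleR[OF s 1]] by simp
qed

text \<open>The infinitesimal rotation in the coordinate plane (i, j). The entries lie in an
  arbitrary inner product space, so it acts on vectors and, with rows as entries, on
  matrices.\<close>

definition coord_gen :: "'n \<Rightarrow> 'n \<Rightarrow> 'v::real_inner ^ 'n::finite \<Rightarrow> 'v ^ 'n" where
  "coord_gen i j x = (\<chi> k. if k = i then x $ j else if k = j then - x $ i else 0)"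

lemma coord_gen_nth [simp]:
  "coord_gen i j x $ k = (if k = i then x $ j else if k = j then - x $ i else 0)"
  by (simp add: coord_gen_def)

lemma linear_coord_gen: "linear (coord_gen i j)"
  by (intro linearI) (auto simp: vec_eq_iff)

lemma sum_UNIV_two:
  fixes f :: "'n::finite \<Rightarrow> 'a::comm_monoid_add"
  assumes "i \<noteq> j"
  shows "(\<Sum>k\<in>UNIV. f k) = f i + f j + (\<Sum>k\<in>UNIV - {i, j}. f k)"
proof -
  have "UNIV = insert i (insert j (UNIV - {i, j}))" by auto
  then have "(\<Sum>k\<in>UNIV. f k) = (\<Sum>k\<in>insert i (insert j (UNIV - {i, j})). f k)" by simp
  also have "\<dots> = f i + (f j + (\<Sum>k\<in>UNIV - {i, j}. f k))" using assms by simp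
  finally show ?thesis by (simp add: add.assoc)
qed

lemma rot_generator_coord_gen:
  assumes "i \<noteq> j"
  shows "rot_generator (coord_gen i j :: 'v::real_inner ^ 'n::finite \<Rightarrow> _)"
  unfolding rot_generator_def
proof (intro conjI allI)
  have nrm: "norm (coord_gen i j x) \<le> norm x" for x :: "'v ^ 'n"
  proof -
    have "(\<Sum>k\<in>UNIV. (norm (coord_gen i j x $ k))\<^sup>2) \<le> (\<Sum>k\<in>UNIV. (norm (x $ k))\<^sup>2)"
      unfolding sum_UNIV_two[OF assms] using assms
      by (simp add: sum_nonneg)
    then show ?thesis by (simp add: norm_vec_def L2_set_def)
  qed
  show "bounded_linear (coord_gen i j :: 'v ^ 'n \<Rightarrow> _)"
    using nrm by (intro bounded_linear_intro[where K = 1] linear_add linear_scale linear_coord_gen) auto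
  show "coord_gen i j x \<bullet> y = - (x \<bullet> coord_gen i j y)" for x y :: "'v ^ 'n"
    unfolding inner_vec_def sum_UNIV_two[OF assms] using assms by simp
  show "coord_gen i j (coord_gen i j (coord_gen i j x)) = - coord_gen i j x" for x :: "'v ^ 'n"
    using assms by (auto simp: vec_eq_iff)
qed

lemma rot_coord_gen_nth:
  assumes "i \<noteq> j"
  shows "rot (coord_gen i j) \<theta> x $ k = (if k = i then cos \<theta> *\<^sub>R x $ i + sin \<theta> *\<^sub>R x $ j
    else if k = j then cos \<theta> *\<^sub>R x $ j - sin \<theta> *\<^sub>R x $ i else x $ k)"
  using assms by (auto simp: rot_def algebra_simps)

section \<open>Spheres\<close>

text \<open>The rotation in the plane (k, j) moves x_k with velocity x_j, and twice differentiated
  it gives - x_k. Summed over j \<noteq> k this yields 1 - x_k^2 and - d x_k, the coefficients of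
  the Jacobi operator with \<open>\<kappa>\<close> = 1. The constant B = 2 is that of
  \<open>norm_rot_diff_le\<close> on unit vectors.\<close>

lemma sphere_zonal_flow:
  fixes k :: "'n::finite"
  assumes "CARD('n) \<ge> 2"
  shows "zonal_flow (sphere_space :: (real ^ 'n) symspace) (axis k 1) (UNIV - {k})
    (\<lambda>j. rot (coord_gen k j)) (\<lambda>j \<theta>. rot (coord_gen k j) (- \<theta>)) (\<lambda>j. coord_gen k j)
    (\<lambda>x. x $ k) (\<lambda>x. x $ k) 0 1 2"
proof -
  let ?X = "sphere_space :: (real ^ 'n) symspace"
  have pts: "points ?X = {x. norm x = 1}" by (simp add: sphere_space_def Let_def)
  have dim: "real (rdim ?X) = real CARD('n) - 1" using assms by (simp add: sphere_space_def Let_def)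
  have sig: "rsigma ?X = (real CARD('n) - 3) / 2" "rtau ?X = (real CARD('n) - 3) / 2"
    using dim by (simp_all add: rsigma_def sphere_space_def Let_def)
  show ?thesis
  proof (rule zonal_flow.intro)
    show "compact (points ?X)"
      using compact_sphere[of "0 :: real ^ 'n" 1] by (simp add: pts sphere_def)
    show "bounded_linear (\<lambda>x :: real ^ 'n. x $ k)" by (rule bounded_linear_vec_nth)
    show "\<bar>x $ k\<bar> \<le> 1" if "x \<in> points ?X" for x
      using that component_le_norm_cart[of x k] by (simp add: pts)
    show "geo_dist ?X (axis k 1) x = arccos (x $ k)" for x
      by (simp add: sphere_space_def Let_def inner_axis')
    show "points_isometry (points ?X) (rot (coord_gen k j) \<theta>) (rot (coord_gen k j) (- \<theta>))"
      if "j \<in> UNIV - {k}" for j \<theta>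
    proof -
      have G: "rot_generator (coord_gen k j :: real ^ 'n \<Rightarrow> _)"
        using that by (intro rot_generator_coord_gen) auto
      show ?thesis
        using rot_inverse[OF G, of \<theta>] rot_inverse[OF G, of "- \<theta>"]
        by (auto simp: points_isometry_def pts norm_rot[OF G] linear_rot[OF G])
    qed
    show "((\<lambda>\<theta>. rot (coord_gen k j) \<theta> x) has_vector_derivative coord_gen k j x) (at 0)"
      if "j \<in> UNIV - {k}" for j and x :: "real ^ 'n"
      using rot_has_vector_derivative[OF rot_generator_coord_gen, of k j "\<lambda>_. x" 0] that by simp
    show "norm (rot (coord_gen k j) \<theta> x - x) \<le> 2 * \<bar>\<theta>\<bar>" if "j \<in> UNIV - {k}" "x \<in> points ?X" for j \<theta> x
      using norm_rot_diff_le[OF rot_generator_coord_gen, of k j \<theta> x] that by (simp add: pts)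
    show "linear (coord_gen k j :: real ^ 'n \<Rightarrow> _)" for j by (rule linear_coord_gen)
    show "(\<Sum>j\<in>UNIV - {k}. (coord_gen k j x $ k)\<^sup>2) = 1 * (1 - (x $ k)\<^sup>2)" if "x \<in> points ?X" for x
    proof -
      have "(\<Sum>j\<in>UNIV. (x $ j)\<^sup>2) = 1"
        using that by (simp add: pts norm_vec_def L2_set_def)
      then show ?thesis by (simp add: sum.remove[of UNIV k])
    qed
    show "(\<Sum>j\<in>UNIV - {k}. coord_gen k j (coord_gen k j x) $ k)
        = 1 * (rtau ?X - rsigma ?X - (rsigma ?X + rtau ?X + 2) * x $ k)" for x
    proof -
      have "(\<Sum>j\<in>UNIV - {k}. coord_gen k j (coord_gen k j x) $ k) = (\<Sum>j\<in>UNIV - {k}. - x $ k)"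
        by (intro sum.cong) auto
      also have "\<dots> = - (real CARD('n) - 1) * x $ k"
        using assms by (simp add: card_Diff_singleton of_nat_diff algebra_simps)
      finally show ?thesis unfolding sig by (simp add: field_simps)
    qed
    show "rsigma ?X + rtau ?X + 1 \<ge> 0" using assms by (simp add: sig)
  qed auto
qed

section \<open>From flows at model points to transference\<close>

text \<open>Beyond R the assumption gives the bound; on the compact interval [0, R] continuity
  does.\<close>

lemma comparable_oscillation_bound:
  assumes "continuous_on {0..} \<psi>1" "continuous_on {0..} \<psi>2" "comparable_oscillation \<psi>1 \<psi>2"
  obtains D where "D > 0" "\<And>r. r \<ge> 0 \<Longrightarrow> \<bar>\<psi>1 r - \<psi>2 r\<bar> \<le> D"
proof -
  obtain R C where RC: "R > 0" "C > 0" "\<And>r. r > R \<Longrightarrow> \<bar>\<psi>1 r - \<psi>2 r\<bar> \<le> C"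
    using assms(3) unfolding comparable_oscillation_def by blast
  have "continuous_on {0..R} (\<lambda>r. \<psi>1 r - \<psi>2 r)"
    by (intro continuous_intros continuous_on_subset[OF assms(1)] continuous_on_subset[OF assms(2)]) auto
  then have "bounded ((\<lambda>r. \<psi>1 r - \<psi>2 r) ` {0..R})"
    by (intro compact_imp_bounded compact_continuous_image) auto
  then obtain K where K: "\<And>r. r \<in> {0..R} \<Longrightarrow> \<bar>\<psi>1 r - \<psi>2 r\<bar> \<le> K"
    unfolding bounded_iff ball_simps real_norm_def by blast
  have "\<bar>\<psi>1 r - \<psi>2 r\<bar> \<le> max C K" if "r \<ge> 0" for r
  proof (cases "r > R")
    case True
    then show ?thesis using RC(3)[of r] by simp
  next
    case False
    then show ?thesis using K[of r] that by simp
  qed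
  then show ?thesis using that[of "max C K"] RC(2) by simp
qed

text \<open>A whole family of model points, indexed by k, is allowed, because the reduction of a
  projection to a coordinate line may end at any index.\<close>

lemma mutually_transferrableI:
  assumes psi: "continuous_on {0..} \<psi>1" "continuous_on {0..} \<psi>2" "comparable_oscillation \<psi>1 \<psi>2"
    and flow: "\<And>k. zonal_flow X (b0 k) (J k) (T k) (T' k) (A k) (l k) (l0 k) c0 \<kappa> B"
    and transitive: "\<And>b. b \<in> points X \<Longrightarrow>
      \<exists>k g g'. points_isometry (points X) g g' \<and> (\<forall>x\<in>points X. geo_dist X b x = arccos (l k (g' x)))"
  shows "mutually_transferrable X \<psi>1 \<psi>2"
proof -
  obtain D where D: "D > 0" "\<And>r. r \<ge> 0 \<Longrightarrow> \<bar>\<psi>1 r - \<psi>2 r\<bar> \<le> D"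
    by (rule comparable_oscillation_bound[OF psi]) blast
  show ?thesis
    unfolding mutually_transferrable_def
  proof
    fix b assume "b \<in> points X"
    then obtain k g g' where g: "points_isometry (points X) g g'"
      "\<And>x. x \<in> points X \<Longrightarrow> geo_dist X b x = arccos (l k (g' x))"
      using transitive by blast
    interpret zonal_flow X b "J k" "\<lambda>j \<theta>. g \<circ> T k j \<theta> \<circ> g'" "\<lambda>j \<theta>. g \<circ> T' k j \<theta> \<circ> g'"
      "\<lambda>j. g \<circ> A k j \<circ> g'" "\<lambda>x. l k (g' x)" "\<lambda>x. l0 k (g' x)" c0 \<kappa> B
      by (rule zonal_flow.zonal_flow_conj[OF flow g])
    have eig: "eig X n \<ge> 0" for n
      using lam_nonneg[of n] by (simp add: eig_def lam_def)
    have D12: "\<bar>\<psi>1 (eig X n) - \<psi>2 (eig X n)\<bar> \<le> D" and D21: "\<bar>\<psi>2 (eig X n) - \<psi>1 (eig X n)\<bar> \<le> D" for n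
      using D(2)[OF eig[of n]] by (simp_all add: abs_minus_commute)
    show "transferrable X b \<psi>1 \<psi>2 \<and> transferrable X b \<psi>2 \<psi>1"
      unfolding transferrable_def
      using maximal_estimates_transfer[of D \<psi>1 \<psi>2] maximal_estimates_transfer[of D \<psi>2 \<psi>1] D(1) D12 D21
      by blast
  qed
qed

lemma sphere_mutually_transferrable:
  assumes "continuous_on {0..} \<psi>1" "continuous_on {0..} \<psi>2" "comparable_oscillation \<psi>1 \<psi>2"
    and "CARD('n::finite) \<ge> 2"
  shows "mutually_transferrable (sphere_space :: (real ^ 'n) symspace) \<psi>1 \<psi>2"
proof (rule mutually_transferrableI[OF assms(1-3) sphere_zonal_flow[OF assms(4)]])
  let ?X = "sphere_space :: (real ^ 'n) symspace" and ?k = "undefined :: 'n"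
  fix b assume b: "b \<in> points ?X"
  then have nrm: "norm (axis ?k 1 :: real ^ 'n) = norm b" by (simp add: sphere_space_def Let_def)
  obtain f where f: "orthogonal_transformation f" "f (axis ?k 1 :: real ^ 'n) = b"
    by (rule orthogonal_transformation_exists[OF nrm])
  have f': "orthogonal_transformation (inv f)" by (rule orthogonal_transformation_inv[OF f(1)])
  have bij: "inv f (f x) = x" "f (inv f x) = x" for x
    using orthogonal_transformation_bij[OF f(1)] by (simp_all add: bij_is_inj bij_is_surj surj_f_inv_f)
  have "points_isometry (points ?X) f (inv f)"
    using f f' by (auto simp: points_isometry_def orthogonal_transformation bij sphere_space_def Let_def)
  moreover have "geo_dist ?X b x = arccos (inv f x $ ?k)" for x
  proof -
    have "b \<bullet> x = f (axis ?k 1) \<bullet> f (inv f x)" by (simp add: f bij)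
    also have "\<dots> = inv f x $ ?k" using f(1) by (simp add: orthogonal_transformation_def inner_axis')
    finally show ?thesis by (simp add: sphere_space_def Let_def)
  qed
  ultimately show "\<exists>k g g'. points_isometry (points ?X) g g' \<and> (\<forall>x\<in>points ?X. geo_dist ?X b x = arccos (g' x $ k))"
    by (intro exI[of _ ?k] exI[of _ f] exI[of _ "inv f"]) simp
qed

section \<open>Projective spaces\<close>

text \<open>A unital algebra with conjugation in which x + c x and x (c x) are real multiples of the
  unit. Associativity is a separate assumption, so that the octonions are included.\<close>

locale conj_algebra =
  fixes m :: "'f::euclidean_space \<Rightarrow> 'f \<Rightarrow> 'f" and c :: "'f \<Rightarrow> 'f" and e :: 'f
  assumes bilinear_m: "bilinear m" and linear_c: "linear c"
    and m_e: "m e x = x" "m x e = x"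
    and c_c: "c (c x) = x" and c_m: "c (m x y) = m (c y) (c x)"
    and norm_e: "norm e = 1" and norm_c: "norm (c x) = norm x"
    and m_cnj: "m x (c x) = (norm x)\<^sup>2 *\<^sub>R e"
    and add_cnj: "x + c x = (2 * (x \<bullet> e)) *\<^sub>R e"
begin

abbreviation proj :: "('f ^ 'n::finite ^ 'n) set" where "proj \<equiv> rank_one_projections m c e"

lemma m_simps:
  "m (x + y) z = m x z + m y z" "m x (y + z) = m x y + m x z"
  "m (x - y) z = m x z - m y z" "m x (y - z) = m x y - m x z"
  "m (r *\<^sub>R x) y = r *\<^sub>R m x y" "m x (r *\<^sub>R y) = r *\<^sub>R m x y"
  using bilinear_m by (auto simp: bilinear_ladd bilinear_radd bilinear_lsub bilinear_rsub bilinear_lmul bilinear_rmul)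

lemma c_simps: "c (x + y) = c x + c y" "c (x - y) = c x - c y" "c (r *\<^sub>R x) = r *\<^sub>R c x" "c 0 = 0"
  using linear_c by (auto simp: linear_add linear_diff linear_scale linear_0)

lemma P_iff: "p \<in> proj \<longleftrightarrow> (\<forall>i j. p $ j $ i = c (p $ i $ j)) \<and>
    (\<forall>i j. (\<Sum>k\<in>UNIV. m (p $ i $ k) (p $ k $ j)) = p $ i $ j) \<and> (\<Sum>i\<in>UNIV. p $ i $ i) = e"
  by (simp add: rank_one_projections_def)

lemma P_hermitian: "p \<in> proj \<Longrightarrow> c (p $ i $ j) = p $ j $ i"
  and P_idempotent: "p \<in> proj \<Longrightarrow> (\<Sum>k\<in>UNIV. m (p $ i $ k) (p $ k $ j)) = p $ i $ j"
  and P_trace: "p \<in> proj \<Longrightarrow> (\<Sum>i\<in>UNIV. p $ i $ i) = e"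
  unfolding P_iff by (blast intro: sym)+

lemma P_norm_sym: "p \<in> proj \<Longrightarrow> norm (p $ i $ j) = norm (p $ j $ i)"
  by (metis P_hermitian norm_c)

definition dg :: "'f ^ 'n::finite ^ 'n \<Rightarrow> 'n \<Rightarrow> real" where
  "dg p i = p $ i $ i \<bullet> e"

lemma inner_e [simp]: "e \<bullet> e = 1"
  using norm_e by (simp add: norm_eq_1)

text \<open>By hermitian symmetry the idempotent equation on the diagonal becomes a sum of products
  x (c x), that is, of squared norms.\<close>

lemma P_diag:
  fixes p :: "'f ^ 'n::finite ^ 'n"
  assumes "p \<in> proj"
  shows "p $ i $ i = dg p i *\<^sub>R e" and "dg p i = (\<Sum>k\<in>UNIV. (norm (p $ i $ k))\<^sup>2)"
proof -
  have "p $ i $ i = (\<Sum>k\<in>UNIV. m (p $ i $ k) (c (p $ i $ k)))"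
    by (simp only: P_hermitian[OF assms] P_idempotent[OF assms])
  then have eq: "p $ i $ i = (\<Sum>k\<in>UNIV. (norm (p $ i $ k))\<^sup>2) *\<^sub>R e"
    by (simp add: m_cnj scaleR_left.sum)
  then show "dg p i = (\<Sum>k\<in>UNIV. (norm (p $ i $ k))\<^sup>2)" by (simp add: dg_def)
  with eq show "p $ i $ i = dg p i *\<^sub>R e" by simp
qed

lemma dg_nonneg: "p \<in> proj \<Longrightarrow> dg p i \<ge> 0"
  by (simp add: P_diag(2) sum_nonneg)

lemma c_e: "c e = e"
  using m_e(1)[of "c e"] c_m[of "c e" "c e"] by (simp add: c_c) (metis c_c c_m m_e)

text \<open>Polarisation of \<open>m_cnj\<close>: the two mixed products are conjugate to each other
  and hence have the same real part.\<close>

lemma inner_m_cnj: "m x (c y) \<bullet> e = x \<bullet> y"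
proof -
  have "(m (x + y) (c (x + y)) - m x (c x) - m y (c y)) \<bullet> e = 2 * (x \<bullet> y)"
    unfolding m_cnj
    by (simp add: inner_diff_left power2_norm_eq_inner inner_add_left inner_add_right inner_commute[of y x])
  then have 1: "m x (c y) \<bullet> e + m y (c x) \<bullet> e = 2 * (x \<bullet> y)"
    by (simp add: m_simps c_simps inner_add_left)
  have "c z \<bullet> e = z \<bullet> e" for z
  proof -
    have "z \<bullet> e + c z \<bullet> e = 2 * (z \<bullet> e)"
      unfolding inner_add_left[symmetric] add_cnj by simp
    then show ?thesis by simp
  qed
  from this[of "m x (c y)"] have "m y (c x) \<bullet> e = m x (c y) \<bullet> e" by (simp add: c_m c_c)
  with 1 show ?thesis by simp
qed

end

text \<open>
  The twist \<open>tw i j u\<close> is an isometry of the projective space that turns the \<open>u\<close>-component of the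
  \<open>(i, j)\<close> entry into its real part. Conjugating a real rotation in the plane \<open>(i, j)\<close> with the
  twists yields one flow for each element of \<open>Basis\<close>; no other isometries are needed.
\<close>

locale twisted_projective = conj_algebra m c e
  for m :: "'f::euclidean_space \<Rightarrow> 'f \<Rightarrow> 'f" and c e +
  fixes t :: real and tw tw' :: "'n::finite \<Rightarrow> 'n \<Rightarrow> 'f \<Rightarrow> 'f ^ 'n ^ 'n \<Rightarrow> 'f ^ 'n ^ 'n"
  assumes norm_m: "norm (m x y) = norm x * norm y"
    and twist_iso: "\<And>i j u. i \<noteq> j \<Longrightarrow> u \<in> Basis \<Longrightarrow>
      points_isometry (rank_one_projections m c e) (tw i j u) (tw' i j u)"
    and twist_fix: "\<And>i j u x. i \<noteq> j \<Longrightarrow> u \<in> Basis \<Longrightarrow> tw' i j u x $ i $ i = x $ i $ i"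
    and twist_diag: "\<And>i j u p k. i \<noteq> j \<Longrightarrow> u \<in> Basis \<Longrightarrow> p \<in> rank_one_projections m c e \<Longrightarrow>
      tw i j u p $ k $ k = p $ k $ k"
    and twist_entry: "\<And>i j u x. i \<noteq> j \<Longrightarrow> u \<in> Basis \<Longrightarrow> tw i j u x $ i $ j \<bullet> e = x $ i $ j \<bullet> u"
    and twist_shift: "\<And>i j u x y r. i \<noteq> j \<Longrightarrow> u \<in> Basis \<Longrightarrow> x $ i $ j = y $ i $ j + r *\<^sub>R e \<Longrightarrow>
      tw' i j u x $ i $ j = tw' i j u y $ i $ j + r *\<^sub>R u"
    and card: "CARD('n) \<ge> 2" and t: "2 * t + 2 = real DIM('f)"
begin

abbreviation P :: "('f ^ 'n ^ 'n) set" where "P \<equiv> rank_one_projections m c e"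

lemma sum_dg:
  assumes "p \<in> P"
  shows "(\<Sum>i\<in>UNIV. dg p i) = 1"
proof -
  have "(\<Sum>i\<in>UNIV. dg p i) = (\<Sum>i\<in>UNIV. p $ i $ i) \<bullet> e"
    by (simp add: dg_def inner_sum_left)
  then show ?thesis by (simp add: P_trace[OF assms])
qed

lemma dg_le_1: "p \<in> P \<Longrightarrow> dg p i \<le> 1"
  using sum_dg[of p] member_le_sum[of i UNIV "dg p"] dg_nonneg[of p] by simp

text \<open>Cauchy--Schwarz gives \<open>\<le>\<close>, and the sums over all \<open>i, j\<close> of both sides are 1.\<close>

lemma norm_entry_square:
  assumes p: "p \<in> P"
  shows "(norm (p $ i $ j))\<^sup>2 = dg p i * dg p j"
proof -
  have le: "(norm (p $ i $ j))\<^sup>2 \<le> dg p i * dg p j" for i j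
  proof -
    have "norm (p $ i $ j) \<le> (\<Sum>k\<in>UNIV. norm (m (p $ i $ k) (p $ k $ j)))"
      unfolding P_idempotent[OF p, of i j, symmetric] by (rule norm_sum)
    also have "\<dots> \<le> (\<Sum>k\<in>UNIV. norm (p $ i $ k) * norm (p $ j $ k))"
      by (intro sum_mono) (simp add: norm_m P_norm_sym[OF p, of _ j])
    finally have "(norm (p $ i $ j))\<^sup>2 \<le> (\<Sum>k\<in>UNIV. norm (p $ i $ k) * norm (p $ j $ k))\<^sup>2"
      by (intro power_mono) auto
    also have "\<dots> \<le> dg p i * dg p j"
      unfolding P_diag(2)[OF p] by (rule Cauchy_Schwarz_ineq_sum)
    finally show ?thesis .
  qed
  let ?D = "\<lambda>i j. dg p i * dg p j - (norm (p $ i $ j))\<^sup>2"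
  have "(\<Sum>i\<in>UNIV. \<Sum>j\<in>UNIV. ?D i j) = 0"
    by (simp add: sum_subtractf P_diag(2)[OF p, symmetric] sum_dg[OF p] flip: sum_distrib_left)
  then have "\<forall>i\<in>UNIV. (\<Sum>j\<in>UNIV. ?D i j) = 0"
    using le by (subst (asm) sum_nonneg_eq_0_iff) (auto intro!: sum_nonneg)
  then have "\<forall>j\<in>UNIV. ?D i j = 0"
    using le by (subst sum_nonneg_eq_0_iff[symmetric]) auto
  then show ?thesis by simp
qed

lemma norm_P: "p \<in> P \<Longrightarrow> norm p = 1"
proof -
  assume p: "p \<in> P"
  have "(norm p)\<^sup>2 = (\<Sum>i\<in>UNIV. (norm (p $ i))\<^sup>2)"
    by (simp add: norm_vec_def L2_set_def sum_nonneg)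
  also have "\<dots> = (\<Sum>i\<in>UNIV. dg p i)"
    by (simp add: P_diag(2)[OF p] norm_vec_def[where x = "_ :: 'f ^ 'n"] L2_set_def sum_nonneg)
  finally have "(norm p)\<^sup>2 = 1\<^sup>2" by (simp add: sum_dg[OF p])
  then show ?thesis by (simp only: power2_eq_iff_nonneg norm_ge_zero zero_le_one)
qed

lemma compact_P: "compact P"
proof -
  have bb: "bounded_bilinear m" using bilinear_m by (simp add: bilinear_conv_bounded_bilinear)
  have blc: "bounded_linear c" using linear_c by (simp add: linear_conv_bounded_linear)
  have "P = (\<Inter>i j. {p. p $ j $ i = c (p $ i $ j)}) \<inter>
      (\<Inter>i j. {p. (\<Sum>k\<in>UNIV. m (p $ i $ k) (p $ k $ j)) = p $ i $ j}) \<inter> {p. (\<Sum>i\<in>UNIV. p $ i $ i) = e}"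
    unfolding rank_one_projections_def by blast
  moreover have "closed \<dots>"
    by (intro closed_Int closed_INT ballI closed_Collect_eq continuous_intros
        bounded_bilinear.continuous_on[OF bb] bounded_linear.continuous_on[OF blc])
  ultimately have "closed P" by simp
  moreover have "bounded P" unfolding bounded_iff using norm_P by (intro exI[of _ 1]) auto
  ultimately show ?thesis by (simp add: compact_eq_bounded_closed)
qed

section \<open>Conjugation of projections by real plane rotations\<close>

definition rot_rows :: "'n \<Rightarrow> 'n \<Rightarrow> real \<Rightarrow> 'f ^ 'n ^ 'n \<Rightarrow> 'f ^ 'n ^ 'n" where
  "rot_rows i j \<theta> p = (\<chi> a. rot (coord_gen i j) \<theta> (p $ a))"

text \<open>The matrix product of R, p and the transpose of R, for the rotation R in the plane (i,
  j). The entries of R are real, so they commute and associate with all coefficients.\<close>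

definition rot_conj :: "'n \<Rightarrow> 'n \<Rightarrow> real \<Rightarrow> 'f ^ 'n ^ 'n \<Rightarrow> 'f ^ 'n ^ 'n" where
  "rot_conj i j \<theta> p = rot (coord_gen i j) \<theta> (rot_rows i j \<theta> p)"

definition row_gen :: "'n \<Rightarrow> 'n \<Rightarrow> 'f ^ 'n ^ 'n \<Rightarrow> 'f ^ 'n ^ 'n" where
  "row_gen i j p = (\<chi> a. coord_gen i j (p $ a))"

lemma rot_rows_eq: "rot_rows i j \<theta> = rot (row_gen i j) \<theta>"
  by (auto simp: rot_rows_def rot_def row_gen_def vec_eq_iff fun_eq_iff)

lemma rot_generator_row_gen:
  assumes "i \<noteq> j"
  shows "rot_generator (row_gen i j)"
proof -
  have G: "rot_generator (coord_gen i j :: 'f ^ 'n \<Rightarrow> _)" by (rule rot_generator_coord_gen[OF assms])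
  have lin: "linear (row_gen i j)"
    by (intro linearI) (auto simp: row_gen_def vec_eq_iff)
  have "norm (row_gen i j x) \<le> norm x" for x
  proof -
    have "(\<Sum>a\<in>UNIV. (norm (row_gen i j x $ a))\<^sup>2) \<le> (\<Sum>a\<in>UNIV. (norm (x $ a))\<^sup>2)"
      using norm_generator_le[OF G] by (intro sum_mono power_mono) (auto simp: row_gen_def)
    then show ?thesis by (simp add: norm_vec_def[where x = "_ :: 'f ^ 'n ^ 'n"] L2_set_def)
  qed
  then have "bounded_linear (row_gen i j)"
    by (intro bounded_linear_intro[where K = 1] linear_add linear_scale lin) auto
  moreover have "row_gen i j x \<bullet> y = - (x \<bullet> row_gen i j y)" for x y
    unfolding inner_vec_def[where x = "_ :: 'f ^ 'n ^ 'n"] row_gen_def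
    by (simp only: vec_lambda_beta rot_generatorD(3)[OF G] sum_negf)
  moreover have "row_gen i j (row_gen i j (row_gen i j x)) = - row_gen i j x" for x
    using rot_generatorD(4)[OF G] unfolding vec_eq_iff[where x = "_ :: 'f ^ 'n ^ 'n"]
    by (simp add: row_gen_def del: coord_gen_nth)
  ultimately show ?thesis unfolding rot_generator_def by blast
qed

text \<open>The same rotation on an arbitrary indexed family, so that it can be applied to either
  index of a matrix; the two formulas of \<open>rot_conj_nth\<close> differ in which index is
  rotated first.\<close>

definition rotv :: "'n \<Rightarrow> 'n \<Rightarrow> real \<Rightarrow> ('n \<Rightarrow> 'f) \<Rightarrow> 'n \<Rightarrow> 'f" where
  "rotv i j \<theta> f k = (if k = i then cos \<theta> *\<^sub>R f i + sin \<theta> *\<^sub>R f j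
    else if k = j then cos \<theta> *\<^sub>R f j - sin \<theta> *\<^sub>R f i else f k)"

lemma rot_conj_nth:
  assumes "i \<noteq> j"
  shows "rot_conj i j \<theta> p $ a $ b = rotv i j \<theta> (\<lambda>k. rotv i j \<theta> (\<lambda>l. p $ k $ l) b) a"
    and "rot_conj i j \<theta> p $ a $ b = rotv i j \<theta> (\<lambda>l. rotv i j \<theta> (\<lambda>k. p $ k $ l) a) b"
  unfolding rot_conj_def rot_rows_def rotv_def
  using assms by (auto simp: rot_coord_gen_nth[OF assms] algebra_simps)

lemma sum_rot_bilinear:
  fixes f g :: "'n \<Rightarrow> 'f"
  assumes "i \<noteq> j"
  shows "(\<Sum>k\<in>UNIV. m (rotv i j \<theta> f k) (rotv i j \<theta> g k)) = (\<Sum>k\<in>UNIV. m (f k) (g k))"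
proof -
  have cs: "(cos \<theta> * cos \<theta>) *\<^sub>R v + (sin \<theta> * sin \<theta>) *\<^sub>R v = v" for v :: 'f
    by (simp add: power2_eq_square[symmetric] flip: scaleR_add_left)
  have "m (rotv i j \<theta> f i) (rotv i j \<theta> g i) + m (rotv i j \<theta> f j) (rotv i j \<theta> g j)
      = ((cos \<theta> * cos \<theta>) *\<^sub>R m (f i) (g i) + (sin \<theta> * sin \<theta>) *\<^sub>R m (f i) (g i))
      + ((cos \<theta> * cos \<theta>) *\<^sub>R m (f j) (g j) + (sin \<theta> * sin \<theta>) *\<^sub>R m (f j) (g j))"
    using assms by (simp add: rotv_def m_simps scaleR_add_right scaleR_diff_right algebra_simps)
  also have "\<dots> = m (f i) (g i) + m (f j) (g j)" by (simp only: cs)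
  finally have "m (rotv i j \<theta> f i) (rotv i j \<theta> g i) + m (rotv i j \<theta> f j) (rotv i j \<theta> g j) = m (f i) (g i) + m (f j) (g j)" .
  moreover have "(\<Sum>k\<in>UNIV - {i, j}. m (rotv i j \<theta> f k) (rotv i j \<theta> g k)) = (\<Sum>k\<in>UNIV - {i, j}. m (f k) (g k))"
    by (intro sum.cong) (auto simp: rotv_def)
  ultimately show ?thesis unfolding sum_UNIV_two[OF assms] by simp
qed

text \<open>In the square of the conjugated matrix the two inner rotations cancel by
  \<open>sum_rot_bilinear\<close>; the outer ones act linearly, each on one factor, and leave the
  product.\<close>

lemma rot_conj_P:
  assumes ij: "i \<noteq> j" and p: "p \<in> P"
  shows "rot_conj i j \<theta> p \<in> P"
proof -
  note nth = rot_conj_nth[OF ij]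
  have R_sum: "rotv i j \<theta> (\<lambda>k. \<Sum>l\<in>I. h l k) a = (\<Sum>l\<in>I. rotv i j \<theta> (h l) a)" for I :: "'n set" and h a
    by (auto simp: rotv_def scaleR_sum_right sum.distrib sum_subtractf)
  have R_c: "c (rotv i j \<theta> f a) = rotv i j \<theta> (\<lambda>k. c (f k)) a" for f a
    by (simp add: rotv_def c_simps)
  have R_ml: "rotv i j \<theta> (\<lambda>k. m (f k) z) a = m (rotv i j \<theta> f a) z" and R_mr: "rotv i j \<theta> (\<lambda>k. m z (f k)) a = m z (rotv i j \<theta> f a)" for f a z
    by (simp_all add: rotv_def m_simps)
  have herm: "rot_conj i j \<theta> p $ b $ a = c (rot_conj i j \<theta> p $ a $ b)" for a b
    unfolding nth(2)[of \<theta> p b a] nth(1)[of \<theta> p a b] R_c P_hermitian[OF p] ..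
  have idem: "(\<Sum>k\<in>UNIV. m (rot_conj i j \<theta> p $ a $ k) (rot_conj i j \<theta> p $ k $ b)) = rot_conj i j \<theta> p $ a $ b" for a b
  proof -
    have "(\<Sum>k\<in>UNIV. m (rot_conj i j \<theta> p $ a $ k) (rot_conj i j \<theta> p $ k $ b))
      = (\<Sum>k\<in>UNIV. m (rotv i j \<theta> (\<lambda>l. rotv i j \<theta> (\<lambda>k. p $ k $ l) a) k) (rotv i j \<theta> (\<lambda>k. rotv i j \<theta> (\<lambda>l. p $ k $ l) b) k))"
      unfolding nth(2)[of \<theta> p a] nth(1)[of \<theta> p _ b] ..
    also have "\<dots> = (\<Sum>k\<in>UNIV. m (rotv i j \<theta> (\<lambda>r. p $ r $ k) a) (rotv i j \<theta> (\<lambda>l. p $ k $ l) b))"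
      by (rule sum_rot_bilinear[OF ij])
    also have "\<dots> = rotv i j \<theta> (\<lambda>r. rotv i j \<theta> (\<lambda>l. \<Sum>k\<in>UNIV. m (p $ r $ k) (p $ k $ l)) b) a"
      by (simp only: R_sum R_ml R_mr)
    also have "\<dots> = rot_conj i j \<theta> p $ a $ b"
      by (simp only: nth(1)[of \<theta> p a b] P_idempotent[OF p])
    finally show ?thesis .
  qed
  have "(\<Sum>a\<in>UNIV. rot_conj i j \<theta> p $ a $ a) = (\<Sum>a\<in>UNIV. p $ a $ a)"
  proof -
    have cs: "(cos \<theta> * cos \<theta>) *\<^sub>R v + (sin \<theta> * sin \<theta>) *\<^sub>R v = v" for v :: 'f
      by (simp add: power2_eq_square[symmetric] flip: scaleR_add_left)
    have "rot_conj i j \<theta> p $ i $ i + rot_conj i j \<theta> p $ j $ j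
      = ((cos \<theta> * cos \<theta>) *\<^sub>R p $ i $ i + (sin \<theta> * sin \<theta>) *\<^sub>R p $ i $ i)
      + ((cos \<theta> * cos \<theta>) *\<^sub>R p $ j $ j + (sin \<theta> * sin \<theta>) *\<^sub>R p $ j $ j)"
      unfolding nth(1) rotv_def using ij by (simp add: algebra_simps)
    moreover have "(\<Sum>a\<in>UNIV - {i, j}. rot_conj i j \<theta> p $ a $ a) = (\<Sum>a\<in>UNIV - {i, j}. p $ a $ a)"
      by (intro sum.cong) (auto simp: nth(1) rotv_def)
    ultimately show ?thesis unfolding sum_UNIV_two[OF ij] cs by (simp only:)
  qed
  then have "(\<Sum>a\<in>UNIV. rot_conj i j \<theta> p $ a $ a) = e" by (simp only: P_trace[OF p])
  then show ?thesis using herm idem unfolding P_iff by blast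
qed

lemma rot_conj_inverse:
  assumes "i \<noteq> j"
  shows "rot_conj i j (- \<theta>) (rot_conj i j \<theta> x) = x"
proof -
  have comm: "rot_rows i j \<phi> (rot (coord_gen i j) \<theta> y) = rot (coord_gen i j) \<theta> (rot_rows i j \<phi> y)" for \<phi> \<theta> y
    unfolding vec_eq_iff by (auto simp: rot_rows_def rot_coord_gen_nth[OF assms] algebra_simps)
  show ?thesis
    unfolding rot_conj_def comm
    unfolding rot_rows_eq by (simp add: rot_inverse rot_generator_coord_gen rot_generator_row_gen assms)
qed

lemma rot_conj_iso:
  assumes "i \<noteq> j"
  shows "points_isometry P (rot_conj i j \<theta>) (rot_conj i j (- \<theta>))"
proof -
  have "linear (rot_conj i j \<theta>)" for \<theta>
    unfolding rot_conj_def[abs_def] rot_rows_eq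
    using linear_compose[OF linear_rot[OF rot_generator_row_gen[OF assms]] linear_rot[OF rot_generator_coord_gen[OF assms]]]
    by (simp add: comp_def)
  moreover have "norm (rot_conj i j \<theta> x) = norm x" for x
    by (simp add: rot_conj_def rot_rows_eq norm_rot rot_generator_coord_gen rot_generator_row_gen assms)
  ultimately show ?thesis
    using rot_conj_P[OF assms] rot_conj_inverse[OF assms, of \<theta>] rot_conj_inverse[OF assms, of "- \<theta>"]
    by (auto simp: points_isometry_def)
qed

end

section \<open>Flows on a projective space\<close>

context twisted_projective
begin

lemma norm_rot_conj_diff_le:
  assumes "i \<noteq> j"
  shows "norm (rot_conj i j \<theta> x - x) \<le> 4 * \<bar>\<theta>\<bar> * norm x"
proof -
  have "norm (rot_conj i j \<theta> x - x) \<le> norm (rot_conj i j \<theta> x - rot_rows i j \<theta> x) + norm (rot_rows i j \<theta> x - x)"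
    using norm_triangle_ineq[of "rot_conj i j \<theta> x - rot_rows i j \<theta> x" "rot_rows i j \<theta> x - x"] by simp
  also have "norm (rot_conj i j \<theta> x - rot_rows i j \<theta> x) \<le> 2 * \<bar>\<theta>\<bar> * norm (rot_rows i j \<theta> x)"
    unfolding rot_conj_def by (rule norm_rot_diff_le[OF rot_generator_coord_gen[OF assms]])
  also have "norm (rot_rows i j \<theta> x) = norm x"
    unfolding rot_rows_eq by (rule norm_rot[OF rot_generator_row_gen[OF assms]])
  also have "norm (rot_rows i j \<theta> x - x) \<le> 2 * \<bar>\<theta>\<bar> * norm x"
    unfolding rot_rows_eq by (rule norm_rot_diff_le[OF rot_generator_row_gen[OF assms]])
  finally show ?thesis by simp
qed

definition conj_gen :: "'n \<Rightarrow> 'n \<Rightarrow> 'f ^ 'n ^ 'n \<Rightarrow> 'f ^ 'n ^ 'n" where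
  "conj_gen i j p = row_gen i j p + coord_gen i j p"

lemma linear_conj_gen: "i \<noteq> j \<Longrightarrow> linear (conj_gen i j)"
  unfolding conj_gen_def[abs_def]
  by (intro linear_compose_add rot_generatorD(2) rot_generator_row_gen rot_generator_coord_gen)

lemma rot_conj_has_vector_derivative:
  assumes "i \<noteq> j"
  shows "((\<lambda>\<theta>. rot_conj i j \<theta> x) has_vector_derivative conj_gen i j x) (at 0)"
proof -
  have "((\<lambda>\<theta>. rot_rows i j \<theta> x) has_vector_derivative row_gen i j x) (at 0)"
    unfolding rot_rows_eq
    using rot_has_vector_derivative[OF rot_generator_row_gen[OF assms], of "\<lambda>_. x" 0] by simp
  from rot_has_vector_derivative[OF rot_generator_coord_gen[OF assms] this] show ?thesis
    unfolding rot_conj_def conj_gen_def by (simp add: rot_rows_eq)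
qed

lemma conj_gen_nth:
  assumes "i \<noteq> j"
  shows "conj_gen i j x $ i $ i = x $ i $ j + x $ j $ i"
    and "conj_gen i j x $ i $ j = x $ j $ j - x $ i $ i"
    and "conj_gen i j x $ j $ i = x $ j $ j - x $ i $ i"
  using assms by (simp_all add: conj_gen_def row_gen_def)

definition flow :: "'n \<Rightarrow> 'n \<times> 'f \<Rightarrow> real \<Rightarrow> 'f ^ 'n ^ 'n \<Rightarrow> 'f ^ 'n ^ 'n" where
  "flow k ju \<theta> = tw' k (fst ju) (snd ju) \<circ> (rot_conj k (fst ju) \<theta> \<circ> tw k (fst ju) (snd ju))"

definition flow_gen :: "'n \<Rightarrow> 'n \<times> 'f \<Rightarrow> 'f ^ 'n ^ 'n \<Rightarrow> 'f ^ 'n ^ 'n" where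
  "flow_gen k ju = tw' k (fst ju) (snd ju) \<circ> (conj_gen k (fst ju) \<circ> tw k (fst ju) (snd ju))"

lemma tw_P: "i \<noteq> j \<Longrightarrow> u \<in> Basis \<Longrightarrow> p \<in> P \<Longrightarrow> tw i j u p \<in> P"
  and tw'_P: "i \<noteq> j \<Longrightarrow> u \<in> Basis \<Longrightarrow> p \<in> P \<Longrightarrow> tw' i j u p \<in> P"
  and tw_tw': "i \<noteq> j \<Longrightarrow> u \<in> Basis \<Longrightarrow> tw i j u (tw' i j u x) = x"
  and tw'_tw: "i \<noteq> j \<Longrightarrow> u \<in> Basis \<Longrightarrow> tw' i j u (tw i j u x) = x"
  and linear_tw: "i \<noteq> j \<Longrightarrow> u \<in> Basis \<Longrightarrow> linear (tw i j u)"
  and linear_tw': "i \<noteq> j \<Longrightarrow> u \<in> Basis \<Longrightarrow> linear (tw' i j u)"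
  using twist_iso[of i j u] by (auto simp: points_isometry_def)

lemma norm_tw: "i \<noteq> j \<Longrightarrow> u \<in> Basis \<Longrightarrow> norm (tw i j u x) = norm x"
  and norm_tw': "i \<noteq> j \<Longrightarrow> u \<in> Basis \<Longrightarrow> norm (tw' i j u x) = norm x"
  using twist_iso[of i j u] points_isometry_sym[OF twist_iso[of i j u]]
  by (auto simp: points_isometry_def)

lemma P_entry_sum:
  assumes "p \<in> P"
  shows "(p $ i $ j + p $ j $ i) \<bullet> e = 2 * (p $ i $ j \<bullet> e)"
  unfolding P_hermitian[OF assms, of i j, symmetric] add_cnj by simp

text \<open>The (k, k) entry moves with velocity p_kj + p_jk, twice the real part of p_kj, and the
  twist replaces the real part by the u-component. In the second derivative the inner twists cancel,
  and the off-diagonal entries move with velocity p_jj - p_kk.\<close>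

lemma flow_gen_entry:
  assumes j: "j \<noteq> k" and u: "u \<in> Basis" and x: "x \<in> P"
  shows "flow_gen k (j, u) x $ k $ k \<bullet> e = 2 * (x $ k $ j \<bullet> u)"
    and "flow_gen k (j, u) (flow_gen k (j, u) x) $ k $ k \<bullet> e = 2 * (dg x j - dg x k)"
proof -
  have kj: "k \<noteq> j" using j by simp
  note z = tw_P[OF kj u x]
  show "flow_gen k (j, u) x $ k $ k \<bullet> e = 2 * (x $ k $ j \<bullet> u)"
    by (simp add: flow_gen_def twist_fix[OF kj u] conj_gen_nth(1)[OF kj] P_entry_sum[OF z] twist_entry[OF kj u])
  show "flow_gen k (j, u) (flow_gen k (j, u) x) $ k $ k \<bullet> e = 2 * (dg x j - dg x k)"
    by (simp add: flow_gen_def twist_fix[OF kj u] tw_tw'[OF kj u] conj_gen_nth[OF kj]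
        twist_diag[OF kj u x] inner_add_left inner_diff_left dg_def)
qed

abbreviation "X \<equiv> projective_space m c e t :: ('f ^ 'n ^ 'n) symspace"

lemma X_simps:
  "points X = P" "geo_dist X p q = arccos (2 * (p \<bullet> q) - 1)" "rtau X = t"
  "rsigma X = (real DIM('f) * (real CARD('n) - 1) - 2) / 2"
  using card by (simp_all add: projective_space_def rsigma_def of_nat_diff)

text \<open>With d = p_kk and l = 2 d - 1, summation over \<open>Basis\<close> gives 16 times the
  sum of |p_kj|^2 over j \<noteq> k. This equals 16 (d - d^2) = 4 (1 - l^2), whence
  \<open>\<kappa>\<close> = 4. The constant B = 4 collects 2 from each side of the
  conjugation.\<close>

lemma projective_zonal_flow:
  "zonal_flow X (axis k (axis k e)) ((UNIV - {k}) \<times> Basis) (flow k) (\<lambda>ju \<theta>. flow k ju (- \<theta>)) (flow_gen k)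
    (\<lambda>x. 2 * (x $ k $ k \<bullet> e) - 1) (\<lambda>x. 2 * (x $ k $ k \<bullet> e)) (-1) 4 4"
proof (rule zonal_flow.intro)
  show "compact (points X)" by (simp add: X_simps compact_P)
  show "bounded_linear (\<lambda>x :: 'f ^ 'n ^ 'n. 2 * (x $ k $ k \<bullet> e))"
    by (intro bounded_linear_const_mult bounded_linear_inner_left_comp
        bounded_linear_compose[OF bounded_linear_vec_nth bounded_linear_vec_nth])
  show "\<bar>2 * (x $ k $ k \<bullet> e) - 1\<bar> \<le> 1" if "x \<in> points X" for x
    using that dg_nonneg[of x k] dg_le_1[of x k] by (simp add: X_simps dg_def abs_le_iff)
  show "geo_dist X (axis k (axis k e)) x = arccos (2 * (x $ k $ k \<bullet> e) - 1)" for x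
    by (simp only: X_simps inner_axis' inner_commute[of e])
  show "points_isometry (points X) (flow k ju \<theta>) (flow k ju (- \<theta>))" if "ju \<in> (UNIV - {k}) \<times> Basis" for ju \<theta>
  proof -
    obtain j u where ju: "ju = (j, u)" "k \<noteq> j" "u \<in> Basis" using \<open>ju \<in> _\<close> by auto
    note tw = twist_iso[OF ju(2,3)]
    from points_isometry_comp[OF points_isometry_sym[OF tw] points_isometry_comp[OF rot_conj_iso[OF ju(2)] tw]]
    show ?thesis unfolding flow_def X_simps ju(1) by (simp add: comp_assoc)
  qed
  show "linear (flow_gen k ju)" if "ju \<in> (UNIV - {k}) \<times> Basis" for ju
    using that unfolding flow_gen_def by (auto intro!: linear_compose linear_tw linear_tw' linear_conj_gen)
  show "flow k ju 0 x = x" if "ju \<in> (UNIV - {k}) \<times> Basis" for ju x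
  proof -
    obtain j u where ju: "ju = (j, u)" "k \<noteq> j" "u \<in> Basis" using \<open>ju \<in> _\<close> by auto
    show ?thesis by (simp add: flow_def ju(1) rot_conj_def rot_rows_eq tw'_tw[OF ju(2,3)])
  qed
  show "((\<lambda>\<theta>. flow k ju \<theta> x) has_vector_derivative flow_gen k ju x) (at 0)"
    if "ju \<in> (UNIV - {k}) \<times> Basis" for ju x
  proof -
    obtain j u where ju: "ju = (j, u)" "k \<noteq> j" "u \<in> Basis" using \<open>ju \<in> _\<close> by auto
    have "bounded_linear (tw' k j u)" using linear_tw'[OF ju(2,3)] by (simp add: linear_conv_bounded_linear)
    from bounded_linear.has_vector_derivative[OF this rot_conj_has_vector_derivative[OF ju(2)]]
    show ?thesis by (simp add: flow_def flow_gen_def ju(1))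
  qed
  show "norm (flow k ju \<theta> x - x) \<le> 4 * \<bar>\<theta>\<bar>" if "ju \<in> (UNIV - {k}) \<times> Basis" "x \<in> points X" for ju x \<theta>
  proof -
    obtain j u where ju: "ju = (j, u)" "k \<noteq> j" "u \<in> Basis" using \<open>ju \<in> _\<close> by auto
    let ?z = "tw k j u x"
    have "flow k ju \<theta> x - x = tw' k j u (rot_conj k j \<theta> ?z - ?z)"
      using linear_tw'[OF ju(2,3)] by (simp add: flow_def ju(1) linear_diff tw'_tw[OF ju(2,3)])
    then have "norm (flow k ju \<theta> x - x) = norm (rot_conj k j \<theta> ?z - ?z)"
      by (simp add: norm_tw'[OF ju(2,3)])
    also have "\<dots> \<le> 4 * \<bar>\<theta>\<bar> * norm ?z" by (rule norm_rot_conj_diff_le[OF ju(2)])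
    finally show ?thesis using that(2) by (simp add: norm_tw[OF ju(2,3)] X_simps norm_P)
  qed
  show "(\<Sum>ju\<in>(UNIV - {k}) \<times> Basis. (2 * (flow_gen k ju x $ k $ k \<bullet> e))\<^sup>2)
      = 4 * (1 - (2 * (x $ k $ k \<bullet> e) - 1)\<^sup>2)" if "x \<in> points X" for x
  proof -
    have x: "x \<in> P" using that by (simp add: X_simps)
    have "(\<Sum>ju\<in>(UNIV - {k}) \<times> Basis. (2 * (flow_gen k ju x $ k $ k \<bullet> e))\<^sup>2)
        = (\<Sum>(j, u)\<in>(UNIV - {k}) \<times> Basis. 16 * (x $ k $ j \<bullet> u)\<^sup>2)"
    proof (rule sum.cong[OF refl])
      fix ju assume "ju \<in> (UNIV - {k}) \<times> (Basis :: 'f set)"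
      then obtain j u where ju: "ju = (j, u)" "j \<noteq> k" "u \<in> Basis" by auto
      show "(2 * (flow_gen k ju x $ k $ k \<bullet> e))\<^sup>2 = (case ju of (j, u) \<Rightarrow> 16 * (x $ k $ j \<bullet> u)\<^sup>2)"
        unfolding ju(1) flow_gen_entry(1)[OF ju(2,3) x] prod.case by (simp only: power_mult_distrib) simp
    qed
    also have "\<dots> = 16 * (\<Sum>j\<in>UNIV - {k}. \<Sum>u\<in>Basis. (x $ k $ j \<bullet> u)\<^sup>2)"
      by (simp add: sum.cartesian_product[symmetric] sum_distrib_left)
    also have "\<dots> = 16 * (\<Sum>j\<in>UNIV - {k}. (norm (x $ k $ j))\<^sup>2)"
    proof -
      have "(norm v)\<^sup>2 = (\<Sum>u\<in>Basis. (v \<bullet> u)\<^sup>2)" for v :: 'f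
        unfolding power2_norm_eq_inner by (subst euclidean_inner) (simp add: power2_eq_square)
      then show ?thesis by simp
    qed
    also have "(\<Sum>j\<in>UNIV - {k}. (norm (x $ k $ j))\<^sup>2) = dg x k - (dg x k)\<^sup>2"
    proof -
      have "(\<Sum>j\<in>UNIV. (norm (x $ k $ j))\<^sup>2) = (norm (x $ k $ k))\<^sup>2 + (\<Sum>j\<in>UNIV - {k}. (norm (x $ k $ j))\<^sup>2)"
        by (simp add: sum.remove[of UNIV k])
      then show ?thesis
        using P_diag(2)[OF x, of k] norm_entry_square[OF x, of k k] unfolding power2_eq_square by linarith
    qed
    finally show ?thesis by (simp add: dg_def power2_eq_square algebra_simps)
  qed
  show "(\<Sum>ju\<in>(UNIV - {k}) \<times> Basis. 2 * (flow_gen k ju (flow_gen k ju x) $ k $ k \<bullet> e))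
      = 4 * (rtau X - rsigma X - (rsigma X + rtau X + 2) * (2 * (x $ k $ k \<bullet> e) - 1))" if "x \<in> points X" for x
  proof -
    have x: "x \<in> P" using that by (simp add: X_simps)
    have "(\<Sum>ju\<in>(UNIV - {k}) \<times> Basis. 2 * (flow_gen k ju (flow_gen k ju x) $ k $ k \<bullet> e))
        = (\<Sum>(j, u)\<in>(UNIV - {k}) \<times> (Basis :: 'f set). 4 * (dg x j - dg x k))"
    proof (rule sum.cong[OF refl])
      fix ju assume "ju \<in> (UNIV - {k}) \<times> (Basis :: 'f set)"
      then obtain j u where ju: "ju = (j, u)" "j \<noteq> k" "u \<in> Basis" by auto
      show "2 * (flow_gen k ju (flow_gen k ju x) $ k $ k \<bullet> e) = (case ju of (j, u) \<Rightarrow> 4 * (dg x j - dg x k))"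
        unfolding ju(1) flow_gen_entry(2)[OF ju(2,3) x] prod.case by simp
    qed
    also have "\<dots> = 4 * real DIM('f) * ((\<Sum>j\<in>UNIV - {k}. dg x j) - (\<Sum>j\<in>UNIV - {k}. dg x k))"
      unfolding sum.cartesian_product[symmetric] sum_subtractf[symmetric] sum_distrib_left
      by (simp add: algebra_simps)
    also have "(\<Sum>j\<in>UNIV - {k}. dg x j) = 1 - dg x k"
      using sum_dg[OF x] by (simp add: sum.remove[of UNIV k])
    also have "(\<Sum>j\<in>UNIV - {k}. dg x k) = (real CARD('n) - 1) * dg x k"
      using card by (simp add: card_Diff_singleton of_nat_diff)
    finally have eq: "(\<Sum>ju\<in>(UNIV - {k}) \<times> Basis. 2 * (flow_gen k ju (flow_gen k ju x) $ k $ k \<bullet> e))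
      = 4 * real DIM('f) * (1 - dg x k - (real CARD('n) - 1) * dg x k)" .
    have t_eq: "t = (real DIM('f) - 2) / 2" using t by simp
    show ?thesis unfolding eq X_simps unfolding t_eq by (simp add: dg_def field_simps)
  qed
  show "rsigma X + rtau X + 1 \<ge> 0"
  proof -
    have "real DIM('f) \<ge> 1" using DIM_positive[where 'a = 'f] by linarith
    then have "1 * 2 \<le> real DIM('f) * real CARD('n)" using card by (intro mult_mono) auto
    moreover have "t = (real DIM('f) - 2) / 2" using t by simp
    ultimately show ?thesis by (simp add: X_simps field_simps)
  qed
qed auto

section \<open>Every projection can be moved to a coordinate line\<close>

text \<open>A rotation by a right angle negates the real part of the twisted entry, so by the
  intermediate value theorem it vanishes for some angle in between. The other components of the
  entry do not change under rotation.\<close>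

lemma remove_component:
  assumes p: "p \<in> P" and ij: "i \<noteq> j" and u: "u \<in> Basis"
  shows "\<exists>g g'. points_isometry P g g' \<and> g p $ i $ j = p $ i $ j - (p $ i $ j \<bullet> u) *\<^sub>R u \<and>
    (\<forall>k. k \<noteq> i \<longrightarrow> k \<noteq> j \<longrightarrow> dg (g p) k = dg p k)"
proof -
  define z where "z = tw i j u p"
  have z: "z \<in> P" using tw_P[OF ij u p] by (simp add: z_def)
  have entry: "rot_conj i j \<theta> z $ i $ j
    = z $ i $ j + (cos \<theta> * sin \<theta> * (dg z j - dg z i) - 2 * (sin \<theta>)\<^sup>2 * (z $ i $ j \<bullet> e)) *\<^sub>R e" for \<theta>
  proof -
    have "(cos \<theta> * cos \<theta>) *\<^sub>R v + (sin \<theta> * sin \<theta>) *\<^sub>R v = v" for v :: 'f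
      by (simp add: power2_eq_square[symmetric] flip: scaleR_add_left)
    then have cs: "(cos \<theta> * cos \<theta>) *\<^sub>R v = v - (sin \<theta> * sin \<theta>) *\<^sub>R v" for v :: 'f
      by (simp add: eq_diff_eq)
    have "z $ j $ i = (2 * (z $ i $ j \<bullet> e)) *\<^sub>R e - z $ i $ j"
      using add_cnj[of "z $ i $ j"] P_hermitian[OF z, of i j] by (simp add: eq_diff_eq add.commute)
    then show ?thesis
      unfolding rot_conj_nth(1)[OF ij] rotv_def using ij
      by (simp add: P_diag(1)[OF z] cs scaleR_diff_right scaleR_diff_left scaleR_add_left scaleR_add_right right_diff_distrib power2_eq_square mult_ac)
  qed
  define F where "F \<theta> = rot_conj i j \<theta> z $ i $ j \<bullet> e" for \<theta>
  have F: "F \<theta> = z $ i $ j \<bullet> e + (cos \<theta> * sin \<theta> * (dg z j - dg z i) - 2 * (sin \<theta>)\<^sup>2 * (z $ i $ j \<bullet> e))" for \<theta>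
    unfolding F_def entry by (simp add: inner_add_left)
  have cont: "continuous_on {0..pi/2} F" unfolding F by (intro continuous_intros)
  have "F 0 = z $ i $ j \<bullet> e" "F (pi / 2) = - (z $ i $ j \<bullet> e)" by (simp_all add: F)
  then obtain \<theta> where "F \<theta> = 0"
    using IVT'[of F 0 0 "pi / 2"] IVT2'[of F "pi / 2" 0 0] cont
    by (cases "z $ i $ j \<bullet> e \<le> 0") force+
  then have lam: "cos \<theta> * sin \<theta> * (dg z j - dg z i) - 2 * (sin \<theta>)\<^sup>2 * (z $ i $ j \<bullet> e) = - (p $ i $ j \<bullet> u)"
    by (simp add: F z_def twist_entry[OF ij u])
  define y where "y = rot_conj i j \<theta> z"
  have y: "y \<in> P" unfolding y_def by (rule rot_conj_P[OF ij z])
  let ?g = "tw' i j u \<circ> (rot_conj i j \<theta> \<circ> tw i j u)"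
  have gp: "?g p = tw' i j u y" by (simp add: y_def z_def)
  have "y $ i $ j = z $ i $ j + (- (p $ i $ j \<bullet> u)) *\<^sub>R e" unfolding y_def entry lam ..
  from twist_shift[OF ij u this]
  have "?g p $ i $ j = p $ i $ j - (p $ i $ j \<bullet> u) *\<^sub>R u"
    unfolding gp by (simp add: z_def tw'_tw[OF ij u])
  moreover have "dg (?g p) k = dg p k" if "k \<noteq> i" "k \<noteq> j" for k
  proof -
    have "tw' i j u y $ k $ k = y $ k $ k"
      using twist_diag[OF ij u tw'_P[OF ij u y], of k] by (simp add: tw_tw'[OF ij u])
    also have "\<dots> = z $ k $ k" using that by (simp add: y_def rot_conj_nth(1)[OF ij] rotv_def)
    also have "\<dots> = p $ k $ k" unfolding z_def by (rule twist_diag[OF ij u p])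
    finally show ?thesis unfolding gp dg_def by simp
  qed
  moreover have "\<exists>h. points_isometry P ?g h"
    using points_isometry_comp[OF points_isometry_sym[OF twist_iso[OF ij u]] points_isometry_comp[OF rot_conj_iso[OF ij] twist_iso[OF ij u]]]
    by blast
  ultimately show ?thesis by blast
qed

text \<open>The components are cleared one after the other; clearing one leaves the others as they
  are.\<close>

lemma remove_entry:
  assumes p: "p \<in> P" and ij: "i \<noteq> j"
  shows "\<exists>g g'. points_isometry P g g' \<and> g p $ i $ j = 0 \<and>
    (\<forall>k. k \<noteq> i \<longrightarrow> k \<noteq> j \<longrightarrow> dg (g p) k = dg p k)"
proof -
  have "\<exists>g g'. points_isometry P g g' \<and> g p $ i $ j = p $ i $ j - (\<Sum>u\<in>U. (p $ i $ j \<bullet> u) *\<^sub>R u) \<and>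
    (\<forall>k. k \<noteq> i \<longrightarrow> k \<noteq> j \<longrightarrow> dg (g p) k = dg p k)" if "finite U" "U \<subseteq> Basis" for U
    using that
  proof (induction U rule: finite_induct)
    case empty
    show ?case by (intro exI[of _ id]) (simp add: points_isometry_id[unfolded id_def])
  next
    case (insert u U)
    then obtain g g' where g: "points_isometry P g g'"
      "g p $ i $ j = p $ i $ j - (\<Sum>u\<in>U. (p $ i $ j \<bullet> u) *\<^sub>R u)"
      "\<forall>k. k \<noteq> i \<longrightarrow> k \<noteq> j \<longrightarrow> dg (g p) k = dg p k" by auto
    have gp: "g p \<in> P" using g(1) p by (auto simp: points_isometry_def)
    have u: "u \<in> Basis" using insert by simp
    obtain h h' where h: "points_isometry P h h'"
      "h (g p) $ i $ j = g p $ i $ j - (g p $ i $ j \<bullet> u) *\<^sub>R u"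
      "\<forall>k. k \<noteq> i \<longrightarrow> k \<noteq> j \<longrightarrow> dg (h (g p)) k = dg (g p) k"
      using remove_component[OF gp ij u] by blast
    have "(\<Sum>v\<in>U. (p $ i $ j \<bullet> v) * (v \<bullet> u)) = 0"
    proof (rule sum.neutral, rule ballI)
      fix v assume v: "v \<in> U"
      then have "v \<in> Basis" "v \<noteq> u" using insert by auto
      then show "(p $ i $ j \<bullet> v) * (v \<bullet> u) = 0" using u by (simp add: inner_not_same_Basis)
    qed
    then have "g p $ i $ j \<bullet> u = p $ i $ j \<bullet> u"
      unfolding g(2) by (simp add: inner_diff_left inner_sum_left)
    then have "(h \<circ> g) p $ i $ j = p $ i $ j - (\<Sum>u\<in>insert u U. (p $ i $ j \<bullet> u) *\<^sub>R u)"
      using insert(1,2) by (simp add: h(2) g(2) algebra_simps)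
    moreover have "points_isometry P (h \<circ> g) (g' \<circ> h')" by (rule points_isometry_comp[OF h(1) g(1)])
    moreover have "\<forall>k. k \<noteq> i \<longrightarrow> k \<noteq> j \<longrightarrow> dg ((h \<circ> g) p) k = dg p k" using g(3) h(3) by simp
    ultimately show ?case by blast
  qed
  from this[of Basis] show ?thesis by (simp add: euclidean_representation)
qed

text \<open>Clearing the entry between two nonzero diagonal entries annihilates one of these, since
  its squared norm is their product. Thus the number of nonzero diagonal entries drops until a
  single one, equal to the trace 1, remains.\<close>

lemma transitive: "p \<in> P \<Longrightarrow> \<exists>g g' k. points_isometry P g g' \<and> g p = axis k (axis k e)"
proof (induction "card {k. dg p k \<noteq> 0}" arbitrary: p rule: less_induct)
  case less
  show ?case
  proof (cases "\<exists>i j. i \<noteq> j \<and> dg p i \<noteq> 0 \<and> dg p j \<noteq> 0")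
    case True
    then obtain i j where ij: "i \<noteq> j" "dg p i \<noteq> 0" "dg p j \<noteq> 0" by blast
    obtain g g' where g: "points_isometry P g g'" "g p $ i $ j = 0"
      "\<And>k. k \<noteq> i \<Longrightarrow> k \<noteq> j \<Longrightarrow> dg (g p) k = dg p k"
      using remove_entry[OF less.prems ij(1)] by blast
    have gp: "g p \<in> P" using g(1) less.prems by (auto simp: points_isometry_def)
    have "dg (g p) i = 0 \<or> dg (g p) j = 0"
      using norm_entry_square[OF gp, of i j] g(2) by simp
    moreover have "{k. dg (g p) k \<noteq> 0} \<subseteq> {k. dg p k \<noteq> 0}"
    proof
      fix x assume "x \<in> {k. dg (g p) k \<noteq> 0}"
      then show "x \<in> {k. dg p k \<noteq> 0}" using ij g(3)[of x] by (cases "x = i \<or> x = j") auto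
    qed
    ultimately have "{k. dg (g p) k \<noteq> 0} \<subset> {k. dg p k \<noteq> 0}"
      using ij by blast
    then have "card {k. dg (g p) k \<noteq> 0} < card {k. dg p k \<noteq> 0}"
      by (intro psubset_card_mono) auto
    from less.hyps[OF this gp] obtain h h' k where h: "points_isometry P h h'" "h (g p) = axis k (axis k e)"
      by blast
    then have "points_isometry P (h \<circ> g) (g' \<circ> h')" "(h \<circ> g) p = axis k (axis k e)"
      using points_isometry_comp[OF h(1) g(1)] by auto
    then show ?thesis by blast
  next
    case False
    obtain k where k: "dg p k \<noteq> 0"
      using sum_dg[OF less.prems] by (metis sum.neutral zero_neq_one)
    have other: "dg p i = 0" if "i \<noteq> k" for i using False k that by blast
    have "dg p k = 1"
      using sum_dg[OF less.prems] other by (simp add: sum.remove[of UNIV k])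
    moreover have "p $ a $ b = 0" if "a \<noteq> k \<or> b \<noteq> k" for a b
      using norm_entry_square[OF less.prems, of a b] other that by auto
    ultimately have "p = axis k (axis k e)"
      using P_diag(1)[OF less.prems, of k] by (auto simp: vec_eq_iff axis_def)
    then show ?thesis using points_isometry_id by (intro exI[of _ id]) auto
  qed
qed

theorem projective_mutually_transferrable:
  assumes "continuous_on {0..} \<psi>1" "continuous_on {0..} \<psi>2" "comparable_oscillation \<psi>1 \<psi>2"
  shows "mutually_transferrable X \<psi>1 \<psi>2"
proof (rule mutually_transferrableI[OF assms projective_zonal_flow])
  fix b assume "b \<in> points X"
  then have "b \<in> P" by (simp add: X_simps)
  from transitive[OF this] obtain g g' k where g: "points_isometry P g g'" "g b = axis k (axis k e)"
    by blast
  have "geo_dist X b x = arccos (2 * (g x $ k $ k \<bullet> e) - 1)" for x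
    unfolding X_simps points_isometry_inner[OF g(1), of b x, symmetric] g(2) inner_axis' inner_commute[of e] ..
  then show "\<exists>k g g'. points_isometry (points X) g g' \<and>
      (\<forall>x\<in>points X. geo_dist X b x = arccos (2 * (g' x $ k $ k \<bullet> e) - 1))"
    using points_isometry_sym[OF g(1)] unfolding X_simps by blast
qed

end

section \<open>The four coefficient algebras\<close>

lemma (in conj_algebra) m_cnj': "m (c x) x = (norm x)\<^sup>2 *\<^sub>R e"
  using m_cnj[of "c x"] by (simp add: c_c norm_c)

lemma (in conj_algebra) c_eq: "c z = (2 * (z \<bullet> e)) *\<^sub>R e - z"
  using add_cnj[of z] by (simp add: eq_diff_eq add.commute)

lemma (in conj_algebra) inner_c: "c x \<bullet> c y = x \<bullet> y"
  by (simp add: c_eq inner_diff_left inner_diff_right inner_commute[of e x] inner_commute[of e y])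

text \<open>Reduces idempotency on the diagonal to norms; the octonion twists rely on this.\<close>

lemma (in conj_algebra) sum_m_hermitian:
  fixes q :: "'f ^ 'n::finite ^ 'n"
  assumes "\<And>i j. q $ j $ i = c (q $ i $ j)"
  shows "(\<Sum>k\<in>UNIV. m (q $ i $ k) (q $ k $ i)) = (\<Sum>k\<in>UNIV. (norm (q $ i $ k))\<^sup>2) *\<^sub>R e"
proof -
  have "m (q $ i $ k) (q $ k $ i) = (norm (q $ i $ k))\<^sup>2 *\<^sub>R e" for k
    by (subst assms[of k i]) (rule m_cnj)
  then show ?thesis by (simp add: scaleR_left.sum)
qed

lemma (in conj_algebra) m_sum:
  "m (\<Sum>i\<in>I. f i) y = (\<Sum>i\<in>I. m (f i) y)" "m x (\<Sum>i\<in>I. f i) = (\<Sum>i\<in>I. m x (f i))"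
  using bilinear_m linear_sum[of "\<lambda>x. m x y" f I] linear_sum[of "m x" f I] by (simp_all add: bilinear_def)

section \<open>Associative coefficients: twists by diagonal matrices\<close>

locale assoc_conj_algebra = conj_algebra m c e
  for m :: "'f::euclidean_space \<Rightarrow> 'f \<Rightarrow> 'f" and c e +
  assumes m_assoc: "m (m x y) z = m x (m y z)"
begin

text \<open>Associativity lets y (c y) be formed first inside (x y) c (x y), and this inner product
  is a real scalar.\<close>

lemma norm_m: "norm (m x y) = norm x * norm y"
proof -
  have "(norm (m x y))\<^sup>2 *\<^sub>R e = m x (m (m y (c y)) (c x))"
    unfolding m_cnj[symmetric] c_m m_assoc ..
  also have "\<dots> = ((norm x)\<^sup>2 * (norm y)\<^sup>2) *\<^sub>R e"
    by (simp add: m_cnj m_simps m_e)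
  finally have "(norm (m x y))\<^sup>2 = (norm x * norm y)\<^sup>2"
    using norm_e by (auto simp: power_mult_distrib)
  then show ?thesis by (simp add: power2_eq_iff_nonneg)
qed

text \<open>Both sides are the inner product of one factor with the conjugate of the other, which is
  symmetric in the two. Needed for the cross terms in \<open>norm_oct_mult\<close>.\<close>

lemma inner_m_cyclic: "m x y \<bullet> e = m y x \<bullet> e"
proof -
  have "m x y \<bullet> e = x \<bullet> c y" using inner_m_cnj[of x "c y"] by (simp add: c_c)
  also have "\<dots> = y \<bullet> c x" by (simp add: c_eq inner_diff_right inner_commute[of x y])
  also have "\<dots> = m y x \<bullet> e" using inner_m_cnj[of y "c x"] by (simp add: c_c)
  finally show ?thesis .
qed

text \<open>Conjugation by the diagonal unitary matrix with u in place j and the unit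
  elsewhere.\<close>

definition atwist :: "'n::finite \<Rightarrow> 'f \<Rightarrow> 'f ^ 'n ^ 'n \<Rightarrow> 'f ^ 'n ^ 'n" where
  "atwist j u p = (\<chi> a b. m (if a = j then u else e) (m (p $ a $ b) (c (if b = j then u else e))))"

lemma atwist_nth: "atwist j u p $ a $ b = m (if a = j then u else e) (m (p $ a $ b) (c (if b = j then u else e)))"
  by (simp add: atwist_def)

lemma atwist_P:
  fixes p :: "'f ^ 'n::finite ^ 'n"
  assumes p: "p \<in> proj" and u: "norm u = 1"
  shows "atwist j u p \<in> proj" and "atwist j u p $ k $ k = p $ k $ k"
proof -
  define d where "d a = (if a = j then u else e)" for a
  have d: "m (c (d a)) (d a) = e" "m (d a) (c (d a)) = e" for a
    using u norm_e by (simp_all add: d_def m_cnj m_cnj')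
  have nth: "atwist j u p $ a $ b = m (d a) (m (p $ a $ b) (c (d b)))" for a b
    by (simp add: atwist_nth d_def)
  show diag: "atwist j u p $ k $ k = p $ k $ k" for k
    unfolding nth by (subst (1 2) P_diag(1)[OF p]) (simp add: m_simps m_e d)
  have "atwist j u p $ b $ a = c (atwist j u p $ a $ b)" for a b
    unfolding nth c_m c_c P_hermitian[OF p] m_assoc ..
  moreover have "(\<Sum>k\<in>UNIV. m (atwist j u p $ a $ k) (atwist j u p $ k $ b)) = atwist j u p $ a $ b" for a b
  proof -
    have "m (atwist j u p $ a $ k) (atwist j u p $ k $ b) = m (d a) (m (m (p $ a $ k) (p $ k $ b)) (c (d b)))" for k
    proof -
      have "m (c (d k)) (m (d k) z) = z" for z
        using m_assoc[of "c (d k)" "d k" z] by (simp add: d m_e)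
      then show ?thesis unfolding nth by (simp add: m_assoc)
    qed
    then have "(\<Sum>k\<in>UNIV. m (atwist j u p $ a $ k) (atwist j u p $ k $ b))
        = m (d a) (m (\<Sum>k\<in>UNIV. m (p $ a $ k) (p $ k $ b)) (c (d b)))"
      by (simp add: m_sum)
    then show ?thesis by (simp add: P_idempotent[OF p] nth)
  qed
  moreover have "(\<Sum>k\<in>UNIV. atwist j u p $ k $ k) = e"
    by (simp add: diag P_trace[OF p])
  ultimately show "atwist j u p \<in> proj" unfolding P_iff by blast
qed

lemma atwist_inverse:
  assumes u: "norm u = 1"
  shows "atwist j (c u) (atwist j u p) = p"
proof -
  have "m (c u) (m u z) = z" for z
    using m_assoc[of "c u" u z] u by (simp add: m_cnj' m_e)
  moreover have "m (m z (c u)) u = z" for z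
    using u by (simp add: m_assoc m_cnj' m_e)
  ultimately show ?thesis
    unfolding vec_eq_iff atwist_nth by (auto simp: c_e c_c m_e) (simp_all add: m_assoc)
qed

lemma atwist_iso:
  assumes u: "norm u = 1"
  shows "points_isometry (proj :: ('f ^ 'n::finite ^ 'n) set) (atwist j u) (atwist j (c u))"
proof -
  have cu: "norm (c u) = 1" using u by (simp add: norm_c)
  have lin: "linear (atwist j v :: 'f ^ 'n ^ 'n \<Rightarrow> _)" for v
    by (intro linearI) (simp_all add: vec_eq_iff atwist_nth m_simps)
  have nrm: "norm (atwist j u p) = norm p" for p :: "'f ^ 'n ^ 'n"
  proof -
    have "norm (if a = j then u else e) = 1" for a using u norm_e by simp
    then show ?thesis by (simp add: norm_vec_def atwist_nth norm_m norm_c)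
  qed
  show ?thesis
    using lin nrm atwist_P(1) u cu atwist_inverse[OF u] atwist_inverse[OF cu]
    by (auto simp: points_isometry_def c_c)
qed

lemma twisted_projective_assoc:
  assumes "CARD('n::finite) \<ge> 2" "2 * t + 2 = real DIM('f)"
  shows "twisted_projective m c e t (\<lambda>(i::'n) j. atwist j) (\<lambda>i j u. atwist j (c u))"
proof (rule twisted_projective.intro[OF conj_algebra_axioms], rule twisted_projective_axioms.intro)
  fix i j :: 'n and u :: 'f assume ij: "i \<noteq> j" and u: "u \<in> Basis"
  then have u1: "norm u = 1" by simp
  show "points_isometry proj (atwist j u :: 'f ^ 'n ^ 'n \<Rightarrow> _) (atwist j (c u))" by (rule atwist_iso[OF u1])
  show "atwist j (c u) x $ i $ i = x $ i $ i" for x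
    using ij by (simp add: atwist_nth m_e c_e)
  show "atwist j u p $ k $ k = p $ k $ k" if "p \<in> proj" for p k
    by (rule atwist_P(2)[OF that u1])
  show "atwist j u x $ i $ j \<bullet> e = x $ i $ j \<bullet> u" for x
    using ij by (simp add: atwist_nth m_e inner_m_cnj)
  show "atwist j (c u) x $ i $ j = atwist j (c u) y $ i $ j + r *\<^sub>R u" if "x $ i $ j = y $ i $ j + r *\<^sub>R e" for x y r
    using ij that by (simp add: atwist_nth m_e m_simps c_c)
qed (use norm_m assms in auto)

end

section \<open>Real numbers, complex numbers and quaternions\<close>

interpretation real_alg: assoc_conj_algebra "(*)" "\<lambda>x. x" "1 :: real"
  by (intro assoc_conj_algebra.intro conj_algebra.intro assoc_conj_algebra_axioms.intro)
    (auto simp: power2_eq_square bilinear_conv_bounded_bilinear bounded_bilinear_mult linear_id[unfolded id_def])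

interpretation complex_alg: assoc_conj_algebra "(*)" cnj "1 :: complex"
proof (intro assoc_conj_algebra.intro conj_algebra.intro assoc_conj_algebra_axioms.intro)
  show "bilinear ((*) :: complex \<Rightarrow> _)"
    by (simp add: bilinear_conv_bounded_bilinear bounded_bilinear_mult)
  show "linear cnj" by (rule bounded_linear.linear[OF bounded_linear_cnj])
  show "x * cnj x = (norm x)\<^sup>2 *\<^sub>R 1" for x
    unfolding complex_norm_square[symmetric] by (simp add: scaleR_conv_of_real)
qed (auto simp: complex_eq_iff inner_complex_def mult.assoc)

lemmas quat_defs = quat_mult_def quat_cnj_def cd_mult_def cd_cnj_def

lemma quat_mult_pair: "quat_mult (a, b) (c, d) = (a * c - cnj d * b, d * a + b * cnj c)"
  and quat_cnj_pair: "quat_cnj (a, b) = (cnj a, - b)"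
  by (simp_all add: quat_defs)

interpretation quat_alg: assoc_conj_algebra quat_mult quat_cnj "(1, 0)"
proof (intro assoc_conj_algebra.intro conj_algebra.intro assoc_conj_algebra_axioms.intro)
  show "bilinear quat_mult"
    unfolding bilinear_def
    by (intro conjI allI linearI) (simp_all add: quat_defs algebra_simps scaleR_conv_of_real)
  show "linear quat_cnj" by (intro linearI) (simp_all add: quat_defs)
  fix x y z :: quat
  show "quat_mult (1, 0) x = x" "quat_mult x (1, 0) = x" by (cases x; simp add: quat_mult_pair)+
  show "quat_cnj (quat_cnj x) = x" by (cases x) (simp add: quat_cnj_pair)
  show "quat_cnj (quat_mult x y) = quat_mult (quat_cnj y) (quat_cnj x)"
    by (cases x; cases y) (simp add: quat_mult_pair quat_cnj_pair algebra_simps)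
  show "norm ((1, 0) :: quat) = 1" by (simp add: norm_prod_def)
  show "norm (quat_cnj x) = norm x" by (cases x) (simp add: quat_cnj_pair norm_prod_def)
  show "quat_mult x (quat_cnj x) = (norm x)\<^sup>2 *\<^sub>R (1, 0)"
    by (cases x) (simp add: quat_mult_pair quat_cnj_pair norm_prod_def complex_mult_cnj cmod_power2 scaleR_conv_of_real mult.commute complex_eq_iff)
  show "x + quat_cnj x = (2 * (x \<bullet> (1, 0))) *\<^sub>R (1, 0)"
    by (cases x) (simp add: quat_cnj_pair inner_complex_def complex_eq_iff)
  show "quat_mult (quat_mult x y) z = quat_mult x (quat_mult y z)"
    by (cases x; cases y; cases z) (simp add: quat_mult_pair algebra_simps)
qed

section \<open>Octonions: composition of norms and Moufang identities\<close>

lemma oct_mult_pair: "oct_mult (a, b) (c, d)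
    = (quat_mult a c - quat_mult (quat_cnj d) b, quat_mult d a + quat_mult b (quat_cnj c))"
  and oct_cnj_pair: "oct_cnj (a, b) = (quat_cnj a, - b)"
  by (simp_all add: oct_mult_def oct_cnj_def cd_mult_def cd_cnj_def)

lemma quat_minus: "quat_mult (- x) y = - quat_mult x y" "quat_mult x (- y) = - quat_mult x y" "quat_cnj (- x) = - quat_cnj x"
  using quat_alg.m_simps(5)[of "-1" x y] quat_alg.m_simps(6)[of x "-1" y] quat_alg.c_simps(3)[of "-1" x] by simp_all

lemmas quat_simps = quat_alg.m_simps quat_alg.c_simps quat_alg.c_m quat_alg.c_c quat_alg.m_e quat_minus

interpretation oct_alg: conj_algebra oct_mult oct_cnj "((1, 0), 0)"
proof (rule conj_algebra.intro)
  show "bilinear oct_mult"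
    unfolding bilinear_def
    by (intro conjI allI linearI) (simp_all add: oct_mult_def cd_mult_def quat_simps algebra_simps)
  show "linear oct_cnj" by (intro linearI) (simp_all add: oct_cnj_def cd_cnj_def quat_simps)
  fix x y :: oct
  obtain a b where x: "x = (a, b)" by (rule prod.exhaust)
  obtain a' b' where y: "y = (a', b')" by (rule prod.exhaust)
  have 0: "quat_mult 0 q = 0" "quat_mult q 0 = 0" for q
    using quat_alg.m_simps(5)[of 0 0 q] quat_alg.m_simps(6)[of q 0 0] by simp_all
  note q = quat_simps 0 quat_alg.c_e
  show "oct_mult ((1, 0), 0) x = x" "oct_mult x ((1, 0), 0) = x"
    by (simp_all add: x oct_mult_pair q)
  show "oct_cnj (oct_cnj x) = x" by (simp add: x oct_cnj_pair q)
  show "oct_cnj (oct_mult x y) = oct_mult (oct_cnj y) (oct_cnj x)"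
    by (simp add: x y oct_mult_pair oct_cnj_pair q)
  show "norm (((1, 0), 0) :: oct) = 1" by (simp add: norm_prod_def)
  show "norm (oct_cnj x) = norm x" by (simp add: x oct_cnj_pair norm_Pair quat_alg.norm_c)
  show "oct_mult x (oct_cnj x) = (norm x)\<^sup>2 *\<^sub>R ((1, 0), 0)"
    by (simp add: x oct_mult_pair oct_cnj_pair q quat_alg.m_cnj quat_alg.m_cnj' norm_Pair scaleR_add_left)
  show "x + oct_cnj x = (2 * (x \<bullet> ((1, 0), 0))) *\<^sub>R ((1, 0), 0)"
    using quat_alg.add_cnj[of a] by (simp add: x oct_cnj_pair)
qed

text \<open>The squared norms of the two quaternion components are expanded; their cross terms
  cancel by associativity and cyclicity of the real part in the quaternions.\<close>

lemma norm_oct_mult: "norm (oct_mult x y) = norm x * norm y"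
proof -
  obtain a b where x: "x = (a, b)" by (rule prod.exhaust)
  obtain c d where y: "y = (c, d)" by (rule prod.exhaust)
  have cross: "quat_mult a c \<bullet> quat_mult (quat_cnj d) b = quat_mult d a \<bullet> quat_mult b (quat_cnj c)"
  proof -
    have "quat_mult a c \<bullet> quat_mult (quat_cnj d) b
        = quat_mult (quat_mult a (quat_mult c (quat_cnj b))) d \<bullet> (1, 0)"
      using quat_alg.inner_m_cnj[of "quat_mult a c" "quat_mult (quat_cnj d) b"]
      by (simp add: quat_simps quat_alg.m_assoc)
    also have "\<dots> = quat_mult d (quat_mult a (quat_mult c (quat_cnj b))) \<bullet> (1, 0)"
      by (rule quat_alg.inner_m_cyclic)
    also have "\<dots> = quat_mult d a \<bullet> quat_mult b (quat_cnj c)"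
      using quat_alg.inner_m_cnj[of "quat_mult d a" "quat_mult b (quat_cnj c)"]
      by (simp add: quat_simps quat_alg.m_assoc)
    finally show ?thesis .
  qed
  have sq: "(norm (u, v))\<^sup>2 = (norm u)\<^sup>2 + (norm v)\<^sup>2" for u v :: quat
    by (simp add: norm_Pair)
  have "(norm (oct_mult x y))\<^sup>2 = (norm (quat_mult a c))\<^sup>2 + (norm (quat_mult (quat_cnj d) b))\<^sup>2
      + (norm (quat_mult d a))\<^sup>2 + (norm (quat_mult b (quat_cnj c)))\<^sup>2"
    unfolding x y oct_mult_pair sq power2_norm_eq_inner[of "_ - _"] power2_norm_eq_inner[of "_ + _"]
    using cross
    by (simp add: inner_diff_left inner_diff_right inner_add_left inner_add_right power2_norm_eq_inner
        inner_commute[of "quat_mult (quat_cnj d) b" "quat_mult a c"]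
        inner_commute[of "quat_mult b (quat_cnj c)" "quat_mult d a"])
  also have "\<dots> = (norm x * norm y)\<^sup>2"
    unfolding power_mult_distrib x y sq quat_alg.norm_m quat_alg.norm_c by (simp add: algebra_simps)
  finally show ?thesis by (simp add: power2_eq_iff_nonneg)
qed

text \<open>Closed under conjugation, so that the Moufang identities apply both to a unit and to its
  inverse.\<close>

definition oct_units :: "oct set" where
  "oct_units = Basis \<union> oct_cnj ` Basis"

lemma oct_units_cnj: "u \<in> oct_units \<Longrightarrow> oct_cnj u \<in> oct_units"
  by (auto simp: oct_units_def oct_alg.c_c)

lemma norm_oct_units: "u \<in> oct_units \<Longrightarrow> norm u = 1"
  by (auto simp: oct_units_def oct_alg.norm_c)

lemma oct_units_cases:
  assumes "u \<in> oct_units"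
  obtains v where "u = v \<or> u = - v"
    "v \<in> {((1, 0), 0), ((\<i>, 0), 0), ((0, 1), 0), ((0, \<i>), 0), (0, (1, 0)), (0, (\<i>, 0)), (0, (0, 1)), (0, (0, \<i>))}"
proof -
  let ?B = "{((1, 0), 0), ((\<i>, 0), 0), ((0, 1), 0), ((0, \<i>), 0), (0, (1, 0)), (0, (\<i>, 0)), (0, (0, 1)), (0, (0, \<i>))} :: oct set"
  have B: "Basis = ?B" by (auto simp: Basis_prod_def Basis_complex_def)
  have "oct_cnj v = v \<or> oct_cnj v = - v" if "v \<in> ?B" for v
    using that by (auto simp: oct_cnj_def cd_cnj_def quat_cnj_def zero_prod_def)
  then show ?thesis using assms that unfolding oct_units_def B by blast
qed

text \<open>The Moufang identities, needed only for the units in \<open>Basis\<close> and their conjugates.\<close>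

lemma oct_moufang:
  fixes u x y :: oct
  assumes "u \<in> oct_units"
  shows "oct_mult (oct_mult u (oct_mult x u)) (oct_mult (oct_cnj u) y) = oct_mult u (oct_mult x y)"
    and "oct_mult (oct_mult x u) (oct_mult (oct_cnj u) (oct_mult y (oct_cnj u))) = oct_mult (oct_mult x y) (oct_cnj u)"
    and "oct_mult (oct_mult u x) (oct_mult y u) = oct_mult u (oct_mult (oct_mult x y) u)"
    and "oct_mult (oct_mult u x) u = oct_mult u (oct_mult x u)"
    and "oct_mult (oct_cnj u) (oct_mult u x) = x"
    and "oct_mult (oct_mult x u) (oct_cnj u) = x"
proof -
  obtain a b where ab: "x = (a, b)" by (rule prod.exhaust)
  obtain x1 x2 where a: "a = (x1, x2)" by (rule prod.exhaust)
  obtain x3 x4 where b: "b = (x3, x4)" by (rule prod.exhaust)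
  obtain c d where cd: "y = (c, d)" by (rule prod.exhaust)
  obtain y1 y2 where c: "c = (y1, y2)" by (rule prod.exhaust)
  obtain y3 y4 where d: "d = (y3, y4)" by (rule prod.exhaust)
  obtain v where v: "u = v \<or> u = - v"
    "v \<in> {((1, 0), 0), ((\<i>, 0), 0), ((0, 1), 0), ((0, \<i>), 0), (0, (1, 0)), (0, (\<i>, 0)), (0, (0, 1)), (0, (0, \<i>))}"
    by (rule oct_units_cases[OF assms])
  have i2: "\<i> * (\<i> * z) = - z" for z by (simp flip: mult.assoc)
  note simps = ab a b cd c d oct_mult_def oct_cnj_def cd_mult_def cd_cnj_def quat_mult_def quat_cnj_def
    algebra_simps i2
  show "oct_mult (oct_mult u (oct_mult x u)) (oct_mult (oct_cnj u) y) = oct_mult u (oct_mult x y)"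
    using v by (elim disjE insertE emptyE) (simp_all add: simps)
  show "oct_mult (oct_mult x u) (oct_mult (oct_cnj u) (oct_mult y (oct_cnj u))) = oct_mult (oct_mult x y) (oct_cnj u)"
    using v by (elim disjE insertE emptyE) (simp_all add: simps)
  show "oct_mult (oct_mult u x) (oct_mult y u) = oct_mult u (oct_mult (oct_mult x y) u)"
    using v by (elim disjE insertE emptyE) (simp_all add: simps)
  show "oct_mult (oct_mult u x) u = oct_mult u (oct_mult x u)"
    using v by (elim disjE insertE emptyE) (simp_all add: simps)
  show "oct_mult (oct_cnj u) (oct_mult u x) = x"
    using v by (elim disjE insertE emptyE) (simp_all add: simps)
  show "oct_mult (oct_mult x u) (oct_cnj u) = x"
    using v by (elim disjE insertE emptyE) (simp_all add: simps)
qed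

section \<open>Twists of the Cayley plane\<close>

text \<open>For associative coefficients this would be conjugation by the diagonal matrix with w, 1
  and the conjugate of w at i, j and the third index. For octonions the maps x to w x, x to x w and
  x to w (x w) form a triality triple: (w x) (y w) = w ((x y) w) is a Moufang identity.\<close>

definition otwist_entry :: "3 \<Rightarrow> 3 \<Rightarrow> oct \<Rightarrow> 3 \<Rightarrow> 3 \<Rightarrow> oct \<Rightarrow> oct" where
  "otwist_entry i j w a b x =
    (if a = b then x
     else if a = i then (if b = j then oct_mult w x else oct_mult w (oct_mult x w))
     else if a = j then (if b = i then oct_mult x (oct_cnj w) else oct_mult x w)
     else if b = i then oct_mult (oct_cnj w) (oct_mult x (oct_cnj w))
     else oct_mult (oct_cnj w) x)"

definition otwist :: "3 \<Rightarrow> 3 \<Rightarrow> oct \<Rightarrow> oct ^ 3 ^ 3 \<Rightarrow> oct ^ 3 ^ 3" where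
  "otwist i j w p = (\<chi> a b. otwist_entry i j w a b (p $ a $ b))"

lemma otwist_nth: "otwist i j w p $ a $ b = otwist_entry i j w a b (p $ a $ b)"
  by (simp add: otwist_def)

lemma third_index:
  fixes i j :: 3
  assumes "i \<noteq> j"
  obtains k where "k \<noteq> i" "k \<noteq> j" "UNIV = {i, j, k}"
proof -
  have "card (UNIV - {i, j} :: 3 set) = 1" using assms by (simp add: card_Diff_subset)
  then obtain k where k: "UNIV - {i, j} = {k}" by (auto simp: card_1_singleton_iff)
  then have "UNIV = {i, j, k}" by blast
  moreover have "k \<noteq> i" "k \<noteq> j" using k by auto
  ultimately show ?thesis using that by blast
qed

lemma norm_otwist_entry: "norm w = 1 \<Longrightarrow> norm (otwist_entry i j w a b x) = norm x"
  by (simp add: otwist_entry_def norm_oct_mult oct_alg.norm_c)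

text \<open>Off the diagonal, idempotency of a 3 x 3 hermitian matrix with real diagonal amounts to
  one product: p_ar p_rb = (1 - d_a - d_b) p_ab with r the third index. The Moufang identities carry
  this over to the twisted entries. On the diagonal only norms occur, and these are
  preserved.\<close>

lemma otwist_P:
  assumes p: "p \<in> (oct_alg.proj :: (oct ^ 3 ^ 3) set)" and w: "w \<in> oct_units" and ij: "i \<noteq> j"
  shows "otwist i j w p \<in> oct_alg.proj"
proof -
  note M = oct_moufang[OF w] and M' = oct_moufang[OF oct_units_cnj[OF w], unfolded oct_alg.c_c]
  obtain k where k: "k \<noteq> i" "k \<noteq> j" "UNIV = {i, j, k}" by (rule third_index[OF ij])
  let ?q = "otwist i j w p"
  have herm: "?q $ b $ a = oct_cnj (?q $ a $ b)" for a b
  proof -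
    have "a \<in> {i, j, k}" "b \<in> {i, j, k}" using k(3) by blast+
    then show ?thesis using ij k(1,2)
      by (auto simp: otwist_nth otwist_entry_def oct_alg.c_m oct_alg.c_c oct_alg.P_hermitian[OF p] M(4) M'(4))
  qed
  have diag: "?q $ a $ a = p $ a $ a" for a
    by (simp add: otwist_nth otwist_entry_def)
  have idem: "(\<Sum>r\<in>UNIV. oct_mult (?q $ a $ r) (?q $ r $ b)) = ?q $ a $ b" for a b
  proof (cases "a = b")
    case True
    have "(\<Sum>r\<in>UNIV. oct_mult (?q $ a $ r) (?q $ r $ a)) = (\<Sum>r\<in>UNIV. (norm (?q $ a $ r))\<^sup>2) *\<^sub>R ((1, 0), 0)"
      by (rule oct_alg.sum_m_hermitian) (rule herm)
    also have "\<dots> = (\<Sum>r\<in>UNIV. (norm (p $ a $ r))\<^sup>2) *\<^sub>R ((1, 0), 0)"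
      by (simp add: otwist_nth norm_otwist_entry norm_oct_units[OF w])
    also have "\<dots> = p $ a $ a"
      using oct_alg.P_diag[OF p, of a] by simp
    finally show ?thesis using True by (simp add: diag)
  next
    case False
    define o1 :: oct where "o1 = ((1, 0), 0)"
    obtain d where d: "\<And>r. p $ r $ r = d r *\<^sub>R o1"
      using oct_alg.P_diag(1)[OF p] unfolding o1_def by blast
    have sum3: "(\<Sum>r\<in>UNIV. f r) = f i + f j + f k" for f :: "3 \<Rightarrow> oct"
      unfolding k(3) using ij k(1,2) by (simp add: add.assoc)
    have P: "p $ a $ b = oct_mult (p $ a $ i) (p $ i $ b) + oct_mult (p $ a $ j) (p $ j $ b) + oct_mult (p $ a $ k) (p $ k $ b)" for a b
      using oct_alg.P_idempotent[OF p, of a b] unfolding sum3 by simp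
    have scal: "oct_mult (d r *\<^sub>R o1) x = d r *\<^sub>R x" "oct_mult x (d r *\<^sub>R o1) = d r *\<^sub>R x" for r x
      unfolding o1_def oct_alg.m_simps oct_alg.m_e by (rule refl)+
    have off: "oct_mult (p $ a $ r) (p $ r $ b) = (1 - d a - d b) *\<^sub>R p $ a $ b"
      if "a \<noteq> b" "a \<noteq> r" "b \<noteq> r" for a b r
    proof -
      have "a \<in> {i, j, k}" "b \<in> {i, j, k}" "r \<in> {i, j, k}" using k(3) by blast+
      then have "p $ a $ b = d a *\<^sub>R p $ a $ b + d b *\<^sub>R p $ a $ b + oct_mult (p $ a $ r) (p $ r $ b)"
        using that ij k(1,2) P[of a b] by (auto simp: d scal add_ac)
      then show ?thesis by (simp add: scaleR_diff_left algebra_simps)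
    qed
    have q_off: "oct_mult (?q $ a $ r) (?q $ r $ b) = otwist_entry i j w a b (oct_mult (p $ a $ r) (p $ r $ b))"
      if "a \<noteq> r" "b \<noteq> r" for r
    proof -
      have "a \<in> {i, j, k}" "b \<in> {i, j, k}" "r \<in> {i, j, k}" using k(3) by blast+
      then show ?thesis using False that ij k(1,2)
        by (auto simp: otwist_nth otwist_entry_def M M')
    qed
    have lin: "otwist_entry i j w a b (s *\<^sub>R x) = s *\<^sub>R otwist_entry i j w a b x" for s x
      by (simp add: otwist_entry_def oct_alg.m_simps)
    obtain r where r: "r \<noteq> a" "r \<noteq> b" "UNIV = {a, b, r}" by (rule third_index[OF False])
    have "(\<Sum>s\<in>UNIV. oct_mult (?q $ a $ s) (?q $ s $ b))
        = oct_mult (?q $ a $ a) (?q $ a $ b) + oct_mult (?q $ a $ b) (?q $ b $ b) + oct_mult (?q $ a $ r) (?q $ r $ b)"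
      unfolding r(3) using r(1,2) False by (simp add: add.assoc)
    also have "\<dots> = d a *\<^sub>R ?q $ a $ b + d b *\<^sub>R ?q $ a $ b + (1 - d a - d b) *\<^sub>R ?q $ a $ b"
      unfolding q_off[OF r(1)[symmetric] r(2)[symmetric]] off[OF False r(1)[symmetric] r(2)[symmetric]] lin diag d scal
      by (simp add: otwist_nth)
    also have "\<dots> = ?q $ a $ b" by (simp flip: scaleR_add_left)
    finally show ?thesis .
  qed
  have "(\<Sum>r\<in>UNIV. ?q $ r $ r) = ((1, 0), 0)" by (simp add: diag oct_alg.P_trace[OF p])
  then show ?thesis using herm idem unfolding oct_alg.P_iff by blast
qed

lemma otwist_iso:
  assumes w: "w \<in> oct_units" and ij: "i \<noteq> j"
  shows "points_isometry oct_alg.proj (otwist i j w) (otwist i j (oct_cnj w))"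
proof -
  have lin: "linear (otwist i j v)" for v
    by (intro linearI) (simp_all add: vec_eq_iff otwist_nth otwist_entry_def oct_alg.m_simps)
  have inv: "otwist i j (oct_cnj v) (otwist i j v p) = p" if v: "v \<in> oct_units" for v p
  proof -
    note M = oct_moufang[OF v] and M' = oct_moufang[OF oct_units_cnj[OF v], unfolded oct_alg.c_c]
    have "oct_mult (oct_cnj v) (oct_mult (oct_mult v (oct_mult x v)) (oct_cnj v)) = x" for x
      unfolding M(4)[symmetric] M(6) M(5) ..
    moreover have "oct_mult v (oct_mult (oct_mult (oct_cnj v) (oct_mult x (oct_cnj v))) v) = x" for x
      unfolding M'(4)[symmetric] M'(6) M'(5) ..
    ultimately show ?thesis
      by (simp add: vec_eq_iff otwist_nth otwist_entry_def oct_alg.c_c M(5,6) M'(5,6))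
  qed
  have "norm (otwist i j w p) = norm p" for p
    by (simp add: norm_vec_def otwist_nth norm_otwist_entry norm_oct_units[OF w])
  then show ?thesis
    using lin otwist_P[OF _ w ij] otwist_P[OF _ oct_units_cnj[OF w] ij] inv[OF w] inv[OF oct_units_cnj[OF w]]
    by (auto simp: points_isometry_def oct_alg.c_c)
qed

text \<open>The forward twist takes the conjugate of u, since left multiplication by it sends u to
  the unit and hence the u-component to the real part.\<close>

lemma twisted_projective_oct:
  "twisted_projective oct_mult oct_cnj ((1, 0), 0) 3 (\<lambda>i j u. otwist i j (oct_cnj u)) (\<lambda>i j u. otwist i j u)"
proof (rule twisted_projective.intro[OF oct_alg.conj_algebra_axioms], rule twisted_projective_axioms.intro)
  show "norm (oct_mult x y) = norm x * norm y" for x y by (rule norm_oct_mult)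
  fix i j :: 3 and u :: oct assume ij: "i \<noteq> j" and u: "u \<in> Basis"
  then have unit: "u \<in> oct_units" by (simp add: oct_units_def)
  show "points_isometry oct_alg.proj (otwist i j (oct_cnj u)) (otwist i j u)"
    using otwist_iso[OF oct_units_cnj[OF unit] ij] by (simp add: oct_alg.c_c)
  show "otwist i j u x $ i $ i = x $ i $ i" for x by (simp add: otwist_nth otwist_entry_def)
  show "otwist i j (oct_cnj u) p $ k $ k = p $ k $ k" for p k by (simp add: otwist_nth otwist_entry_def)
  show "otwist i j (oct_cnj u) x $ i $ j \<bullet> ((1, 0), 0) = x $ i $ j \<bullet> u" for x
  proof -
    have "oct_mult (oct_cnj u) y \<bullet> ((1, 0), 0) = y \<bullet> u" for y
      using oct_alg.inner_m_cnj[of "oct_cnj u" "oct_cnj y"]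
        oct_alg.inner_c by (simp add: oct_alg.c_c inner_commute)
    then show ?thesis using ij by (simp add: otwist_nth otwist_entry_def)
  qed
  show "otwist i j u x $ i $ j = otwist i j u y $ i $ j + r *\<^sub>R u"
    if "x $ i $ j = y $ i $ j + r *\<^sub>R ((1, 0), 0)" for x y r
  proof -
    have entry: "otwist i j u z $ i $ j = oct_mult u (z $ i $ j)" for z
      using ij by (simp add: otwist_nth otwist_entry_def)
    show ?thesis unfolding entry that oct_alg.m_simps oct_alg.m_e ..
  qed
qed auto

text \<open>The index type \<open>'n\<close> counts homogeneous coordinates, one more than the
  dimension over the coefficients: two or more give the spheres from the circle on, three or more
  the projective spaces from the planes on.\<close>

theorem theorem1p10:
  fixes \<psi>1 \<psi>2 :: "real \<Rightarrow> real"
  assumes "continuous_on {0..} \<psi>1" and "continuous_on {0..} \<psi>2"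
    and "comparable_oscillation \<psi>1 \<psi>2"
  shows "(CARD('n::finite) \<ge> 2 \<longrightarrow>
            mutually_transferrable (sphere_space :: (real ^ 'n) symspace) \<psi>1 \<psi>2) \<and>
         (CARD('n) \<ge> 3 \<longrightarrow>
            mutually_transferrable (real_projective :: (real ^ 'n ^ 'n) symspace) \<psi>1 \<psi>2 \<and>
            mutually_transferrable (complex_projective :: (complex ^ 'n ^ 'n) symspace) \<psi>1 \<psi>2 \<and>
            mutually_transferrable (quat_projective :: (quat ^ 'n ^ 'n) symspace) \<psi>1 \<psi>2) \<and>
         mutually_transferrable cayley_plane \<psi>1 \<psi>2"
proof (intro conjI impI)
  show "mutually_transferrable (sphere_space :: (real ^ 'n) symspace) \<psi>1 \<psi>2" if "CARD('n) \<ge> 2"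
    by (rule sphere_mutually_transferrable[OF assms that])
  show "mutually_transferrable cayley_plane \<psi>1 \<psi>2"
    unfolding cayley_plane_def
    by (rule twisted_projective.projective_mutually_transferrable[OF twisted_projective_oct assms])
  assume "CARD('n) \<ge> 3"
  then have n: "CARD('n) \<ge> 2" by simp
  show "mutually_transferrable (real_projective :: (real ^ 'n ^ 'n) symspace) \<psi>1 \<psi>2"
    unfolding real_projective_def
    by (rule twisted_projective.projective_mutually_transferrable[OF real_alg.twisted_projective_assoc[OF n] assms]) simp
  show "mutually_transferrable (complex_projective :: (complex ^ 'n ^ 'n) symspace) \<psi>1 \<psi>2"
    unfolding complex_projective_def
    by (rule twisted_projective.projective_mutually_transferrable[OF complex_alg.twisted_projective_assoc[OF n] assms]) simp
  show "mutually_transferrable (quat_projective :: (quat ^ 'n ^ 'n) symspace) \<psi>1 \<psi>2"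
    unfolding quat_projective_def
    by (rule twisted_projective.projective_mutually_transferrable[OF quat_alg.twisted_projective_assoc[OF n] assms]) simp
qed

end
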